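(* Let $m\in\mathbb{Z}$ and let $D_{s,t,\varepsilon_1,\varepsilon_2}$ be the family of perturbed Dirac operators on the cylinder $M=\mathbb{R}\times S^1$ defined in the context. Take $s=1$, $t=0$ and $\varepsilon_1>\varepsilon_2\ge 0$. Then $$\ker_{L^2}(D^+_{1,0,\varepsilon_1,\varepsilon_2})=\overline{\mathbb{C}\langle\{\delta_{m0}\,a_n(r)e^{2\pi\sqrt{-1}n\theta}\mid n\in\mathbb{Z}\}\rangle},\qquad \ker_{L^2}(D^-_{1,0,\varepsilon_1,\varepsilon_2})=0,$$ where $\delta_{m0}$ is the Kronecker delta, the bar denotes $L^2$-closure of the linear span, and $$a_n(r)=\exp\left(2\pi\int^r\big((n-\rho)-f^{\varepsilon_1}\rho\big)\,dr\right).$$ In particular, $$\chi_{S^1}(M,\mu)=\bigoplus_{n\in\mathbb{Z}}\delta_{m0}\,\mathbb{C}_{(n)},$$ i.e. every weight $n\in\mathbb{Z}$ has multiplicity $\delta_{m0}$.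
   Context: Let $m\in\mathbb{Z}$, $M=\mathbb{R}\times S^1$ with coordinates $(r,\theta)$ ($S^1=\mathbb{R}/\mathbb{Z}$), metric $g=dr^2+d\theta^2$, symplectic form $\omega=dr\wedge d\theta$, almost complex structure $J\partial_r=\partial_\theta$, $J\partial_\theta=-\partial_r$. Let $W^+=M\times\mathbb{C}$, $W^-=TM_{\mathbb{C}}=(TM,J)$ with frame $\partial_\theta$, $W=W^+\oplus W^-$, with Clifford action $c(dr)=\begin{pmatrix}0&-\sqrt{-1}\\ -\sqrt{-1}&0\end{pmatrix}$, $c(d\theta)=\begin{pmatrix}0&-1\\ 1&0\end{pmatrix}$. Let $\rho:\mathbb{R}\to\mathbb{R}$ be a smooth non-decreasing function with $\rho(r)=r$ for $m-1/4<r<m+1/4$, $\rho(r)=m-1/2$ for $r<m-1/2$, $\rho(r)=m+1/2$ for $r>m+1/2$. Let $\nabla^W=d-2\pi\sqrt{-1}\rho(r)\,d\theta$ be the Clifford connection and $$D=\begin{pmatrix}0&-\partial_\theta-\sqrt{-1}\partial_r+2\pi\sqrt{-1}\rho\\ \partial_\theta-\sqrt{-1}\partial_r-2\pi\sqrt{-1}\rho&0\end{pmatrix},\quad D_{S^1}=\begin{pmatrix}0&-\partial_\theta+2\pi\sqrt{-1}\rho\\ \partial_\theta-2\pi\sqrt{-1}\rho&0\end{pmatrix}.$$ $S^1$ acts on $M$ by rotation, with the lift to $W$ trivial on the fiber direction; the line spanned by a section $a(r)e^{2\pi\sqrt{-1}n\theta}$ is identified with the weight-$n$ representation $\mathbb{C}_{(n)}$.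 Put $\mu:=-2\pi\rho$ and $\mu^M:=-2\pi\rho\,\partial_\theta$ (the induced vector field). Let $f$ be a smooth positive function on $M$ depending only on $r$, with $f=|r|$ for $|r|$ sufficiently large. For $s,t,\varepsilon_1,\varepsilon_2\ge0$ put $D_{s,t,\varepsilon_1,\varepsilon_2}:=D+\sqrt{-1}sf^{\varepsilon_1}c(\mu^M)+tf^{\varepsilon_2}D_{S^1}=\begin{pmatrix}0&D^-_{s,t,\varepsilon_1,\varepsilon_2}\\ D^+_{s,t,\varepsilon_1,\varepsilon_2}&0\end{pmatrix}$, where $$D^{+}_{s,t,\varepsilon_1,\varepsilon_2}=(1+tf^{\varepsilon_2})(\partial_\theta-2\pi\sqrt{-1}\rho)-\sqrt{-1}\partial_r-2\pi\sqrt{-1}sf^{\varepsilon_1}\rho,$$ $$D^{-}_{s,t,\varepsilon_1,\varepsilon_2}=-(1+tf^{\varepsilon_2})(\partial_\theta-2\pi\sqrt{-1}\rho)-\sqrt{-1}\partial_r+2\pi\sqrt{-1}sf^{\varepsilon_1}\rho.$$ $\ker_{L^2}$ denotes the space of $L^2$-solutions. The transverse index $\chi_{S^1}(M,\mu)$ in Braverman's analytic realization is the formal difference of $S^1$-representations $\ker_{L^2}(D^+_{1,0,\varepsilon_1,\varepsilon_2})-\ker_{L^2}(D^-_{1,0,\varepsilon_1,\varepsilon_2})$ for $\varepsilon_1>0$, taken weight by weight. $\int^r$ denotes a primitive (any choice, affecting $a_n$ only by a positive constant). *)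

theory Defs
  imports "HOL-Analysis.Analysis"
begin

text \<open>
  Functions on the cylinder \<open>M = R \<times> R/Z\<close> are functions of \<open>(r, \<theta>)\<close> on the plane that are
  1-periodic in \<open>\<theta>\<close>; integration over \<open>M\<close> uses the fundamental domain \<open>0 \<le> \<theta> < 1\<close>.
  Sections of \<open>W\<^sup>+ = M \<times> C\<close> and of \<open>W\<^sup>-\<close> (in the rotation-invariant unit frame \<open>\<partial>\<^sub>\<theta>\<close>) are both
  complex-valued functions; sections of \<open>W\<close> take values in \<open>C\<^sup>2\<close>.
\<close>

definition cyl :: "(real \<times> real) measure" where
  "cyl = lborel \<Otimes>\<^sub>M restrict_space lborel {0..<1}"

definition periodic :: "(real \<times> real \<Rightarrow> complex) \<Rightarrow> bool" where
  "periodic u \<longleftrightarrow> (\<forall>r \<theta>. u (r, \<theta> + 1) = u (r, \<theta>))"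

definition pd_r :: "(real \<times> real \<Rightarrow> 'a::real_normed_vector) \<Rightarrow> real \<times> real \<Rightarrow> 'a" where
  "pd_r u p = vector_derivative (\<lambda>x. u (x, snd p)) (at (fst p))"

definition pd_th :: "(real \<times> real \<Rightarrow> 'a::real_normed_vector) \<Rightarrow> real \<times> real \<Rightarrow> 'a" where
  "pd_th u p = vector_derivative (\<lambda>y. u (fst p, y)) (at (snd p))"

definition smooth_fun :: "(real \<Rightarrow> real) \<Rightarrow> bool" where
  "smooth_fun h \<longleftrightarrow> (\<forall>k x. ((deriv ^^ k) h) differentiable (at x))"

text \<open>\<open>C\<^sup>\<infinity>\<close>: the function and all its iterated partial derivatives are differentiable.\<close>

coinductive smooth_sec :: "(real \<times> real \<Rightarrow> complex) \<Rightarrow> bool" where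
  "(\<forall>p. u differentiable (at p)) \<Longrightarrow> smooth_sec (pd_r u) \<Longrightarrow> smooth_sec (pd_th u) \<Longrightarrow> smooth_sec u"

definition test_sec :: "(real \<times> real \<Rightarrow> complex) \<Rightarrow> bool" where
  "test_sec \<phi> \<longleftrightarrow> smooth_sec \<phi> \<and> periodic \<phi> \<and> (\<exists>R. \<forall>r \<theta>. \<bar>r\<bar> > R \<longrightarrow> \<phi> (r, \<theta>) = 0)"


section \<open>The perturbed Dirac operators\<close>

definition c_dr :: "complex^2^2" where
  "c_dr = vector [vector [0, - \<i>], vector [- \<i>, 0]]"

definition c_dth :: "complex^2^2" where
  "c_dth = vector [vector [0, - 1], vector [1, 0]]"

text \<open>The connection \<open>d - 2\<pi>\<i>\<rho> d\<theta>\<close> in the direction \<open>\<partial>\<^sub>\<theta>\<close>; in the direction \<open>\<partial>\<^sub>r\<close> it is \<open>pd_r\<close>.\<close>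

definition nabla_th ::
  "(real \<Rightarrow> real) \<Rightarrow> (real \<times> real \<Rightarrow> complex^2) \<Rightarrow> real \<times> real \<Rightarrow> complex^2" where
  "nabla_th \<rho> \<Psi> p = pd_th \<Psi> p - (2 * pi * \<i> * \<rho> (fst p)) *s \<Psi> p"

definition dirac ::
  "(real \<Rightarrow> real) \<Rightarrow> (real \<times> real \<Rightarrow> complex^2) \<Rightarrow> real \<times> real \<Rightarrow> complex^2" where
  "dirac \<rho> \<Psi> p = c_dr *v pd_r \<Psi> p + c_dth *v nabla_th \<rho> \<Psi> p"

definition dirac_circle ::
  "(real \<Rightarrow> real) \<Rightarrow> (real \<times> real \<Rightarrow> complex^2) \<Rightarrow> real \<times> real \<Rightarrow> complex^2" where
  "dirac_circle \<rho> \<Psi> p = c_dth *v nabla_th \<rho> \<Psi> p"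

text \<open>Clifford action of \<open>\<mu>\<^sup>M = -2\<pi>\<rho> \<partial>\<^sub>\<theta>\<close>, which the metric identifies with \<open>-2\<pi>\<rho> d\<theta>\<close>.\<close>

definition c_mu :: "(real \<Rightarrow> real) \<Rightarrow> real \<times> real \<Rightarrow> complex^2 \<Rightarrow> complex^2" where
  "c_mu \<rho> p w = complex_of_real (- 2 * pi * \<rho> (fst p)) *s (c_dth *v w)"

definition dirac_pert ::
  "(real \<Rightarrow> real) \<Rightarrow> (real \<Rightarrow> real) \<Rightarrow> real \<Rightarrow> real \<Rightarrow> real \<Rightarrow> real
    \<Rightarrow> (real \<times> real \<Rightarrow> complex^2) \<Rightarrow> real \<times> real \<Rightarrow> complex^2" where
  "dirac_pert \<rho> f s t \<epsilon>\<^sub>1 \<epsilon>\<^sub>2 \<Psi> p =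
     dirac \<rho> \<Psi> p + (\<i> * complex_of_real (s * f (fst p) powr \<epsilon>\<^sub>1)) *s c_mu \<rho> p (\<Psi> p)
       + complex_of_real (t * f (fst p) powr \<epsilon>\<^sub>2) *s dirac_circle \<rho> \<Psi> p"

definition dirac_plus ::
  "(real \<Rightarrow> real) \<Rightarrow> (real \<Rightarrow> real) \<Rightarrow> real \<Rightarrow> real \<Rightarrow> real \<Rightarrow> real
    \<Rightarrow> (real \<times> real \<Rightarrow> complex) \<Rightarrow> real \<times> real \<Rightarrow> complex" where
  "dirac_plus \<rho> f s t \<epsilon>\<^sub>1 \<epsilon>\<^sub>2 u p =
     complex_of_real (1 + t * f (fst p) powr \<epsilon>\<^sub>2) * (pd_th u p - 2 * pi * \<i> * \<rho> (fst p) * u p)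
       - \<i> * pd_r u p - 2 * pi * \<i> * complex_of_real (s * f (fst p) powr \<epsilon>\<^sub>1 * \<rho> (fst p)) * u p"

definition dirac_minus ::
  "(real \<Rightarrow> real) \<Rightarrow> (real \<Rightarrow> real) \<Rightarrow> real \<Rightarrow> real \<Rightarrow> real \<Rightarrow> real
    \<Rightarrow> (real \<times> real \<Rightarrow> complex) \<Rightarrow> real \<times> real \<Rightarrow> complex" where
  "dirac_minus \<rho> f s t \<epsilon>\<^sub>1 \<epsilon>\<^sub>2 v p =
     - complex_of_real (1 + t * f (fst p) powr \<epsilon>\<^sub>2) * (pd_th v p - 2 * pi * \<i> * \<rho> (fst p) * v p)
       - \<i> * pd_r v p + 2 * pi * \<i> * complex_of_real (s * f (fst p) powr \<epsilon>\<^sub>1 * \<rho> (fst p)) * v p"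

lemma vector_derivative_pair:
  fixes g h :: "real \<Rightarrow> complex"
  assumes "g differentiable (at x)" "h differentiable (at x)"
  shows "vector_derivative (\<lambda>x. vector [g x, h x] :: complex^2) (at x)
       = vector [vector_derivative g (at x), vector_derivative h (at x)]"
proof (rule vector_derivative_at)
  have g: "(g has_derivative (\<lambda>y. y *\<^sub>R vector_derivative g (at x))) (at x)"
    and h: "(h has_derivative (\<lambda>y. y *\<^sub>R vector_derivative h (at x))) (at x)"
    using assms vector_derivative_works unfolding has_vector_derivative_def by blast+
  have axis: "(vector [a, b] :: complex^2) = axis 1 a + axis 2 b" for a b :: complex
    by (simp add: vec_eq_iff forall_2 axis_def)
  have bl: "bounded_linear (axis i :: complex \<Rightarrow> complex^2)" for i
    by (rule linear_conv_bounded_linear[THEN iffD1], rule linearI)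
       (auto simp: vec_eq_iff axis_def)
  have "((\<lambda>x. axis 1 (g x) + axis 2 (h x) :: complex^2) has_derivative
      (\<lambda>y. axis 1 (y *\<^sub>R vector_derivative g (at x)) + axis 2 (y *\<^sub>R vector_derivative h (at x)))) (at x)"
    by (intro has_derivative_add bounded_linear.has_derivative[OF bl] g h)
  moreover have "axis 1 (y *\<^sub>R a) + axis 2 (y *\<^sub>R b) = y *\<^sub>R (axis 1 a + axis 2 b :: complex^2)"
    for y :: real and a b :: complex
    by (simp add: vec_eq_iff axis_def)
  ultimately show "((\<lambda>x. vector [g x, h x] :: complex^2) has_vector_derivative
      vector [vector_derivative g (at x), vector_derivative h (at x)]) (at x)"
    unfolding has_vector_derivative_def axis by simp
qed

lemma dirac_pert_blocks:
  assumes "(\<lambda>x. u (x, snd p)) differentiable (at (fst p))" "(\<lambda>y. u (fst p, y)) differentiable (at (snd p))"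
    and "(\<lambda>x. v (x, snd p)) differentiable (at (fst p))" "(\<lambda>y. v (fst p, y)) differentiable (at (snd p))"
  shows "dirac_pert \<rho> f s t \<epsilon>\<^sub>1 \<epsilon>\<^sub>2 (\<lambda>q. vector [u q, v q]) p
       = vector [dirac_minus \<rho> f s t \<epsilon>\<^sub>1 \<epsilon>\<^sub>2 v p, dirac_plus \<rho> f s t \<epsilon>\<^sub>1 \<epsilon>\<^sub>2 u p]"
proof -
  have "pd_r (\<lambda>q. vector [u q, v q] :: complex^2) p = vector [pd_r u p, pd_r v p]"
       "pd_th (\<lambda>q. vector [u q, v q] :: complex^2) p = vector [pd_th u p, pd_th v p]"
    using assms by (simp_all add: pd_r_def pd_th_def vector_derivative_pair)
  then show ?thesis
    by (simp add: dirac_pert_def dirac_def dirac_circle_def c_mu_def nabla_th_def c_dr_def c_dth_def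
        dirac_plus_def dirac_minus_def vec_eq_iff forall_2 matrix_vector_mult_def sum_2 algebra_simps)
qed


section \<open>Square-integrable solutions\<close>

text \<open>
  Elements of \<open>L\<^sup>2\<close> are represented by functions. The kernels and closures below are
  invariant under changing a representative on a null set, so an equation between two of them is an
  equation between subspaces of \<open>L\<^sup>2\<close>.
\<close>

definition L2 :: "(real \<times> real \<Rightarrow> complex) set" where
  "L2 = {u. u \<in> borel_measurable borel \<and> periodic u \<and> integrable cyl (\<lambda>p. (norm (u p))\<^sup>2)}"

definition L2_null :: "(real \<times> real \<Rightarrow> complex) set" where
  "L2_null = {u \<in> L2. AE p in cyl. u p = 0}"

definition cspan :: "(real \<times> real \<Rightarrow> complex) set \<Rightarrow> (real \<times> real \<Rightarrow> complex) set" where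
  "cspan S = {\<lambda>p. \<Sum>v\<in>F. c v * v p | F c. finite F \<and> F \<subseteq> S}"

definition L2_closure :: "(real \<times> real \<Rightarrow> complex) set \<Rightarrow> (real \<times> real \<Rightarrow> complex) set" where
  "L2_closure S = {u \<in> L2. \<forall>e>0. \<exists>v\<in>S \<inter> L2. (LINT p|cyl. (norm (u p - v p))\<^sup>2) < e}"

text \<open>
  Solutions are understood in the sense of distributions. Since \<open>f\<close> and \<open>\<rho>\<close> are real and depend on
  \<open>r\<close> only, \<open>dirac_minus\<close> is the formal \<open>L\<^sup>2\<close>-adjoint of \<open>dirac_plus\<close>, and vice versa.
\<close>

definition ker_plus ::
  "(real \<Rightarrow> real) \<Rightarrow> (real \<Rightarrow> real) \<Rightarrow> real \<Rightarrow> real \<Rightarrow> real \<Rightarrow> real \<Rightarrow> (real \<times> real \<Rightarrow> complex) set" where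
  "ker_plus \<rho> f s t \<epsilon>\<^sub>1 \<epsilon>\<^sub>2 =
     {u \<in> L2. \<forall>\<phi>. test_sec \<phi> \<longrightarrow> (LINT p|cyl. u p * cnj (dirac_minus \<rho> f s t \<epsilon>\<^sub>1 \<epsilon>\<^sub>2 \<phi> p)) = 0}"

definition ker_minus ::
  "(real \<Rightarrow> real) \<Rightarrow> (real \<Rightarrow> real) \<Rightarrow> real \<Rightarrow> real \<Rightarrow> real \<Rightarrow> real \<Rightarrow> (real \<times> real \<Rightarrow> complex) set" where
  "ker_minus \<rho> f s t \<epsilon>\<^sub>1 \<epsilon>\<^sub>2 =
     {v \<in> L2. \<forall>\<phi>. test_sec \<phi> \<longrightarrow> (LINT p|cyl. v p * cnj (dirac_plus \<rho> f s t \<epsilon>\<^sub>1 \<epsilon>\<^sub>2 \<phi> p)) = 0}"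


section \<open>Weights and the transverse index\<close>

text \<open>
  Rotation acts by \<open>u(r, \<theta>) \<mapsto> u(r, \<theta> + \<alpha>)\<close>, so that \<open>a(r) exp(2\<pi>\<i>n\<theta>)\<close> has weight \<open>n\<close>.
\<close>

definition weight_space :: "(real \<times> real \<Rightarrow> complex) set \<Rightarrow> int \<Rightarrow> (real \<times> real \<Rightarrow> complex) set" where
  "weight_space K n = {u \<in> K. \<forall>\<alpha>. AE p in cyl. u (fst p, snd p + \<alpha>) = cis (2 * pi * n * \<alpha>) * u p}"

text \<open>Complex dimension of the image of \<open>V\<close> in \<open>L\<^sup>2\<close>, i.e. modulo null functions.\<close>

definition has_L2_dim :: "(real \<times> real \<Rightarrow> complex) set \<Rightarrow> nat \<Rightarrow> bool" where
  "has_L2_dim V d \<longleftrightarrow>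
     (\<exists>B. finite B \<and> card B = d \<and> B \<subseteq> V
        \<and> (\<forall>c. (AE p in cyl. (\<Sum>b\<in>B. c b * b p) = 0) \<longrightarrow> (\<forall>b\<in>B. c b = 0))
        \<and> (\<forall>u\<in>V. \<exists>c. AE p in cyl. u p = (\<Sum>b\<in>B. c b * b p)))"

definition finite_mult :: "(real \<times> real \<Rightarrow> complex) set \<Rightarrow> int \<Rightarrow> bool" where
  "finite_mult K n \<longleftrightarrow> (\<exists>d. has_L2_dim (weight_space K n) d)"

text \<open>The value is meaningful only under \<open>finite_mult K n\<close>.\<close>

definition weight_mult :: "(real \<times> real \<Rightarrow> complex) set \<Rightarrow> int \<Rightarrow> nat" where
  "weight_mult K n = (THE d. has_L2_dim (weight_space K n) d)"

text \<open>A formal difference of representations is recorded by its integer multiplicity at each weight.\<close>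

definition transverse_index :: "(real \<Rightarrow> real) \<Rightarrow> (real \<Rightarrow> real) \<Rightarrow> real \<Rightarrow> real \<Rightarrow> int \<Rightarrow> int" where
  "transverse_index \<rho> f \<epsilon>\<^sub>1 \<epsilon>\<^sub>2 n =
     int (weight_mult (ker_plus \<rho> f 1 0 \<epsilon>\<^sub>1 \<epsilon>\<^sub>2) n) - int (weight_mult (ker_minus \<rho> f 1 0 \<epsilon>\<^sub>1 \<epsilon>\<^sub>2) n)"

end

theory Submission
  imports Defs
begin

text \<open>
  An \<open>L\<^sup>2\<close> solution is determined by its Fourier modes in \<open>\<theta>\<close>. Testing the equation against
  \<open>exp (- 2\<pi>\<tau>A\<^sub>n) w(r) exp (2\<pi>\<i>n\<theta>)\<close> reduces it, mode by mode, to \<open>\<integral> h w' = 0\<close> for the quotient \<open>h\<close> of the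
  \<open>n\<close>-th mode by the formal solution \<open>exp (2\<pi>\<tau>A\<^sub>n)\<close>, so \<open>h\<close> is constant by du Bois-Reymond. Since
  \<open>A\<^sub>n' = n - (1 + f\<^sup>\<epsilon>) \<rho>\<close> is dominated near \<open>\<plusminus>\<infinity>\<close> by \<open>- |r|\<^sup>\<epsilon> (m \<plusminus> 1/2)\<close>, the function \<open>exp (2\<pi>A\<^sub>n)\<close> decays at both ends
  exactly when \<open>m = 0\<close>, while \<open>exp (- 2\<pi>A\<^sub>n)\<close> never does. Completeness of the Fourier system (from
  Stone-Weierstrass) turns the mode-wise description into the description of the kernels as closed spans.
\<close>

section \<open>Square-integrable functions\<close>

text \<open>The plateau values \<open>m + 1/2\<close> and \<open>m - 1/2\<close> of
  \<open>\<rho>\<close> are half-integers, so neither vanishes, and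
  \<open>\<epsilon>\<^sub>1 > 0\<close> makes \<open>f powr \<epsilon>\<^sub>1\<close> outgrow any
  fixed weight \<open>n\<close>. Hence the derivative of \<open>A n\<close> near each end has the
  sign opposite to the plateau there, whatever \<open>n\<close> is. Decay of
  \<open>exp (2 * pi * A n r)\<close> at both ends asks for \<open>m - 1/2 < 0 < m + 1/2\<close>,
  that is \<open>m = 0\<close>; decay of its reciprocal asks for
  \<open>m + 1/2 < 0 < m - 1/2\<close>, which is impossible. Since \<open>n\<close> does not enter
  these conditions, all weights share one multiplicity. The obstacle is the weak notion of solution:
  a kernel element is only a square-integrable function, and its modes are determined for almost
  every \<open>r\<close> only. Regularity is never established beforehand; derivatives always fall
  on test sections, and smoothness of each mode comes out of du Bois-Reymond. The closed span lies
  in the kernel because pairing with a fixed test section is continuous in L2.\<close>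

lemma continuous_on_compact_bounded:
  assumes "compact S" "continuous_on S g"
  shows "\<exists>B. \<forall>x\<in>S. norm (g x) \<le> B"
  using compact_imp_bounded[OF compact_continuous_image[OF assms(2,1)]] unfolding bounded_iff by simp

text \<open>Kept apart from \<open>L2\<close> so that one notion serves the circle, the radial line
  and the cylinder; \<open>L2\<close> also asks for Borel measurability on the whole plane and for
  periodicity.\<close>

definition sqint :: "'a measure \<Rightarrow> ('a \<Rightarrow> complex) \<Rightarrow> bool" where
  "sqint M g \<longleftrightarrow> g \<in> borel_measurable M \<and> integrable M (\<lambda>x. (cmod (g x))\<^sup>2)"

lemma sqint_measurable [measurable_dest]: "sqint M g \<Longrightarrow> g \<in> borel_measurable M"
  by (simp add: sqint_def)

lemma sqint_integrable: "sqint M g \<Longrightarrow> integrable M (\<lambda>x. (cmod (g x))\<^sup>2)"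
  by (simp add: sqint_def)

lemma sqint_bound:
  assumes "g \<in> borel_measurable M" "integrable M w" "AE x in M. (cmod (g x))\<^sup>2 \<le> w x"
  shows "sqint M g"
  unfolding sqint_def
proof
  show "integrable M (\<lambda>x. (cmod (g x))\<^sup>2)"
  proof (rule Bochner_Integration.integrable_bound[OF assms(2)])
    show "(\<lambda>x. (cmod (g x))\<^sup>2) \<in> borel_measurable M" using assms(1) by measurable
    show "AE x in M. norm ((cmod (g x))\<^sup>2) \<le> norm (w x)" using assms(3) by eventually_elim auto
  qed
qed fact

lemma cmod_add_sq: "(cmod (x + y))\<^sup>2 \<le> 2 * (cmod x)\<^sup>2 + 2 * (cmod y)\<^sup>2"
proof -
  have "(cmod (x + y))\<^sup>2 \<le> (cmod x + cmod y)\<^sup>2" by (simp add: norm_triangle_ineq power_mono)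
  also have "\<dots> \<le> 2 * (cmod x)\<^sup>2 + 2 * (cmod y)\<^sup>2"
    using zero_le_power2[of "cmod x - cmod y"] by (simp add: power2_eq_square algebra_simps)
  finally show ?thesis .
qed

lemma sqint_add:
  assumes "sqint M f" "sqint M g" shows "sqint M (\<lambda>x. f x + g x)"
proof (rule sqint_bound)
  show "integrable M (\<lambda>x. 2 * (cmod (f x))\<^sup>2 + 2 * (cmod (g x))\<^sup>2)"
    using assms by (auto simp: sqint_def)
qed (use assms in \<open>auto simp: sqint_def cmod_add_sq\<close>)

lemma sqint_cmult:
  assumes "sqint M f" shows "sqint M (\<lambda>x. c * f x)"
  using assms by (auto simp: sqint_def norm_mult power_mult_distrib)

lemma sqint_diff:
  assumes "sqint M f" "sqint M g" shows "sqint M (\<lambda>x. f x - g x)"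
  using sqint_add[OF assms(1) sqint_cmult[OF assms(2), of "-1"]] by simp

lemma sqint_zero [simp]: "sqint M (\<lambda>x. 0)" by (simp add: sqint_def)

lemma sqint_sum: "(\<And>i. i \<in> I \<Longrightarrow> sqint M (f i)) \<Longrightarrow> sqint M (\<lambda>x. \<Sum>i\<in>I. f i x)"
  by (induction I rule: infinite_finite_induct) (auto intro: sqint_add)

lemma sqint_cnj: "sqint M f \<Longrightarrow> sqint M (\<lambda>x. cnj (f x))"
  unfolding sqint_def by (auto intro: measurable_compose[OF _ borel_measurable_continuous_onI[OF continuous_on_cnj[OF continuous_on_id]]])

lemma sqint_mult_integrable:
  assumes "sqint M f" "sqint M g" shows "integrable M (\<lambda>x. f x * g x)"
proof (rule Bochner_Integration.integrable_bound)
  show "integrable M (\<lambda>x. (cmod (f x))\<^sup>2 + (cmod (g x))\<^sup>2)"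
    using assms by (auto simp: sqint_def)
  show "(\<lambda>x. f x * g x) \<in> borel_measurable M" using assms by (auto simp: sqint_def)
  have "a * b \<le> a\<^sup>2 + b\<^sup>2" for a b :: real
    using zero_le_power2[of "a - b"] zero_le_power2[of "a"] zero_le_power2[of "b"]
      unfolding power2_diff by linarith
  then show "AE x in M. norm (f x * g x) \<le> norm ((cmod (f x))\<^sup>2 + (cmod (g x))\<^sup>2)"
    by (simp add: norm_mult)
qed

text \<open>A squared form of the triangle inequality at the price of a factor 2; the approximation
  arguments compensate by starting from \<open>e / 4\<close>.\<close>

lemma sqint_triangle:
  assumes "sqint M f" "sqint M g"
  shows "(LINT x|M. (cmod (f x + g x))\<^sup>2) \<le> 2 * (LINT x|M. (cmod (f x))\<^sup>2) + 2 * (LINT x|M. (cmod (g x))\<^sup>2)"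
proof -
  have "(LINT x|M. (cmod (f x + g x))\<^sup>2) \<le> (LINT x|M. 2 * (cmod (f x))\<^sup>2 + 2 * (cmod (g x))\<^sup>2)"
  proof (rule integral_mono)
    show "integrable M (\<lambda>x. 2 * (cmod (f x))\<^sup>2 + 2 * (cmod (g x))\<^sup>2)"
      using assms by (auto simp: sqint_def)
  qed (use sqint_integrable[OF sqint_add[OF assms]] cmod_add_sq in auto)
  also have "\<dots> = 2 * (LINT x|M. (cmod (f x))\<^sup>2) + 2 * (LINT x|M. (cmod (g x))\<^sup>2)"
    using assms by (simp add: sqint_def)
  finally show ?thesis .
qed

text \<open>The limit inherits the bound \<open>w\<close>, so the squared errors are dominated by
  \<open>4 * (w x)\<^sup>2\<close>.\<close>

lemma sqint_dominated_convergence: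
  assumes s: "\<And>k. s k \<in> borel_measurable M" and g: "g \<in> borel_measurable M"
    and w: "integrable M (\<lambda>x. (w x)\<^sup>2)"
    and lim: "AE x in M. (\<lambda>k. s k x) \<longlonglongrightarrow> g x"
    and le: "\<And>k. AE x in M. cmod (s k x) \<le> w x"
  shows "(\<lambda>k. LINT x|M. (cmod (g x - s k x))\<^sup>2) \<longlonglongrightarrow> 0"
proof -
  have "AE x in M. \<forall>k. cmod (s k x) \<le> w x" using le by (simp add: AE_all_countable)
  then have gw: "AE x in M. cmod (g x) \<le> w x" using lim
  proof eventually_elim
    case (elim x)
    show ?case by (rule LIMSEQ_le_const2[OF tendsto_norm[OF elim(2)]]) (use elim(1) in auto)
  qed
  have "(\<lambda>k. LINT x|M. (cmod (g x - s k x))\<^sup>2) \<longlonglongrightarrow> (LINT x|M. 0)"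
  proof (rule integral_dominated_convergence)
    show "integrable M (\<lambda>x. 4 * (w x)\<^sup>2)" using w by simp
    show "AE x in M. (\<lambda>k. (cmod (g x - s k x))\<^sup>2) \<longlonglongrightarrow> 0"
      using lim
    proof eventually_elim
      case (elim x)
      then have "(\<lambda>k. (cmod (g x - s k x))\<^sup>2) \<longlonglongrightarrow> (cmod (g x - g x))\<^sup>2"
        by (intro tendsto_intros)
      then show ?case by simp
    qed
    fix k
    show "AE x in M. norm ((cmod (g x - s k x))\<^sup>2) \<le> 4 * (w x)\<^sup>2"
      using le[of k] gw
    proof eventually_elim
      case (elim x)
      have "cmod (g x - s k x) \<le> 2 * w x"
        using norm_triangle_ineq4[of "g x" "s k x"] elim by linarith
      then have "(cmod (g x - s k x))\<^sup>2 \<le> (2 * w x)\<^sup>2" by (intro power_mono) auto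
      then show ?case by (simp add: power_mult_distrib)
    qed
  qed (use s g in measurable)
  then show ?thesis by simp
qed

section \<open>Fourier series on the circle\<close>

text \<open>The half-open fundamental domain has total mass 1, so the exponentials
  \<open>fexp n\<close> are orthonormal without a normalising factor.\<close>

definition circ :: "real measure" where
  "circ = restrict_space lborel {0..<1}"

lemma space_circ [simp]: "space circ = {0..<1}"
  by (simp add: circ_def)

lemma sets_circD: "A \<in> sets circ \<Longrightarrow> A \<in> sets borel"
  by (auto simp: circ_def sets_restrict_space_iff)

lemma measurable_circI: "f \<in> measurable borel N \<Longrightarrow> f \<in> measurable circ N"
  unfolding circ_def by (rule measurable_restrict_space1) simp

lemma emeasure_circ_space: "emeasure circ {0..<1} = 1"
  by (simp add: circ_def emeasure_restrict_space)

interpretation circ: finite_measure circ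
  by standard (simp add: emeasure_circ_space)

lemma measure_circ_space: "measure circ {0..<1} = 1"
  by (simp add: measure_def emeasure_circ_space)

lemma integral_circ_Icc:
  "(LINT t|circ. g t) = (LINT t:{0..1}|lborel. g t :: 'b :: {banach, second_countable_topology})"
proof -
  have "(LINT t|circ. g t) = (LINT t:{0..<1}|lborel. g t)"
    by (simp add: circ_def integral_restrict_space set_lebesgue_integral_def)
  also have "\<dots> = (LINT t:{0..1}|lborel. g t)"
    by (rule set_integral_discrete_difference[where X = "{1}"]) auto
  finally show ?thesis .
qed

text \<open>Applied to 1-periodic \<open>G\<close>, where the right-hand side vanishes: this gives
  the orthogonality of exponentials and integration by parts along the circle.\<close>

lemma integral_circ_FTC:
  fixes G :: "real \<Rightarrow> 'b :: euclidean_space"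
  assumes "\<And>t. (G has_vector_derivative g t) (at t)" "continuous_on UNIV g"
  shows "(LINT t|circ. g t) = G 1 - G 0"
  unfolding integral_circ_Icc set_lebesgue_integral_def
  using assms
  by (intro integral_FTC_atLeastAtMost)
     (auto intro: has_vector_derivative_at_within continuous_on_subset)

definition fexp :: "int \<Rightarrow> real \<Rightarrow> complex" where
  "fexp n t = cis (2 * pi * of_int n * t)"

lemma fexp_add: "fexp (n + k) t = fexp n t * fexp k t"
  by (simp add: fexp_def cis_mult algebra_simps)

lemma cnj_fexp: "cnj (fexp n t) = fexp (- n) t"
  by (simp add: fexp_def cis_cnj)

lemma norm_fexp [simp]: "cmod (fexp n t) = 1"
  by (simp add: fexp_def)

lemma fexp_0 [simp]: "fexp 0 t = 1"
  by (simp add: fexp_def)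

lemma fexp_shift: "fexp n (t + a) = fexp n a * fexp n t"
  by (simp add: fexp_def cis_mult algebra_simps)

lemma fexp_1 [simp]: "fexp n 1 = 1"
  using cis_multiple_2pi[of "of_int n"] by (simp add: fexp_def mult_ac)

lemma fexp_at_0 [simp]: "fexp n 0 = 1"
  by (simp add: fexp_def)

lemma has_vector_derivative_fexp:
  "(fexp n has_vector_derivative (2 * pi * \<i> * of_int n * fexp n t)) (at t)"
proof -
  have "((\<lambda>z. exp (\<i> * (2 * pi * of_int n * z))) has_field_derivative
      (2 * pi * \<i> * of_int n * exp (\<i> * (2 * pi * of_int n * of_real t)))) (at (of_real t))"
    by (auto intro!: derivative_eq_intros)
  then show ?thesis
    unfolding fexp_def cis_conv_exp
    by (drule_tac has_vector_derivative_real_field) (simp add: mult_ac)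
qed

lemma continuous_fexp: "continuous_on A (fexp n)"
  unfolding fexp_def cis_conv_exp by (intro continuous_intros)

lemma fexp_measurable [measurable]: "fexp n \<in> borel_measurable borel"
  by (intro borel_measurable_continuous_onI continuous_fexp)

lemma integral_fexp: "(LINT t|circ. fexp n t) = (if n = 0 then 1 else 0)"
proof (cases "n = 0")
  case True
  then show ?thesis by (simp add: measure_circ_space)
next
  case False
  have "(LINT t|circ. 2 * pi * \<i> * of_int n * fexp n t) = fexp n 1 - fexp n 0"
    by (intro integral_circ_FTC has_vector_derivative_fexp continuous_intros continuous_fexp)
  then show ?thesis using False by simp
qed

lemma sqint_circ_bounded:
  assumes "g \<in> borel_measurable circ" "\<And>t. cmod (g t) \<le> B"
  shows "sqint circ g"
proof (rule sqint_bound[OF assms(1)])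
  show "integrable circ (\<lambda>_. B\<^sup>2)" by simp
  show "AE t in circ. (cmod (g t))\<^sup>2 \<le> B\<^sup>2" using assms(2) by (auto intro!: power_mono)
qed

lemma sqint_fexp: "sqint circ (fexp n)"
  by (rule sqint_circ_bounded[of _ 1]) (auto intro: measurable_circI)

definition fcoef :: "(real \<Rightarrow> complex) \<Rightarrow> int \<Rightarrow> complex" where
  "fcoef g n = (LINT t|circ. g t * cnj (fexp n t))"

lemma cmod_diff_sq: "(cmod (x - y))\<^sup>2 = (cmod x)\<^sup>2 - 2 * Re (x * cnj y) + (cmod y)\<^sup>2"
  unfolding cmod_power2 by (simp add: power2_eq_square algebra_simps)

text \<open>Expanding the square and using orthonormality, the terms containing \<open>c\<close>
  complete to \<open>(cmod (fcoef g n - c n))\<^sup>2\<close>. Hence the Fourier coefficients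
  minimise the error, and Bessel's inequality is the case \<open>c = fcoef g\<close>.\<close>

lemma bessel_identity:
  assumes g: "sqint circ g" and I: "finite I"
  shows "(LINT t|circ. (cmod (g t - (\<Sum>n\<in>I. c n * fexp n t)))\<^sup>2)
       = (LINT t|circ. (cmod (g t))\<^sup>2) - (\<Sum>n\<in>I. (cmod (fcoef g n))\<^sup>2) + (\<Sum>n\<in>I. (cmod (fcoef g n - c n))\<^sup>2)"
proof -
  define p where "p = (\<lambda>t. \<Sum>n\<in>I. c n * fexp n t)"
  have p: "sqint circ p" unfolding p_def by (intro sqint_sum sqint_cmult sqint_fexp)
  have igp: "integrable circ (\<lambda>t. g t * cnj (p t))"
    by (intro sqint_mult_integrable g sqint_cnj p)
  have igh: "integrable circ (\<lambda>t. g t * cnj (fexp n t))" for n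
    by (intro sqint_mult_integrable g sqint_cnj sqint_fexp)
  have ihh: "integrable circ (\<lambda>t. fexp n t * cnj (fexp k t))" for n k
    by (intro sqint_mult_integrable sqint_cnj sqint_fexp)
  have gp: "(LINT t|circ. g t * cnj (p t)) = (\<Sum>n\<in>I. cnj (c n) * fcoef g n)"
  proof -
    have "(LINT t|circ. g t * cnj (p t)) = (LINT t|circ. (\<Sum>n\<in>I. cnj (c n) * (g t * cnj (fexp n t))))"
      by (simp add: p_def sum_distrib_left mult_ac)
    also have "\<dots> = (\<Sum>n\<in>I. cnj (c n) * fcoef g n)"
      by (subst Bochner_Integration.integral_sum) (auto simp: fcoef_def intro: igh)
    finally show ?thesis .
  qed
  have hh: "(LINT t|circ. fexp n t * cnj (fexp k t)) = (if n = k then 1 else 0)" for n k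
    unfolding cnj_fexp fexp_add[symmetric] integral_fexp by auto
  have pp: "(LINT t|circ. (cmod (p t))\<^sup>2) = (\<Sum>n\<in>I. (cmod (c n))\<^sup>2)"
  proof -
    have "complex_of_real (LINT t|circ. (cmod (p t))\<^sup>2) = (LINT t|circ. complex_of_real ((cmod (p t))\<^sup>2))"
      by (rule integral_complex_of_real[symmetric])
    also have "\<dots> = (LINT t|circ. p t * cnj (p t))" by (simp only: complex_norm_square)
    also have "\<dots> = (LINT t|circ. (\<Sum>n\<in>I. \<Sum>k\<in>I. c n * cnj (c k) * (fexp n t * cnj (fexp k t))))"
      by (simp add: p_def sum_product mult_ac)
    also have "\<dots> = (\<Sum>n\<in>I. \<Sum>k\<in>I. c n * cnj (c k) * (if n = k then 1 else 0))"
      by (subst Bochner_Integration.integral_sum | simp add: ihh hh)+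
    also have "\<dots> = (\<Sum>n\<in>I. c n * cnj (c n))"
      using I by (simp add: if_distrib sum.delta cong: if_cong)
    also have "\<dots> = complex_of_real (\<Sum>n\<in>I. (cmod (c n))\<^sup>2)"
      unfolding of_real_sum complex_norm_square ..
    finally show ?thesis using of_real_eq_iff by blast
  qed
  have "(LINT t|circ. (cmod (g t - p t))\<^sup>2) = (LINT t|circ. (cmod (g t))\<^sup>2 - 2 * Re (g t * cnj (p t)) + (cmod (p t))\<^sup>2)"
    by (simp add: cmod_diff_sq)
  also have "\<dots> = (LINT t|circ. (cmod (g t))\<^sup>2) - 2 * (LINT t|circ. Re (g t * cnj (p t))) + (LINT t|circ. (cmod (p t))\<^sup>2)"
    using g p integrable_Re[OF igp] by (simp add: sqint_def del: times_complex.sel complex_cnj)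
  also have "(LINT t|circ. Re (g t * cnj (p t))) = Re (LINT t|circ. g t * cnj (p t))"
    by (rule integral_Re[OF igp])
  finally have "(LINT t|circ. (cmod (g t - p t))\<^sup>2)
      = (LINT t|circ. (cmod (g t))\<^sup>2) - 2 * Re (\<Sum>n\<in>I. cnj (c n) * fcoef g n) + (\<Sum>n\<in>I. (cmod (c n))\<^sup>2)"
    unfolding gp pp .
  moreover have "(\<Sum>n\<in>I. (cmod (fcoef g n - c n))\<^sup>2)
      = (\<Sum>n\<in>I. (cmod (fcoef g n))\<^sup>2) - 2 * Re (\<Sum>n\<in>I. cnj (c n) * fcoef g n) + (\<Sum>n\<in>I. (cmod (c n))\<^sup>2)"
    by (simp add: cmod_diff_sq sum.distrib sum_subtractf sum_distrib_left mult_ac)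
  ultimately show ?thesis unfolding p_def by simp
qed

section \<open>Trigonometric polynomials\<close>

inductive trigpoly :: "(real \<Rightarrow> complex) \<Rightarrow> bool" where
  fexp: "trigpoly (\<lambda>t. c * fexp n t)"
| add: "trigpoly p \<Longrightarrow> trigpoly q \<Longrightarrow> trigpoly (\<lambda>t. p t + q t)"

lemma trigpoly_const: "trigpoly (\<lambda>t. c)"
  using trigpoly.fexp[of c 0] by simp

lemma trigpoly_mult:
  assumes "trigpoly p" "trigpoly q" shows "trigpoly (\<lambda>t. p t * q t)"
  using assms
proof (induction arbitrary: q)
  case (fexp c n)
  then show ?case
  proof induction
    case (fexp d k)
    have "(\<lambda>t. c * fexp n t * (d * fexp k t)) = (\<lambda>t. (c * d) * fexp (n + k) t)"
      by (simp add: fexp_add mult_ac)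
    then show ?case by (simp only: trigpoly.fexp)
  next
    case (add p q)
    then show ?case by (simp only: distrib_left trigpoly.add)
  qed
next
  case (add p1 p2)
  then show ?case by (simp only: distrib_right trigpoly.add)
qed

lemma trigpoly_sqint: "trigpoly p \<Longrightarrow> sqint circ p"
  by (induction rule: trigpoly.induct) (auto intro: sqint_add sqint_cmult sqint_fexp)

text \<open>Every sufficiently large range is allowed, so that a single approximant bounds the error
  of all later symmetric partial sums.\<close>

lemma trigpoly_expand:
  assumes "trigpoly p"
  shows "\<exists>N. \<forall>M\<ge>N. \<exists>c. \<forall>t. p t = (\<Sum>n\<in>{- int M..int M}. c n * fexp n t)"
  using assms
proof induction
  case (fexp c n)
  have "\<exists>d. \<forall>t. c * fexp n t = (\<Sum>k\<in>{- int M..int M}. d k * fexp k t)" if "M \<ge> nat \<bar>n\<bar>" for M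
  proof (rule exI, rule allI)
    fix t
    have "(\<Sum>k\<in>{- int M..int M}. (if k = n then c else 0) * fexp k t)
        = (\<Sum>k\<in>{- int M..int M}. if k = n then c * fexp n t else 0)"
      by (intro sum.cong) auto
    also have "\<dots> = c * fexp n t" using that by (subst sum.delta) auto
    finally show "c * fexp n t = (\<Sum>k\<in>{- int M..int M}. (if k = n then c else 0) * fexp k t)" by simp
  qed
  then show ?case by blast
next
  case (add p q)
  then obtain N1 N2 where N:
    "\<And>M. M \<ge> N1 \<Longrightarrow> \<exists>c. \<forall>t. p t = (\<Sum>n\<in>{- int M..int M}. c n * fexp n t)"
    "\<And>M. M \<ge> N2 \<Longrightarrow> \<exists>c. \<forall>t. q t = (\<Sum>n\<in>{- int M..int M}. c n * fexp n t)" by blast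
  have "\<exists>c. \<forall>t. p t + q t = (\<Sum>n\<in>{- int M..int M}. c n * fexp n t)" if M: "M \<ge> max N1 N2" for M
  proof -
    obtain c d where "\<forall>t. p t = (\<Sum>n\<in>{- int M..int M}. c n * fexp n t)"
      "\<forall>t. q t = (\<Sum>n\<in>{- int M..int M}. d n * fexp n t)" using N M by (meson max.boundedE)
    then have "\<forall>t. p t + q t = (\<Sum>n\<in>{- int M..int M}. (c n + d n) * fexp n t)"
      by (simp add: sum.distrib distrib_right)
    then show ?thesis by (rule exI[where x = "\<lambda>n. c n + d n"])
  qed
  then show ?case by blast
qed

text \<open>Stone-Weierstrass delivers polynomials in the real and imaginary parts; on the unit
  circle these two coordinates are combinations of \<open>fexp 1\<close> and
  \<open>fexp (- 1)\<close>, and products of exponentials are exponentials.\<close>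

lemma trigpoly_of_polynomial:
  assumes "real_polynomial_function g"
  shows "trigpoly (\<lambda>t. complex_of_real (g (cis (2 * pi * t))))"
  using assms
proof induction
  case (linear f)
  interpret bounded_linear f by fact
  have f: "f z = Re z * f 1 + Im z * f \<i>" for z
  proof -
    have "f z = f (Re z *\<^sub>R 1 + Im z *\<^sub>R \<i>)"
      by (rule arg_cong[where f = f]) (simp add: complex_eq_iff)
    also have "\<dots> = Re z * f 1 + Im z * f \<i>" by (subst add, subst (1 2) scaleR) simp
    finally show ?thesis .
  qed
  \<comment> \<open>Euler's formulas for cosine and sine.\<close>
  have "complex_of_real (f (cis (2 * pi * t)))
      = (f 1 / 2 + f \<i> / (2 * \<i>)) * fexp 1 t + (f 1 / 2 - f \<i> / (2 * \<i>)) * fexp (- 1) t" for t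
    by (subst f) (simp add: fexp_def complex_eq_iff)
  then show ?case by (simp only: trigpoly.intros)
qed (auto intro: trigpoly_const trigpoly.add trigpoly_mult)

section \<open>Density of trigonometric polynomials in L2 of the circle\<close>

definition trig_approx :: "(real \<Rightarrow> complex) \<Rightarrow> bool" where
  "trig_approx g \<longleftrightarrow> sqint circ g \<and> (\<forall>e>0. \<exists>p. trigpoly p \<and> (LINT t|circ. (cmod (g t - p t))\<^sup>2) < e)"

lemma trig_approx_closed:
  assumes g: "sqint circ g"
    and *: "\<And>e. e > 0 \<Longrightarrow> \<exists>h. trig_approx h \<and> (LINT t|circ. (cmod (g t - h t))\<^sup>2) < e"
  shows "trig_approx g"
  unfolding trig_approx_def
proof (intro conjI allI impI g)
  fix e :: real assume e: "e > 0"
  obtain h where h: "trig_approx h" "(LINT t|circ. (cmod (g t - h t))\<^sup>2) < e / 4" using *[of "e/4"] e by auto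
  obtain p where p: "trigpoly p" "(LINT t|circ. (cmod (h t - p t))\<^sup>2) < e / 4"
    using h(1) e unfolding trig_approx_def by (meson zero_less_divide_iff zero_less_numeral)
  have "(LINT t|circ. (cmod (g t - p t))\<^sup>2) = (LINT t|circ. (cmod ((g t - h t) + (h t - p t)))\<^sup>2)" by simp
  also have "\<dots> \<le> 2 * (LINT t|circ. (cmod (g t - h t))\<^sup>2) + 2 * (LINT t|circ. (cmod (h t - p t))\<^sup>2)"
    using g h(1) trigpoly_sqint[OF p(1)]
    by (intro sqint_triangle sqint_diff) (auto simp: trig_approx_def)
  also have "\<dots> < e" using h(2) p(2) by simp
  finally show "\<exists>p. trigpoly p \<and> (LINT t|circ. (cmod (g t - p t))\<^sup>2) < e" using p(1) by blast
qed

lemma trig_approx_trigpoly: "trigpoly p \<Longrightarrow> trig_approx p"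
  unfolding trig_approx_def by (auto intro: trigpoly_sqint exI[of _ p])

lemma trig_approx_add:
  assumes f: "trig_approx f" and g: "trig_approx g" shows "trig_approx (\<lambda>t. f t + g t)"
proof -
  have sf: "sqint circ f" and sg: "sqint circ g" using assms by (auto simp: trig_approx_def)
  show ?thesis unfolding trig_approx_def
  proof (intro conjI allI impI sqint_add sf sg)
    fix e :: real assume e: "e > 0"
    obtain p where p: "trigpoly p" "(LINT t|circ. (cmod (f t - p t))\<^sup>2) < e / 4"
      using f e unfolding trig_approx_def by (meson zero_less_divide_iff zero_less_numeral)
    obtain q where q: "trigpoly q" "(LINT t|circ. (cmod (g t - q t))\<^sup>2) < e / 4"
      using g e unfolding trig_approx_def by (meson zero_less_divide_iff zero_less_numeral)
    have "(LINT t|circ. (cmod (f t + g t - (p t + q t)))\<^sup>2) = (LINT t|circ. (cmod ((f t - p t) + (g t - q t)))\<^sup>2)"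
      by (simp add: algebra_simps)
    also have "\<dots> \<le> 2 * (LINT t|circ. (cmod (f t - p t))\<^sup>2) + 2 * (LINT t|circ. (cmod (g t - q t))\<^sup>2)"
      by (intro sqint_triangle sqint_diff sf sg trigpoly_sqint p q)
    also have "\<dots> < e" using p(2) q(2) by simp
    finally show "\<exists>p. trigpoly p \<and> (LINT t|circ. (cmod (f t + g t - p t))\<^sup>2) < e"
      using trigpoly.add[OF p(1) q(1)] by blast
  qed
qed

lemma trig_approx_cmult:
  assumes f: "trig_approx f" shows "trig_approx (\<lambda>t. c * f t)"
proof (cases "c = 0")
  case True
  then show ?thesis using trig_approx_trigpoly[OF trigpoly_const[of 0]] by simp
next
  case False
  have sf: "sqint circ f" using assms by (auto simp: trig_approx_def)
  show ?thesis unfolding trig_approx_def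
  proof (intro conjI allI impI sqint_cmult sf)
    fix e :: real assume e: "e > 0"
    then have "e / (cmod c)\<^sup>2 > 0" using False by simp
    then obtain p where p: "trigpoly p" "(LINT t|circ. (cmod (f t - p t))\<^sup>2) < e / (cmod c)\<^sup>2"
      using f unfolding trig_approx_def by blast
    have "(LINT t|circ. (cmod (c * f t - c * p t))\<^sup>2) = (cmod c)\<^sup>2 * (LINT t|circ. (cmod (f t - p t))\<^sup>2)"
      by (simp add: norm_mult power_mult_distrib flip: right_diff_distrib)
    also have "\<dots> < e" using p(2) False by (simp add: field_simps)
    finally show "\<exists>p. trigpoly p \<and> (LINT t|circ. (cmod (c * f t - p t))\<^sup>2) < e"
      using trigpoly_mult[OF trigpoly_const[of c] p(1)] by blast
  qed
qed

lemma trig_approx_limit: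
  assumes s: "\<And>k. trig_approx (s k)" and g: "sqint circ g"
    and w: "integrable circ (\<lambda>x. (w x)\<^sup>2)"
    and lim: "AE x in circ. (\<lambda>k. s k x) \<longlonglongrightarrow> g x"
    and le: "\<And>k. AE x in circ. cmod (s k x) \<le> w x"
  shows "trig_approx g"
proof (rule trig_approx_closed[OF g])
  fix e :: real assume "e > 0"
  have "(\<lambda>k. LINT x|circ. (cmod (g x - s k x))\<^sup>2) \<longlonglongrightarrow> 0"
    using s g by (intro sqint_dominated_convergence[OF _ _ w lim le]) (auto simp: trig_approx_def sqint_def)
  then have "\<forall>\<^sub>F k in sequentially. (LINT x|circ. (cmod (g x - s k x))\<^sup>2) < e"
    using \<open>e > 0\<close> by (rule order_tendstoD)
  then obtain k where "(LINT x|circ. (cmod (g x - s k x))\<^sup>2) < e"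
    by (meson eventually_sequentially order_refl)
  then show "\<exists>h. trig_approx h \<and> (LINT t|circ. (cmod (g t - h t))\<^sup>2) < e" using s by blast
qed

lemma trig_approx_cong:
  assumes "trig_approx f" "g \<in> borel_measurable circ" "AE t in circ. g t = f t"
  shows "trig_approx g"
proof -
  have f: "sqint circ f" using assms by (simp add: trig_approx_def)
  have g: "sqint circ g"
    by (rule sqint_bound[OF assms(2) sqint_integrable[OF f]]) (use assms(3) in eventually_elim, simp)
  show ?thesis
  proof (rule trig_approx_closed[OF g])
    fix e :: real assume "e > 0"
    have "(LINT t|circ. (cmod (g t - f t))\<^sup>2) = (LINT t|circ. 0)"
      using assms f g by (intro integral_cong_AE) (auto simp: sqint_def)
    then show "\<exists>h. trig_approx h \<and> (LINT t|circ. (cmod (g t - h t))\<^sup>2) < e"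
      using assms(1) \<open>e > 0\<close> by (intro exI[of _ f]) simp
  qed
qed

text \<open>Composing a function \<open>\<phi>\<close> on the plane with the circle map makes it
  periodic from the start; a uniform error on the circle controls the L2 error because the total
  mass is 1.\<close>

lemma trig_approx_continuous:
  fixes \<phi> :: "complex \<Rightarrow> real"
  assumes "continuous_on UNIV \<phi>"
  shows "trig_approx (\<lambda>t. \<phi> (cis (2 * pi * t)))"
proof -
  have cs: "continuous_on (sphere 0 1) \<phi>" using assms continuous_on_subset by blast
  have "bounded (\<phi> ` sphere 0 1)"
    by (intro compact_imp_bounded compact_continuous_image cs compact_sphere)
  then obtain B where B: "\<And>z. z \<in> sphere 0 1 \<Longrightarrow> \<bar>\<phi> z\<bar> \<le> B" unfolding bounded_iff by (metis imageI real_norm_def)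
  have m: "(\<lambda>t. complex_of_real (\<phi> (cis (2 * pi * t)))) \<in> borel_measurable circ"
    unfolding cis_conv_exp
    by (intro measurable_circI borel_measurable_continuous_onI continuous_on_of_real
        continuous_on_compose2[OF assms] continuous_intros) auto
  have sq: "sqint circ (\<lambda>t. complex_of_real (\<phi> (cis (2 * pi * t))))"
    using B by (intro sqint_circ_bounded[OF m, of B]) simp
  show ?thesis unfolding trig_approx_def
  proof (intro conjI allI impI sq)
    fix e :: real assume e: "e > 0"
    \<comment> \<open>\<open>d \<le> 1\<close> gives \<open>d * d \<le> d\<close>, so
      \<open>d\<close> bounds the squared error too; \<open>e / 2\<close> puts it strictly below
      \<open>e\<close>.\<close>
    define d where "d = min 1 (e / 2)"
    have d: "0 < d" "d \<le> 1" "d < e" using e by (auto simp: d_def)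
    obtain g where g: "real_polynomial_function g" "\<And>z. z \<in> sphere 0 1 \<Longrightarrow> \<bar>\<phi> z - g z\<bar> < d"
      using Stone_Weierstrass_real_polynomial_function[OF compact_sphere cs d(1)] by blast
    define p where "p t = complex_of_real (g (cis (2 * pi * t)))" for t
    have p: "trigpoly p" unfolding p_def by (rule trigpoly_of_polynomial[OF g(1)])
    have le: "(cmod (complex_of_real (\<phi> (cis (2 * pi * t))) - p t))\<^sup>2 \<le> d" for t
    proof -
      have "cmod (complex_of_real (\<phi> (cis (2 * pi * t))) - p t) \<le> d"
        unfolding p_def of_real_diff[symmetric] norm_of_real using g(2)[of "cis (2*pi*t)"] by simp
      then have "(cmod (complex_of_real (\<phi> (cis (2 * pi * t))) - p t))\<^sup>2 \<le> d * d"
        unfolding power2_eq_square by (intro mult_mono) (use d in auto)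
      also have "\<dots> \<le> d * 1" using d by (intro mult_left_mono) auto
      finally show ?thesis by simp
    qed
    have "(LINT t|circ. (cmod (complex_of_real (\<phi> (cis (2 * pi * t))) - p t))\<^sup>2) \<le> (LINT t|circ. d)"
      using sqint_integrable[OF sqint_diff[OF sq trigpoly_sqint[OF p]]] le
      by (intro integral_mono) auto
    also have "\<dots> < e" using d by (simp add: measure_circ_space)
    finally show "\<exists>p. trigpoly p \<and> (LINT t|circ. (cmod (complex_of_real (\<phi> (cis (2 * pi * t))) - p t))\<^sup>2) < e"
      using p by blast
  qed
qed

text \<open>Equality on the circle fixes \<open>s - t\<close> up to an integer, and the bound leaves
  only the integer 0.\<close>

lemma cis_2pi_inj:
  assumes "cis (2 * pi * s) = cis (2 * pi * t)" "\<bar>s - t\<bar> < 1"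
  shows "s = t"
proof -
  have "cis (2 * pi * (s - t)) = 1"
    using assms(1) by (simp add: right_diff_distrib flip: cis_divide)
  then have "cos (2 * pi * (s - t)) = 1" by (metis cis.simps(1) one_complex.simps(1))
  then obtain n :: int where "2 * pi * (s - t) = of_int n * 2 * pi" by (auto simp: cos_one_2pi_int)
  then have "2 * pi * (s - t) = 2 * pi * of_int n" by (simp only: mult_ac)
  then have "s - t = of_int n" by (subst (asm) mult_cancel_left) simp
  moreover from this have "n = 0" using assms(2) by linarith
  ultimately show ?thesis by simp
qed

text \<open>With \<open>C\<close> the closed complementary arc, the indicator is a pointwise limit
  of \<open>min 1 (k * infdist z C)\<close>, which are continuous functions of the point
  \<open>z\<close> on the circle.\<close>

lemma trig_approx_arc:
  assumes b: "0 < b" "b < 1"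
  shows "trig_approx (\<lambda>t. indicator {..<b} t)"
proof -
  define C where "C = (\<lambda>t. cis (2 * pi * t)) ` {b..1}"
  have "compact C" unfolding C_def cis_conv_exp
    by (intro compact_continuous_image continuous_intros) auto
  then have C: "closed C" "C \<noteq> {}" using b by (auto simp: C_def compact_imp_closed)
  define s where "s k t = complex_of_real (min 1 (of_nat k * infdist (cis (2 * pi * t)) C))" for k t
  show ?thesis
  proof (rule trig_approx_limit[of s _ "\<lambda>_. 1"])
    show "trig_approx (s k)" for k unfolding s_def
      by (rule trig_approx_continuous) (intro continuous_intros continuous_on_infdist)
    show "sqint circ (indicator {..<b})"
      by (rule sqint_circ_bounded[of _ 1]) (auto intro!: measurable_circI simp: indicator_def)
    \<comment> \<open>The parameter 0 is exceptional: it belongs to the arc, but its point on the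
      circle is also the endpoint of \<open>C\<close> at parameter 1.\<close>
    have "AE t in circ. t \<noteq> 0"
      unfolding circ_def by (subst AE_restrict_space_iff) (use AE_lborel_singleton[of "0::real"] in auto)
    then show "AE t in circ. (\<lambda>k. s k t) \<longlonglongrightarrow> indicator {..<b} t"
      using AE_space[of circ]
    proof eventually_elim
      case (elim t)
      show ?case
      proof (cases "t < b")
        case False
        then have "infdist (cis (2 * pi * t)) C = 0"
          using elim by (intro infdist_zero) (auto simp: C_def)
        then show ?thesis using False by (simp add: s_def)
      next
        case True
        have "cis (2 * pi * t) \<notin> C"
        proof
          assume "cis (2 * pi * t) \<in> C"
          then obtain u where u: "u \<in> {b..1}" "cis (2 * pi * t) = cis (2 * pi * u)" by (auto simp: C_def)
          then have "t = u" using elim True by (intro cis_2pi_inj) auto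
          then show False using u True by simp
        qed
        then have pos: "infdist (cis (2 * pi * t)) C > 0"
          using C by (simp add: infdist_pos_not_in_closed)
        obtain K :: nat where "K * infdist (cis (2 * pi * t)) C > 1"
          using reals_Archimedean3[OF pos] by blast
        then have "1 \<le> k * infdist (cis (2 * pi * t)) C" if "k \<ge> K" for k :: nat
          using that pos by (smt (verit, best) mult_right_mono of_nat_mono)
        then have "\<forall>\<^sub>F k in sequentially. s k t = indicator {..<b} t"
          using True unfolding eventually_sequentially s_def by (intro exI[of _ K]) (auto simp: min_absorb1)
        then show ?thesis by (rule tendsto_eventually)
      qed
    qed
    show "AE t in circ. cmod (s k t) \<le> 1" for k
      unfolding s_def norm_of_real using infdist_nonneg[of _ C] by (intro AE_I2) (simp add: min_def)
  qed auto
qed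

text \<open>Half-lines \<open>{..<b}\<close> form an intersection-stable generator of the Borel
  sets, and on the circle each of them is empty, an arc starting at 0, or everything.\<close>

lemma trig_approx_indicator:
  assumes "A \<in> sets borel"
  shows "trig_approx (\<lambda>t. indicator A t)"
proof -
  have "Int_stable (range (\<lambda>b::real. {..<b}))"
  proof (rule Int_stableI_image)
    show "\<exists>c\<in>UNIV. {..<a} \<inter> {..<b} = {..<c}" for a b :: real
      by (intro bexI[of _ "min a b"]) auto
  qed
  moreover have "range (\<lambda>b::real. {..<b}) \<subseteq> Pow UNIV" by simp
  moreover have "A \<in> sigma_sets UNIV (range (\<lambda>b::real. {..<b}))"
    using assms by (simp add: borel_Iio)
  ultimately show ?thesis
  proof (induction rule: sigma_sets_induct_disjoint)
    case (basic A)
    then obtain b where A: "A = {..<b}" by auto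
    consider "b \<le> 0" | "0 < b" "b < 1" | "1 \<le> b" by linarith
    then show ?case
    proof cases
      case 1
      show ?thesis unfolding A
        by (rule trig_approx_cong[OF trig_approx_trigpoly[OF trigpoly_const[of 0]]])
           (use 1 in \<open>auto intro!: measurable_circI AE_I2\<close>)
    next
      case 2
      then show ?thesis unfolding A by (rule trig_approx_arc)
    next
      case 3
      show ?thesis unfolding A
        by (rule trig_approx_cong[OF trig_approx_trigpoly[OF trigpoly_const[of 1]]])
           (use 3 in \<open>auto intro!: measurable_circI AE_I2\<close>)
    qed
  next
    case empty
    show ?case using trig_approx_trigpoly[OF trigpoly_const[of 0]] by simp
  next
    case (compl A)
    have "trig_approx (\<lambda>t. 1 + (- 1) * indicator A t)"
      by (intro trig_approx_add trig_approx_cmult compl trig_approx_trigpoly trigpoly_const)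
    then show ?case by (simp add: indicator_diff fun_eq_iff)
  next
    case (union A)
    have Ab: "A i \<in> sets borel" for i using union by (auto simp: borel_Iio)
    have fin: "trig_approx (\<lambda>t. \<Sum>i<k. indicator (A i) t)" for k
      by (induction k) (auto intro: trig_approx_add union trig_approx_trigpoly trigpoly_const)
    have eq: "(\<Sum>i<k. indicator (A i) t) = (indicator (\<Union>i<k. A i) t :: complex)" for k t
      by (rule indicator_UN_disjoint[symmetric])
         (use union in \<open>auto intro: disjoint_family_on_mono\<close>)
    show ?case
    proof (rule trig_approx_limit[of "\<lambda>k t. indicator (\<Union>i<k. A i) t" _ "\<lambda>_. 1"])
      show "trig_approx (\<lambda>t. indicator (\<Union>i<k. A i) t)" for k using fin[of k] by (simp add: eq)
      show "sqint circ (indicator (\<Union>i. A i))"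
        by (rule sqint_circ_bounded[of _ 1]) (use Ab in \<open>auto intro!: measurable_circI simp: indicator_def\<close>)
      show "AE x in circ. (\<lambda>k. indicator (\<Union>i<k. A i) x) \<longlonglongrightarrow> (indicator (\<Union>i. A i) x :: complex)"
        by (intro AE_I2 LIMSEQ_indicator_UN)
      show "AE x in circ. cmod (indicator (\<Union>i<k. A i) x) \<le> 1" for k
        by (auto simp: indicator_def)
    qed auto
  qed
qed

text \<open>Simple functions bounded by \<open>2 * cmod (g x)\<close> converge to \<open>g\<close>
  pointwise, and this bound is the square-integrable majorant.\<close>

lemma trig_approx_sqint:
  assumes g: "sqint circ g" shows "trig_approx g"
proof -
  obtain s where s: "\<And>i. simple_function circ (s i)" "\<And>x. x \<in> space circ \<Longrightarrow> (\<lambda>i. s i x) \<longlonglongrightarrow> g x"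
    "\<And>i x. x \<in> space circ \<Longrightarrow> cmod (s i x) \<le> 2 * cmod (g x)"
    using borel_measurable_implies_sequence_metric[OF sqint_measurable[OF g], of 0]
    unfolding norm_conv_dist by metis
  show ?thesis
  proof (rule trig_approx_limit[OF _ g])
    fix i
    have "trig_approx (\<lambda>x. \<Sum>y \<in> s i ` space circ. y * indicator (s i -` {y} \<inter> space circ) x)"
    proof -
      have "trig_approx (\<lambda>x. \<Sum>y \<in> F. y * indicator (s i -` {y} \<inter> space circ) x)" if "finite F" for F
        using that
      proof (induction F)
        case empty show ?case by (simp add: trig_approx_trigpoly trigpoly_const)
      next
        case (insert y F)
        show ?case
          unfolding sum.insert[OF insert(1,2)]
          by (intro trig_approx_add trig_approx_cmult trig_approx_indicator
              sets_circD[OF simple_functionD(2)[OF s(1)]] insert)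
      qed
      then show ?thesis using simple_functionD(1)[OF s(1)] by blast
    qed
    then show "trig_approx (s i)"
    proof (rule trig_approx_cong)
      show "s i \<in> borel_measurable circ" by (rule borel_measurable_simple_function[OF s(1)])
      show "AE t in circ. s i t = (\<Sum>y \<in> s i ` space circ. y * indicator (s i -` {y} \<inter> space circ) t)"
        using simple_function_indicator_representation_AE[OF s(1), of i]
      proof eventually_elim
        case (elim t)
        show ?case by (subst elim) (auto intro!: sum.cong simp: indicator_def)
      qed
    qed
    show "AE x in circ. cmod (s i x) \<le> 2 * cmod (g x)" using s(3) by (intro AE_I2) 
  next
    show "integrable circ (\<lambda>x. (2 * cmod (g x))\<^sup>2)"
      using sqint_integrable[OF g] by (simp add: power_mult_distrib)
    show "AE x in circ. (\<lambda>k. s k x) \<longlonglongrightarrow> g x" using s(2) by (intro AE_I2)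
  qed
qed

section \<open>Symmetric Fourier sums and their errors\<close>

definition fpart :: "(real \<Rightarrow> complex) \<Rightarrow> nat \<Rightarrow> real \<Rightarrow> complex" where
  "fpart g N t = (\<Sum>n\<in>{- int N..int N}. fcoef g n * fexp n t)"

text \<open>Being uniform in \<open>N\<close>, this is the majorant when the slice errors are
  integrated over \<open>r\<close>.\<close>

lemma fpart_error_le:
  assumes "sqint circ g"
  shows "(LINT t|circ. (cmod (g t - fpart g N t))\<^sup>2) \<le> (LINT t|circ. (cmod (g t))\<^sup>2)"
  unfolding fpart_def by (subst bessel_identity[OF assms]) (auto intro!: sum_nonneg)

text \<open>A good trigonometric polynomial is a competitor among the sums of every large order
  \<open>M\<close>, and the Fourier sum of that order does at least as well.\<close>

lemma fpart_error_tendsto: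
  assumes g: "sqint circ g"
  shows "(\<lambda>N. LINT t|circ. (cmod (g t - fpart g N t))\<^sup>2) \<longlonglongrightarrow> 0"
proof (rule LIMSEQ_I)
  fix e :: real assume "e > 0"
  then obtain p where p: "trigpoly p" "(LINT t|circ. (cmod (g t - p t))\<^sup>2) < e"
    using trig_approx_sqint[OF g] unfolding trig_approx_def by blast
  obtain N where N: "\<And>M. M \<ge> N \<Longrightarrow> \<exists>c. \<forall>t. p t = (\<Sum>n\<in>{- int M..int M}. c n * fexp n t)"
    using trigpoly_expand[OF p(1)] by blast
  have "norm ((LINT t|circ. (cmod (g t - fpart g M t))\<^sup>2) - 0) < e" if "M \<ge> N" for M
  proof -
    obtain c where c: "\<And>t. p t = (\<Sum>n\<in>{- int M..int M}. c n * fexp n t)" using N[OF \<open>M \<ge> N\<close>] by blast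
    have "(LINT t|circ. (cmod (g t - fpart g M t))\<^sup>2) \<le> (LINT t|circ. (cmod (g t - p t))\<^sup>2)"
      unfolding fpart_def c bessel_identity[OF g finite_atLeastAtMost_int] by (auto intro!: sum_nonneg)
    moreover have "(LINT t|circ. (cmod (g t - fpart g M t))\<^sup>2) \<ge> 0" by (intro integral_nonneg_AE) auto
    ultimately show ?thesis using p(2) by simp
  qed
  then show "\<exists>N. \<forall>M\<ge>N. norm ((LINT t|circ. (cmod (g t - fpart g M t))\<^sup>2) - 0) < e" by blast
qed

text \<open>Bessel's inequality for one coefficient, read off from the nonnegativity of the error;
  it makes the radial modes square-integrable.\<close>

lemma fcoef_sq_le:
  assumes "sqint circ g"
  shows "(cmod (fcoef g n))\<^sup>2 \<le> (LINT t|circ. (cmod (g t))\<^sup>2)"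
proof -
  have "0 \<le> (LINT t|circ. (cmod (g t - (\<Sum>k\<in>{n}. fcoef g k * fexp k t)))\<^sup>2)"
    by (intro integral_nonneg_AE) auto
  then show ?thesis by (subst (asm) bessel_identity[OF assms]) auto
qed

section \<open>Smooth functions\<close>

text \<open>A closure of \<open>smooth_fun\<close> under the operations needed here: the derivative
  of anything built by these rules is built by them again, which a formula for the iterated
  \<open>deriv\<close> would not show as directly. The rule \<open>primitive\<close> admits the
  functions \<open>A n\<close> and logarithms.\<close>

inductive smooth1 :: "(real \<Rightarrow> real) \<Rightarrow> bool" where
  base: "smooth_fun h \<Longrightarrow> smooth1 h"
| const: "smooth1 (\<lambda>x. c)"
| add: "smooth1 g \<Longrightarrow> smooth1 h \<Longrightarrow> smooth1 (\<lambda>x. g x + h x)"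
| mult: "smooth1 g \<Longrightarrow> smooth1 h \<Longrightarrow> smooth1 (\<lambda>x. g x * h x)"
| exp: "smooth1 g \<Longrightarrow> smooth1 (\<lambda>x. exp (g x))"
| inverse: "smooth1 g \<Longrightarrow> (\<And>x. g x \<noteq> 0) \<Longrightarrow> smooth1 (\<lambda>x. inverse (g x))"
| affine: "smooth1 g \<Longrightarrow> smooth1 (\<lambda>x. g (a * x + b))"
| primitive: "smooth1 g \<Longrightarrow> (\<And>x. (G has_real_derivative g x) (at x)) \<Longrightarrow> smooth1 G"

lemma smooth1_deriv:
  assumes "smooth1 g"
  shows "\<exists>g'. smooth1 g' \<and> (\<forall>x. (g has_real_derivative g' x) (at x))"
  using assms
proof induction
  case (base h)
  have d: "(deriv ^^ k) h differentiable at x" for k x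
    using base by (simp add: smooth_fun_def)
  have "smooth_fun (deriv h)"
    unfolding smooth_fun_def using d[of "Suc _"] by (simp add: funpow_Suc_right del: funpow.simps)
  moreover have "(h has_real_derivative deriv h x) (at x)" for x
    using d[of 0 x] by (simp add: DERIV_deriv_iff_real_differentiable)
  ultimately show ?case by (blast intro: smooth1.base)
next
  case (const c)
  show ?case by (rule exI[of _ "\<lambda>x. 0"]) (auto intro: smooth1.const)
next
  case (add g h)
  then obtain g' h' where "smooth1 g'" "smooth1 h'" "\<And>x. (g has_real_derivative g' x) (at x)"
    "\<And>x. (h has_real_derivative h' x) (at x)" by blast
  then show ?case
    by (intro exI[of _ "\<lambda>x. g' x + h' x"]) (auto intro!: smooth1.add derivative_eq_intros)
next
  case (mult g h)
  then obtain g' h' where "smooth1 g'" "smooth1 h'" "\<And>x. (g has_real_derivative g' x) (at x)"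
    "\<And>x. (h has_real_derivative h' x) (at x)" by blast
  then show ?case using mult(1,2)
    by (intro exI[of _ "\<lambda>x. g' x * h x + h' x * g x"])
       (auto intro!: smooth1.add smooth1.mult derivative_eq_intros)
next
  case (exp g)
  then obtain g' where "smooth1 g'" "\<And>x. (g has_real_derivative g' x) (at x)" by blast
  then show ?case using exp(1)
    by (intro exI[of _ "\<lambda>x. exp (g x) * g' x"]) (auto intro!: smooth1.intros(4,5) derivative_eq_intros)
next
  case (inverse g)
  then obtain g' where "smooth1 g'" "\<And>x. (g has_real_derivative g' x) (at x)" by blast
  then show ?case using inverse(1,2)
    by (intro exI[of _ "\<lambda>x. (- 1) * (inverse (g x) * (g' x * inverse (g x)))"] conjI allI)
       (intro smooth1.mult smooth1.const smooth1.inverse, auto intro!: derivative_eq_intros)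
next
  case (affine g a b)
  then obtain g' where g': "smooth1 g'" "\<And>x. (g has_real_derivative g' x) (at x)" by blast
  have "((\<lambda>x. g (a * x + b)) has_real_derivative g' (a * x + b) * a) (at x)" for x
    by (rule DERIV_chain2[OF g'(2)]) (auto intro!: derivative_eq_intros)
  then show ?case using g'(1)
    by (intro exI[of _ "\<lambda>x. g' (a * x + b) * a"]) (auto intro!: smooth1.mult smooth1.affine smooth1.const)
next
  case (primitive g G)
  then show ?case by blast
qed

lemma smooth1_continuous: "smooth1 g \<Longrightarrow> continuous_on A g"
  by (meson smooth1_deriv DERIV_isCont continuous_at_imp_continuous_on)

lemma smooth1_measurable: "smooth1 g \<Longrightarrow> g \<in> borel_measurable borel"
  by (intro borel_measurable_continuous_onI smooth1_continuous)

lemma smooth1_cmult: "smooth1 g \<Longrightarrow> smooth1 (\<lambda>x. c * g x)"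
  by (intro smooth1.mult smooth1.const)

lemma smooth1_diff: "smooth1 g \<Longrightarrow> smooth1 h \<Longrightarrow> smooth1 (\<lambda>x. g x - h x)"
  using smooth1.add[OF _ smooth1_cmult[of h "-1"]] by simp

text \<open>The logarithm of \<open>g\<close> is a primitive of \<open>g' / g\<close>, and the power
  is the exponential of a multiple of it.\<close>

lemma smooth1_powr:
  assumes g: "smooth1 g" and pos: "\<And>x. g x > 0" shows "smooth1 (\<lambda>x. g x powr e)"
proof -
  obtain g' where g': "smooth1 g'" "\<And>x. (g has_real_derivative g' x) (at x)"
    using smooth1_deriv[OF g] by blast
  have "smooth1 (\<lambda>x. ln (g x))"
  proof (rule smooth1.primitive)
    show "smooth1 (\<lambda>x. g' x * inverse (g x))"
      using pos by (intro smooth1.mult smooth1.inverse g g') (metis less_irrefl)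
    show "((\<lambda>x. ln (g x)) has_real_derivative g' x * inverse (g x)) (at x)" for x
      using pos[of x] by (auto intro!: derivative_eq_intros g' simp: divide_inverse)
  qed
  then have "smooth1 (\<lambda>x. exp (e * ln (g x)))"
    by (intro smooth1.exp smooth1_cmult)
  moreover have "(\<lambda>x. exp (e * ln (g x))) = (\<lambda>x. g x powr e)"
    using pos by (auto simp: powr_def fun_eq_iff) (metis less_irrefl)+
  ultimately show ?thesis by simp
qed

text \<open>The complex factor \<open>K\<close> absorbs the constant produced by
  \<open>pd_th\<close> while \<open>g\<close> stays real, so both partial derivatives map this
  family to itself.\<close>

definition mode :: "complex \<Rightarrow> (real \<Rightarrow> real) \<Rightarrow> int \<Rightarrow> real \<times> real \<Rightarrow> complex" where
  "mode K g n p = K * complex_of_real (g (fst p)) * fexp n (snd p)"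

lemma pd_r_mode:
  assumes "\<And>x. (g has_real_derivative g' x) (at x)"
  shows "pd_r (mode K g n) = mode K g' n"
proof
  fix p :: "real \<times> real"
  have "((\<lambda>x. complex_of_real (g x)) has_vector_derivative complex_of_real (g' (fst p))) (at (fst p))"
    using assms has_real_derivative_iff_has_vector_derivative has_vector_derivative_of_real by blast
  then have "((\<lambda>x. mode K g n (x, snd p)) has_vector_derivative mode K g' n p) (at (fst p))"
    unfolding mode_def by (auto intro!: has_vector_derivative_mult_left has_vector_derivative_mult_right)
  then show "pd_r (mode K g n) p = mode K g' n p"
    unfolding pd_r_def by (rule vector_derivative_at)
qed

lemma pd_th_mode: "pd_th (mode K g n) = mode (K * (2 * pi * \<i> * of_int n)) g n"
proof
  fix p
  have "((\<lambda>y. mode K g n (fst p, y)) has_vector_derivative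
      K * complex_of_real (g (fst p)) * (2 * pi * \<i> * of_int n * fexp n (snd p))) (at (snd p))"
    unfolding mode_def fst_conv snd_conv
    by (intro has_vector_derivative_mult_right has_vector_derivative_fexp)
  then have "pd_th (mode K g n) p = K * complex_of_real (g (fst p)) * (2 * pi * \<i> * of_int n * fexp n (snd p))"
    unfolding pd_th_def by (rule vector_derivative_at)
  then show "pd_th (mode K g n) p = mode (K * (2 * pi * \<i> * of_int n)) g n p"
    by (simp add: mode_def mult_ac)
qed

text \<open>Coinduction over all separated sections with \<open>smooth1\<close> radial part, a set
  closed under both partial derivatives.\<close>

lemma smooth_sec_mode:
  assumes "smooth1 g" shows "smooth_sec (mode K g n)"
proof -
  show ?thesis
  proof (rule smooth_sec.coinduct[of "\<lambda>u. \<exists>K g n. smooth1 g \<and> u = mode K g n"])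
    show "\<exists>K' g' n'. smooth1 g' \<and> mode K g n = mode K' g' n'" using assms by blast
  next
    fix u assume "\<exists>K g n. smooth1 g \<and> u = mode K g n"
    then obtain K g n where g: "smooth1 g" and u: "u = mode K g n" by blast
    obtain g' where g': "smooth1 g'" "\<And>x. (g has_real_derivative g' x) (at x)"
      using smooth1_deriv[OF g] by blast
    have diff: "u differentiable (at p)" for p
    proof -
      have "(g has_derivative (\<lambda>h. g' (fst p) * h)) (at (fst p))"
        using g'(2)[of "fst p"] by (simp add: has_field_derivative_def)
      then have "((\<lambda>p. complex_of_real (g (fst p))) has_derivative
          (\<lambda>h. complex_of_real (g' (fst p) * fst h))) (at p)"
        by (intro has_derivative_of_real
            has_derivative_compose[OF bounded_linear_imp_has_derivative[OF bounded_linear_fst]])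
      then have 1: "(\<lambda>p. complex_of_real (g (fst p))) differentiable (at p)"
        by (rule differentiableI)
      have "(fexp n has_derivative (\<lambda>h. h *\<^sub>R (2 * pi * \<i> * of_int n * fexp n (snd p)))) (at (snd p))"
        using has_vector_derivative_fexp by (simp only: has_vector_derivative_def)
      then have "((\<lambda>p. fexp n (snd p)) has_derivative
          (\<lambda>h. snd h *\<^sub>R (2 * pi * \<i> * of_int n * fexp n (snd p)))) (at p)"
        by (intro has_derivative_compose[OF bounded_linear_imp_has_derivative[OF bounded_linear_snd]])
      then have 2: "(\<lambda>p. fexp n (snd p)) differentiable (at p)"
        by (rule differentiableI)
      show ?thesis unfolding u mode_def
        by (intro differentiable_mult differentiable_const 1 2)
    qed
    have "pd_r u = mode K g' n" "pd_th u = mode (K * (2 * pi * \<i> * of_int n)) g n"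
      unfolding u by (rule pd_r_mode[OF g'(2)], rule pd_th_mode)
    then show "\<exists>v. u = v \<and> (\<forall>p. v differentiable at p) \<and>
        ((\<exists>K g n. smooth1 g \<and> pd_r v = mode K g n) \<or> smooth_sec (pd_r v)) \<and>
        ((\<exists>K g n. smooth1 g \<and> pd_th v = mode K g n) \<or> smooth_sec (pd_th v))"
      by (intro exI[of _ u] conjI refl allI diff disjI1) (rule exI conjI g g'(1) | assumption)+
  qed
qed

section \<open>The lemma of du Bois-Reymond\<close>

text \<open>
  No bump function has to be constructed: the cutoff \<open>\<rho>\<close> itself, shifted, is such a step
  (\<open>smooth_stepI\<close>).
\<close>

definition smooth_step :: "(real \<Rightarrow> real) \<Rightarrow> bool" where
  "smooth_step H \<longleftrightarrow> smooth1 H \<and> (\<forall>x. 0 \<le> H x \<and> H x \<le> 1)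
     \<and> (\<forall>x. x < -1/2 \<longrightarrow> H x = 0) \<and> (\<forall>x. x > 1/2 \<longrightarrow> H x = 1)"

lemma smooth_stepI:
  assumes "smooth_fun \<rho>" "mono \<rho>"
    and l: "\<And>r. r < real_of_int m - 1/2 \<Longrightarrow> \<rho> r = real_of_int m - 1/2"
    and r: "\<And>r. r > real_of_int m + 1/2 \<Longrightarrow> \<rho> r = real_of_int m + 1/2"
  shows "smooth_step (\<lambda>x. \<rho> (1 * x + m) - (real_of_int m - 1/2))"
proof -
  have *: "real_of_int m - 1/2 \<le> \<rho> y \<and> \<rho> y \<le> real_of_int m + 1/2" for y
  proof -
    \<comment> \<open>Comparison points at distance at least 1 from \<open>m\<close> lie strictly
      inside the two plateaus.\<close>
    have "\<rho> (min y (real_of_int m - 1)) \<le> \<rho> y" "\<rho> y \<le> \<rho> (max y (real_of_int m + 1))"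
      using assms(2) by (auto intro: monoD)
    moreover have "\<rho> (min y (real_of_int m - 1)) = real_of_int m - 1/2" by (rule l) auto
    moreover have "\<rho> (max y (real_of_int m + 1)) = real_of_int m + 1/2" by (rule r) auto
    ultimately show ?thesis by simp
  qed
  show ?thesis unfolding smooth_step_def
  proof (intro conjI allI impI)
    show "smooth1 (\<lambda>x. \<rho> (1 * x + real_of_int m) - (real_of_int m - 1/2))"
      by (intro smooth1_diff smooth1.const smooth1.affine smooth1.base assms(1))
  next
    fix x :: real
    show "0 \<le> \<rho> (1 * x + real_of_int m) - (real_of_int m - 1/2)"
      "\<rho> (1 * x + real_of_int m) - (real_of_int m - 1/2) \<le> 1"
      using *[of "1 * x + real_of_int m"] by auto
  next
    fix x :: real assume "x < - 1/2"
    then show "\<rho> (1 * x + real_of_int m) - (real_of_int m - 1/2) = 0"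
      using l[of "1 * x + real_of_int m"] by simp
  next
    fix x :: real assume "x > 1/2"
    then show "\<rho> (1 * x + real_of_int m) - (real_of_int m - 1/2) = 1"
      using r[of "1 * x + real_of_int m"] by simp
  qed
qed

text \<open>Only the shape near the ends matters: the constants \<open>c\<close> and
  \<open>d\<close> cancel in differences of translates, leaving the slope 1 on the right.\<close>

lemma smooth_step_primitive:
  assumes "smooth_step H"
  obtains G c d where "\<And>x. (G has_real_derivative H x) (at x)"
    "\<And>x. x < -1/2 \<Longrightarrow> G x = c" "\<And>x. x > 1/2 \<Longrightarrow> G x = x + d"
proof -
  have H: "smooth1 H" "\<And>x. x < -1/2 \<Longrightarrow> H x = 0" "\<And>x. x > 1/2 \<Longrightarrow> H x = 1"
    using assms by (auto simp: smooth_step_def)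
  have "isCont H x" for x
    using smooth1_continuous[OF H(1), of UNIV] by (simp add: continuous_on_eq_continuous_at)
  then obtain G where "\<And>x. (G has_vector_derivative H x) (at x)"
    using einterval_antiderivative[of "-\<infinity>" "\<infinity>" H] by auto
  then have G: "\<And>x. (G has_real_derivative H x) (at x)"
    by (simp add: has_real_derivative_iff_has_vector_derivative)
  have "\<exists>c. \<forall>x\<in>{..< -1/2}. G x = c"
  proof (rule has_field_derivative_zero_constant)
    show "(G has_field_derivative 0) (at x within {..< -1/2})" if "x \<in> {..< -1/2}" for x
      using has_field_derivative_at_within[OF G[of x]] H(2)[of x] that by simp
  qed auto
  moreover have "\<exists>d. \<forall>x\<in>{1/2<..}. G x - x = d"
  proof (rule has_field_derivative_zero_constant)
    show "((\<lambda>x. G x - x) has_field_derivative 0) (at x within {1/2<..})" if "x \<in> {1/2<..}" for x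
    proof -
      have "((\<lambda>x. G x - x) has_field_derivative H x - 1) (at x within {1/2<..})"
        by (intro DERIV_diff DERIV_ident has_field_derivative_at_within[OF G])
      then show ?thesis using H(3)[of x] that by simp
    qed
  qed auto
  ultimately obtain c d where "\<forall>x\<in>{..< -1/2}. G x = c" "\<forall>x\<in>{1/2<..}. G x - x = d" by blast
  then show ?thesis using that[OF G, of c d] by (force simp: algebra_simps)
qed

text \<open>Rescaled translates of the single step \<open>H\<close> supply interval cutoffs of any
  sharpness. The limit is taken by dominated convergence, and \<open>C\<close> is the integral of
  \<open>h\<close> against the fixed unit-mass bump \<open>\<eta>\<close>.\<close>

lemma du_bois_reymond_interval:
  fixes h :: "real \<Rightarrow> complex"
  assumes H: "smooth_step H"
    and h: "\<And>R. set_integrable lborel {-R..R} h"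
    and weak: "\<And>\<psi> \<psi>' R. smooth1 \<psi>' \<Longrightarrow> (\<And>x. (\<psi> has_real_derivative \<psi>' x) (at x)) \<Longrightarrow>
      (\<And>x. \<bar>x\<bar> > R \<Longrightarrow> \<psi> x = 0) \<Longrightarrow> (LINT x|lborel. h x * complex_of_real (\<psi>' x)) = 0"
  shows "\<exists>C. \<forall>a b. a < b \<longrightarrow> (LINT x:{a<..<b}|lborel. h x) = complex_of_real (b - a) * C"
proof -
  have sH: "smooth1 H" and H01: "\<And>x. 0 \<le> H x" "\<And>x. H x \<le> 1"
    and H0: "\<And>x. x < -1/2 \<Longrightarrow> H x = 0" and H1: "\<And>x. x > 1/2 \<Longrightarrow> H x = 1"
    using H by (auto simp: smooth_step_def)
  obtain G c d where G: "\<And>x. (G has_real_derivative H x) (at x)"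
    and G0: "\<And>x. x < -1/2 \<Longrightarrow> G x = c" and G1: "\<And>x. x > 1/2 \<Longrightarrow> G x = x + d"
    using smooth_step_primitive[OF H] by blast
  \<comment> \<open>\<open>B a b k\<close> tends to the indicator of \<open>(a, b)\<close> as \<open>k \<rightarrow> \<infinity>\<close>; subtracting \<open>(b - a) \<eta>\<close> makes its
    primitive \<open>\<psi>\<close> compactly supported, which gives \<open>\<integral> h B = (b - a) \<integral> h \<eta>\<close>.\<close>
  define B where "B a b k x = H (k * x + - (k * a)) - H (k * x + - (k * b))" for a b k x :: real
  define \<eta> where "\<eta> x = H (1 * x + 0) - H (1 * x + (- 1))" for x :: real
  have mH: "H \<in> borel_measurable borel" by (rule smooth1_measurable[OF sH])
  have hm: "h \<in> borel_measurable borel"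
  proof (rule borel_measurable_LIMSEQ_metric)
    show "(\<lambda>x. indicator {- real i..real i} x *\<^sub>R h x) \<in> borel_measurable borel" for i
      using h[of "real i"] by (simp add: set_integrable_def)
    fix x
    obtain N :: nat where "real N > \<bar>x\<bar>" using reals_Archimedean2 by blast
    then have "\<forall>\<^sub>F i in sequentially. indicator {- real i..real i} x *\<^sub>R h x = h x"
      unfolding eventually_sequentially by (intro exI[of _ N]) (auto simp: indicator_def)
    then show "(\<lambda>i. indicator {- real i..real i} x *\<^sub>R h x) \<longlonglongrightarrow> h x" by (rule tendsto_eventually)
  qed
  have integ: "integrable lborel (\<lambda>x. h x * complex_of_real (w x))"
    if "w \<in> borel_measurable borel" "\<And>x. \<bar>w x\<bar> \<le> 1" "\<And>x. \<bar>x\<bar> > R \<Longrightarrow> w x = 0" for w R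
  proof (rule Bochner_Integration.integrable_bound)
    show "integrable lborel (\<lambda>x. indicator {-R..R} x *\<^sub>R h x)"
      using h[of R] by (simp add: set_integrable_def)
    show "AE x in lborel. norm (h x * complex_of_real (w x)) \<le> norm (indicator {-R..R} x *\<^sub>R h x)"
    proof (rule AE_I2)
      fix x
      show "norm (h x * complex_of_real (w x)) \<le> norm (indicator {-R..R} x *\<^sub>R h x)"
        using that(2)[of x] that(3)[of x]
        by (cases "\<bar>x\<bar> > R") (auto simp: norm_mult indicator_def intro: mult_left_le)
    qed
  qed (use that hm in measurable)
  have B1: "\<bar>B a b k x\<bar> \<le> 1" for a b k x
    using H01[of "k * x + - (k * a)"] H01[of "k * x + - (k * b)"] by (auto simp: B_def abs_if)
  have \<eta>1: "\<bar>\<eta> x\<bar> \<le> 1" for x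
    using H01[of x] H01[of "x - 1"] by (auto simp: \<eta>_def abs_if)
  have \<eta>0: "\<eta> x = 0" if "\<bar>x\<bar> > 2" for x
    using that by (cases "x > 0") (auto simp: \<eta>_def H0 H1)
  \<comment> \<open>Far from both points the two steps are saturated on the same side, and
    \<open>k \<ge> 1\<close> only increases the distance 3. That distance also exceeds the
    \<open>3/2\<close> needed for the shifted step in \<open>\<eta>\<close>.\<close>
  have ends: "k * x + - (k * a) < -1/2 \<and> k * x + - (k * b) < -1/2
      \<or> k * x + - (k * a) > 1/2 \<and> k * x + - (k * b) > 1/2"
    if "\<bar>x\<bar> > \<bar>a\<bar> + \<bar>b\<bar> + 3" "k \<ge> 1" for a b k x :: real
  proof (cases "x > 0")
    case True
    then have "x - a \<ge> 3" "x - b \<ge> 3" using that by auto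
    then have "k * (x - a) \<ge> 1 * 3" "k * (x - b) \<ge> 1 * 3" using that by (intro mult_mono; simp)+
    then show ?thesis by (auto simp: algebra_simps)
  next
    case False
    then have "a - x \<ge> 3" "b - x \<ge> 3" using that by auto
    then have "k * (a - x) \<ge> 1 * 3" "k * (b - x) \<ge> 1 * 3" using that by (intro mult_mono; simp)+
    then show ?thesis by (auto simp: algebra_simps)
  qed
  have B0: "B a b k x = 0" if "\<bar>x\<bar> > \<bar>a\<bar> + \<bar>b\<bar> + 3" "k \<ge> 1" for a b k x
    using ends[OF that] by (auto simp: B_def H0 H1)
  have mB: "B a b k \<in> borel_measurable borel" for a b k
    unfolding B_def using mH by measurable
  have m\<eta>: "\<eta> \<in> borel_measurable borel"
    unfolding \<eta>_def using mH by measurable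
  define C where "C = (LINT x|lborel. h x * complex_of_real (\<eta> x))"
  have BC: "(LINT x|lborel. h x * complex_of_real (B a b k x)) = complex_of_real (b - a) * C" if k: "k \<ge> 1" for a b k
  proof -
    \<comment> \<open>Division by \<open>k\<close> undoes the chain rule. On the far right the first
      part equals \<open>b - a\<close> and the second subtracts the same amount; on the far left
      both vanish.\<close>
    define \<psi> where "\<psi> x = (G (k * x + - (k * a)) - G (k * x + - (k * b))) / k
      - (b - a) * (G (1 * x + 0) - G (1 * x + (- 1)))" for x
    have "(LINT x|lborel. h x * complex_of_real (B a b k x - (b - a) * \<eta> x)) = 0"
    proof (rule weak[where \<psi> = \<psi> and R = "\<bar>a\<bar> + \<bar>b\<bar> + 3"])
      show "smooth1 (\<lambda>x. B a b k x - (b - a) * \<eta> x)"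
        unfolding B_def \<eta>_def by (intro smooth1_diff smooth1_cmult smooth1.affine sH)
      have aff: "((\<lambda>x. G (c * x + e)) has_real_derivative H (c * x + e) * c) (at x)" for c e x
        by (rule DERIV_chain2[OF G]) (auto intro!: derivative_eq_intros)
      show "(\<psi> has_real_derivative B a b k x - (b - a) * \<eta> x) (at x)" for x
      proof -
        have "(\<psi> has_real_derivative (H (k * x + - (k * a)) * k - H (k * x + - (k * b)) * k) / k
            - (b - a) * (H (1 * x + 0) * 1 - H (1 * x + (- 1)) * 1)) (at x)"
          unfolding \<psi>_def by (intro DERIV_diff DERIV_cdivide DERIV_cmult aff)
        moreover have "(H (k * x + - (k * a)) * k - H (k * x + - (k * b)) * k) / k
            = H (k * x + - (k * a)) - H (k * x + - (k * b))"
          using k by (simp flip: left_diff_distrib)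
        ultimately show ?thesis unfolding B_def \<eta>_def by simp
      qed
      show "\<psi> x = 0" if x: "\<bar>x\<bar> > \<bar>a\<bar> + \<bar>b\<bar> + 3" for x
      proof (cases "x > 0")
        case True
        then have "G (1 * x + 0) - G (1 * x + (- 1)) = 1" using x by (simp add: G1)
        moreover have "\<not> k * x + - (k * a) < - 1/2"
        proof -
          have "0 \<le> k * (x - a)" using k x True by (intro mult_nonneg_nonneg) auto
          then show ?thesis by (simp add: algebra_simps)
        qed
        then have "G (k * x + - (k * a)) - G (k * x + - (k * b)) = k * (b - a)"
          using ends[OF x k] by (auto simp: G1 algebra_simps)
        ultimately show ?thesis using k by (simp add: \<psi>_def)
      next
        case False
        then have "G (1 * x + 0) - G (1 * x + (- 1)) = 0" using x by (simp add: G0)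
        moreover have "\<not> k * x + - (k * a) > 1/2"
        proof -
          have "0 \<le> k * (a - x)" using k x False by (intro mult_nonneg_nonneg) auto
          then show ?thesis by (simp add: algebra_simps)
        qed
        then have "G (k * x + - (k * a)) - G (k * x + - (k * b)) = 0"
          using ends[OF x k] by (auto simp: G0)
        ultimately show ?thesis using k by (simp add: \<psi>_def)
      qed
    qed
    moreover have "(LINT x|lborel. h x * complex_of_real (B a b k x - (b - a) * \<eta> x))
       = (LINT x|lborel. h x * complex_of_real (B a b k x) - complex_of_real (b - a) * (h x * complex_of_real (\<eta> x)))"
      by (intro Bochner_Integration.integral_cong) (auto simp: algebra_simps)
    moreover have "\<dots> = (LINT x|lborel. h x * complex_of_real (B a b k x)) - complex_of_real (b - a) * C"
      unfolding C_def
      by (subst Bochner_Integration.integral_diff)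
         (auto intro!: integ[OF mB B1 B0] integ[OF m\<eta> \<eta>1 \<eta>0] k)
    ultimately show ?thesis by simp
  qed
  have "(LINT x:{a<..<b}|lborel. h x) = complex_of_real (b - a) * C" if ab: "a < b" for a b
  proof -
    have "(\<lambda>k::nat. LINT x|lborel. h x * complex_of_real (B a b (real (Suc k)) x))
        \<longlonglongrightarrow> (LINT x:{a<..<b}|lborel. h x)"
      unfolding set_lebesgue_integral_def
    proof (rule integral_dominated_convergence)
      show "integrable lborel (\<lambda>x. norm (indicator {-(\<bar>a\<bar> + \<bar>b\<bar> + 3)..\<bar>a\<bar> + \<bar>b\<bar> + 3} x *\<^sub>R h x))"
        using h[of "\<bar>a\<bar> + \<bar>b\<bar> + 3"] unfolding set_integrable_def by (rule integrable_norm)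
      \<comment> \<open>Farther than \<open>1 / k\<close> from its centre, the rescaled step has its
        argument outside \<open>[-1/2, 1/2]\<close> and has reached its limiting value.\<close>
      have ev: "\<forall>\<^sub>F k in sequentially. (1::real) < real (Suc k) * \<bar>y\<bar>" if "y \<noteq> 0" for y :: real
      proof -
        obtain K :: nat where K: "1 < real K * \<bar>y\<bar>" using \<open>y \<noteq> 0\<close> zero_less_abs_iff reals_Archimedean3 by metis
        have "1 < real (Suc k) * \<bar>y\<bar>" if "k \<ge> K" for k
          using that K by (smt (verit, best) mult_right_mono of_nat_mono le_SucI abs_ge_zero)
        then show ?thesis by (auto simp: eventually_sequentially)
      qed
      have "AE x in lborel. x \<noteq> a" "AE x in lborel. x \<noteq> b" by (rule AE_lborel_singleton)+
      then show "AE x in lborel. (\<lambda>k. h x * complex_of_real (B a b (real (Suc k)) x))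
          \<longlonglongrightarrow> indicator {a<..<b} x *\<^sub>R h x"
      proof eventually_elim
        case (elim x)
        have "\<forall>\<^sub>F k in sequentially. B a b (real (Suc k)) x = indicator {a<..<b} x"
        proof -
          have "\<forall>\<^sub>F k in sequentially. 1 < real (Suc k) * \<bar>x - a\<bar>"
            "\<forall>\<^sub>F k in sequentially. 1 < real (Suc k) * \<bar>x - b\<bar>"
            using ev[of "x - a"] ev[of "x - b"] elim by simp_all
          then show ?thesis
          proof eventually_elim
            case (elim k)
          define K where "K = real (Suc k)"
          have K: "K > 0" by (simp add: K_def)
          have e: "1 < K * \<bar>x - a\<bar>" "1 < K * \<bar>x - b\<bar>" "x \<noteq> a" "x \<noteq> b"
            using elim \<open>x \<noteq> a\<close> \<open>x \<noteq> b\<close> by (auto simp: K_def)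
          have st: "H (K * x + - (K * y)) = (if x > y then 1 else 0)" if "1 < K * \<bar>x - y\<bar>" for y
            using that by (auto simp: abs_if algebra_simps split: if_splits intro!: H0 H1)
          show ?case unfolding B_def K_def[symmetric] st[OF e(1)] st[OF e(2)]
            using e(3,4) ab by (auto simp: indicator_def)
        qed
        qed
        then have "\<forall>\<^sub>F k in sequentially. h x * complex_of_real (B a b (real (Suc k)) x) = indicator {a<..<b} x *\<^sub>R h x"
          by eventually_elim (auto simp: indicator_def)
        then show ?case by (rule tendsto_eventually)
      qed
      show "AE x in lborel. norm (h x * complex_of_real (B a b (real (Suc k)) x))
          \<le> norm (indicator {-(\<bar>a\<bar> + \<bar>b\<bar> + 3)..\<bar>a\<bar> + \<bar>b\<bar> + 3} x *\<^sub>R h x)" for k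
      proof (rule AE_I2)
        fix x
        show "norm (h x * complex_of_real (B a b (real (Suc k)) x))
          \<le> norm (indicator {-(\<bar>a\<bar> + \<bar>b\<bar> + 3)..\<bar>a\<bar> + \<bar>b\<bar> + 3} x *\<^sub>R h x)"
          using B1[of a b "real (Suc k)" x] B0[of a b x "real (Suc k)"]
          by (cases "\<bar>x\<bar> > \<bar>a\<bar> + \<bar>b\<bar> + 3") (auto simp: norm_mult indicator_def intro: mult_left_le)
      qed
    qed (use hm mB in measurable)
    moreover have "(LINT x|lborel. h x * complex_of_real (B a b (real (Suc k)) x)) = complex_of_real (b - a) * C" for k
      by (rule BC) simp
    ultimately show ?thesis by (simp add: LIMSEQ_const_iff)
  qed
  then show ?thesis by blast
qed

text \<open>The restrictions to \<open>(-K, K)\<close> are integrable; the vanishing of their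
  interval integrals extends to all Borel sets by a pi-lambda argument, and countably many
  \<open>K\<close> cover the line.\<close>

lemma AE_zero_of_intervals:
  fixes g :: "real \<Rightarrow> complex"
  assumes g: "\<And>R. set_integrable lborel {-R..R} g"
    and zero: "\<And>a b. a < b \<Longrightarrow> (LINT x:{a<..<b}|lborel. g x) = 0"
  shows "AE x in lborel. g x = 0"
proof -
  have "AE x in lborel. indicator {- real K<..<real K} x *\<^sub>R g x = 0" for K :: nat
  proof (rule sigma_finite_measure.density_zero[OF lborel.sigma_finite_measure_axioms])
    define f where "f = (\<lambda>x. indicator {- real K<..<real K} x *\<^sub>R g x)"
    have "set_integrable lborel {- real K<..<real K} g"
      by (rule set_integrable_subset[OF g[of "real K"]]) auto
    then have f: "integrable lborel f" by (simp add: f_def set_integrable_def)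
    have ff: "set_integrable lborel A f" if "A \<in> sets borel" for A
      using integrable_mult_indicator[of A lborel f] f that by (simp add: set_integrable_def)
    show "integrable lborel (\<lambda>x. indicator {- real K<..<real K} x *\<^sub>R g x)" using f by (simp add: f_def)
    have basic: "(LINT x:{a<..<b}|lborel. f x) = 0" for a b
    proof -
      have eq: "(LINT x:{a<..<b}|lborel. f x) = (LINT x:{max a (- real K)<..<min b (real K)}|lborel. g x)"
        unfolding set_lebesgue_integral_def f_def
        by (intro Bochner_Integration.integral_cong) (auto simp: indicator_def)
      show ?thesis unfolding eq
      proof (cases "max a (- real K) < min b (real K)")
        case False
        then have e: "{max a (- real K)<..<min b (real K)} = {}"
          by (intro greaterThanLessThan_empty) (use False in linarith)
        show "(LINT x:{max a (- real K)<..<min b (real K)}|lborel. g x) = 0" unfolding e by (simp add: set_lebesgue_integral_def)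
      qed (rule zero)
    qed
    have borel_eq: "borel = sigma UNIV (range (\<lambda>(a, b). {a <..< b::real}))"
      using borel_eq_box[where 'a = real] by (simp add: box_real)
    fix A assume "A \<in> sets (lborel :: real measure)"
    then have A: "A \<in> sigma_sets UNIV (range (\<lambda>(a, b). {a <..< b::real}))"
      by (simp add: borel_eq)
    have "Int_stable (range (\<lambda>(a, b). {a <..< b::real}))"
    proof (rule Int_stableI_image)
      show "\<exists>k\<in>UNIV. (case i of (a, b) \<Rightarrow> {a<..<b}) \<inter> (case j of (a, b) \<Rightarrow> {a<..<b})
          = (case k of (a, b) \<Rightarrow> {a<..<b::real})" for i j
        by (intro bexI[of _ "(max (fst i) (fst j), min (snd i) (snd j))"]) (auto split: prod.splits)
    qed
    moreover have "range (\<lambda>(a, b). {a <..< b::real}) \<subseteq> Pow UNIV" by simp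
    moreover note A
    ultimately have "(LINT x:A|lborel. f x) = 0"
    proof (induction rule: sigma_sets_induct_disjoint)
      case (compl A)
      then have A: "A \<in> sets borel" by (simp add: borel_eq)
      have "(LINT x:UNIV - A|lborel. f x) + (LINT x:A|lborel. f x) = (LINT x:(UNIV - A) \<union> A|lborel. f x)"
        using A by (intro set_integral_Un[symmetric] ff) auto
      also have "\<dots> = (LINT x|lborel. f x)" by (simp add: set_lebesgue_integral_def)
      \<comment> \<open>The truncated function lives on \<open>(-K, K)\<close>, so its total
        integral is itself an interval integral.\<close>
      also have "\<dots> = (LINT x:{- real K<..<real K}|lborel. f x)"
        unfolding set_lebesgue_integral_def f_def
        by (intro Bochner_Integration.integral_cong) (auto simp: indicator_def)
      finally show ?case using basic compl by simp
    next
      case (union A)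
      then have A: "A i \<in> sets borel" for i by (auto simp: borel_eq)
      have "(LINT x:(\<Union>i. A i)|lborel. f x) = (\<Sum>i. LINT x:A i|lborel. f x)"
        using union A by (intro lebesgue_integral_countable_add ff) (auto simp: disjoint_family_on_def)
      then show ?case using union by simp
    qed (use basic in \<open>auto simp: set_lebesgue_integral_def\<close>)
    then show "(LINT x:A|lborel. indicator {- real K<..<real K} x *\<^sub>R g x) = 0" by (simp add: f_def)
  qed
  then have "AE x in lborel. \<forall>K::nat. indicator {- real K<..<real K} x *\<^sub>R g x = 0"
    unfolding AE_all_countable by blast
  then show ?thesis
  proof eventually_elim
    case (elim x)
    obtain K :: nat where "real K > \<bar>x\<bar>" using reals_Archimedean2 by blast
    then show ?case using elim[rule_format, of K] by (auto simp: indicator_def split: if_splits)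
  qed
qed

lemma du_bois_reymond:
  fixes h :: "real \<Rightarrow> complex"
  assumes H: "smooth_step H"
    and h: "\<And>R. set_integrable lborel {-R..R} h"
    and weak: "\<And>\<psi> \<psi>' R. smooth1 \<psi>' \<Longrightarrow> (\<And>x. (\<psi> has_real_derivative \<psi>' x) (at x)) \<Longrightarrow>
      (\<And>x. \<bar>x\<bar> > R \<Longrightarrow> \<psi> x = 0) \<Longrightarrow> (LINT x|lborel. h x * complex_of_real (\<psi>' x)) = 0"
  shows "\<exists>C. AE x in lborel. h x = C"
proof -
  obtain C where C: "\<And>a b. a < b \<Longrightarrow> (LINT x:{a<..<b}|lborel. h x) = complex_of_real (b - a) * C"
    using du_bois_reymond_interval[OF H h] weak by blast
  have const: "set_integrable lborel {a..b} (\<lambda>x. C)" for a b :: real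
    unfolding set_integrable_def
    by (intro integrable_scaleR_left integrable_real_indicator) (auto simp: emeasure_lborel_Icc_eq)
  have "AE x in lborel. h x - C = 0"
  proof (rule AE_zero_of_intervals)
    show "set_integrable lborel {-R..R} (\<lambda>x. h x - C)" for R
      by (intro set_integral_diff h const)
    fix a b :: real assume ab: "a < b"
    define R where "R = max \<bar>a\<bar> \<bar>b\<bar>"
    have sub: "{a<..<b} \<subseteq> {-R..R}" by (auto simp: R_def)
    have "(LINT x:{a<..<b}|lborel. h x - C) = (LINT x:{a<..<b}|lborel. h x) - (LINT x:{a<..<b}|lborel. C)"
      by (intro set_integral_diff set_integrable_subset[OF h[of R] _ sub] set_integrable_subset[OF const[of "-R" R] _ sub]) auto
    also have "(LINT x:{a<..<b}|lborel. C) = complex_of_real (b - a) * C"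
      using ab by (simp add: set_lebesgue_integral_def scaleR_conv_of_real)
    finally show "(LINT x:{a<..<b}|lborel. h x - C) = 0" using C[OF ab] by simp
  qed
  then show ?thesis by (intro exI[of _ C]) simp
qed

section \<open>Fourier modes on the cylinder\<close>

lemma cyl_eq: "cyl = lborel \<Otimes>\<^sub>M circ"
  by (simp add: cyl_def circ_def)

lemma space_cyl: "space cyl = UNIV \<times> {0..<1}"
  by (simp add: cyl_eq space_pair_measure)

interpretation cyl: pair_sigma_finite lborel circ
  by (intro pair_sigma_finite.intro lborel.sigma_finite_measure_axioms circ.sigma_finite_measure_axioms)

lemma measurable_cylI:
  assumes "u \<in> borel_measurable borel" shows "u \<in> borel_measurable cyl"
proof -
  have "(\<lambda>p. (fst p, snd p)) \<in> cyl \<rightarrow>\<^sub>M borel \<Otimes>\<^sub>M borel"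
    unfolding cyl_eq
    by (intro measurable_Pair measurable_compose[OF measurable_snd] measurable_compose[OF measurable_fst])
       (auto intro: measurable_circI)
  then show ?thesis
    using measurable_compose[of "\<lambda>p. p" cyl borel u] assms by (simp add: borel_prod)
qed

lemma measurable_slice:
  assumes "u \<in> borel_measurable borel" shows "(\<lambda>t. u (r, t)) \<in> borel_measurable borel"
  by (rule measurable_compose[OF _ assms]) (intro borel_measurable_continuous_onI continuous_intros)

lemma AE_cyl_fst:
  assumes "AE r in lborel. P r" shows "AE p in cyl. P (fst p)"
proof -
  obtain N where N: "{r \<in> space lborel. \<not> P r} \<subseteq> N" "N \<in> null_sets lborel"
    using assms unfolding eventually_ae_filter by blast
  show ?thesis
  proof (rule AE_I')
    have "emeasure cyl (N \<times> {0..<1}) = emeasure lborel N * emeasure circ {0..<1}"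
      unfolding cyl_eq using N
      by (intro circ.emeasure_pair_measure_Times) (use sets.top[of circ] in \<open>auto simp: null_sets_def\<close>)
    moreover have "N \<times> {0..<1} \<in> sets cyl"
      unfolding cyl_eq using N sets.top[of circ] by (auto simp: null_sets_def)
    ultimately show "N \<times> {0..<1} \<in> null_sets cyl" using N by (auto simp: null_sets_def)
    show "{p \<in> space cyl. \<not> P (fst p)} \<subseteq> N \<times> {0..<1}" using N by (auto simp: space_cyl)
  qed
qed

lemma L2_sqint: "u \<in> L2 \<Longrightarrow> sqint cyl u"
  by (auto simp: L2_def sqint_def intro: measurable_cylI)

lemma L2_measurable: "u \<in> L2 \<Longrightarrow> u \<in> borel_measurable borel"
  by (simp add: L2_def)

lemma L2I: "u \<in> borel_measurable borel \<Longrightarrow> periodic u \<Longrightarrow> sqint cyl u \<Longrightarrow> u \<in> L2"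
  by (auto simp: L2_def sqint_def)

lemma sqint_slice:
  assumes "u \<in> L2" shows "AE r in lborel. sqint circ (\<lambda>t. u (r, t))"
proof -
  have "AE r in lborel. integrable circ (\<lambda>t. (cmod (u (r, t)))\<^sup>2)"
    using sqint_integrable[OF L2_sqint[OF assms]] unfolding cyl_eq by (rule cyl.AE_integrable_fst')
  then show ?thesis
    by eventually_elim (simp add: sqint_def measurable_circI measurable_slice L2_measurable assms)
qed

lemma integral_cyl_sq:
  assumes "sqint cyl u"
  shows "(LINT p|cyl. (cmod (u p))\<^sup>2) = (LINT r|lborel. LINT t|circ. (cmod (u (r, t)))\<^sup>2)"
    "integrable lborel (\<lambda>r. LINT t|circ. (cmod (u (r, t)))\<^sup>2)"
  using cyl.integral_fst'[of "\<lambda>p. (cmod (u p))\<^sup>2"] cyl.integrable_fst'[of "\<lambda>p. (cmod (u p))\<^sup>2"]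
    sqint_integrable[OF assms] by (simp_all add: cyl_eq)

text \<open>For a section in \<open>L2\<close> the slice is known to be square-integrable for almost
  every \<open>r\<close> only; at the other radii the value carries no information.\<close>

definition fmode :: "(real \<times> real \<Rightarrow> complex) \<Rightarrow> int \<Rightarrow> real \<Rightarrow> complex" where
  "fmode u n r = fcoef (\<lambda>t. u (r, t)) n"

lemma fmode_measurable:
  assumes "u \<in> borel_measurable borel" shows "fmode u n \<in> borel_measurable borel"
proof -
  have "(\<lambda>p. u p * cnj (fexp n (snd p))) \<in> borel_measurable cyl"
    unfolding cnj_fexp
    by (intro measurable_cylI borel_measurable_times assms measurable_compose[OF _ fexp_measurable])
       (simp add: borel_prod[symmetric])
  then have "(\<lambda>(r, t). u (r, t) * cnj (fexp n t)) \<in> borel_measurable (lborel \<Otimes>\<^sub>M circ)"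
    by (simp add: cyl_eq split_beta')
  then have "(\<lambda>r. LINT t|circ. u (r, t) * cnj (fexp n t)) \<in> borel_measurable lborel"
    by (rule circ.borel_measurable_lebesgue_integral)
  then show ?thesis by (simp add: fmode_def[abs_def] fcoef_def)
qed

lemma sqint_fmode:
  assumes "u \<in> L2" shows "sqint lborel (fmode u n)"
proof (rule sqint_bound)
  show "integrable lborel (\<lambda>r. LINT t|circ. (cmod (u (r, t)))\<^sup>2)"
    by (rule integral_cyl_sq(2)[OF L2_sqint[OF assms]])
  show "AE r in lborel. (cmod (fmode u n r))\<^sup>2 \<le> (LINT t|circ. (cmod (u (r, t)))\<^sup>2)"
    using sqint_slice[OF assms] by eventually_elim (simp add: fmode_def fcoef_sq_le)
  show "fmode u n \<in> borel_measurable lborel"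
    using fmode_measurable[OF L2_measurable[OF assms]] by simp
qed

text \<open>The slice at \<open>r\<close> has norm \<open>cmod (v r)\<close>, since
  \<open>fexp n\<close> has modulus 1 and the circle has mass 1.\<close>

lemma sqint_cyl_separated:
  assumes "sqint lborel v" shows "sqint cyl (\<lambda>p. v (fst p) * fexp n (snd p))"
  unfolding sqint_def
proof
  have v: "v \<in> borel_measurable borel" using assms by (simp add: sqint_def)
  show m: "(\<lambda>p. v (fst p) * fexp n (snd p)) \<in> borel_measurable cyl"
    by (intro measurable_cylI borel_measurable_times measurable_compose[OF _ fexp_measurable]
        measurable_compose[OF _ v]) (simp_all add: borel_prod[symmetric])
  show "integrable cyl (\<lambda>p. (cmod (v (fst p) * fexp n (snd p)))\<^sup>2)"
    unfolding cyl_eq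
  proof (rule cyl.Fubini_integrable)
    show "(\<lambda>p. (cmod (v (fst p) * fexp n (snd p)))\<^sup>2) \<in> borel_measurable (lborel \<Otimes>\<^sub>M circ)"
      using m by (simp add: cyl_eq)
  qed (use sqint_integrable[OF assms] in \<open>simp_all add: norm_mult measure_circ_space\<close>)
qed

text \<open>The support lies over \<open>[-R, R]\<close>, a part of the cylinder of finite measure,
  and continuity on the compact set \<open>{-R..R} \<times> {0..1}\<close> gives a bound
  there.\<close>

lemma sqint_cyl_compact:
  assumes g: "continuous_on UNIV g" and zero: "\<And>p. \<bar>fst p\<bar> > R \<Longrightarrow> g p = 0"
  shows "sqint cyl g"
proof -
  have "compact ({-R..R} \<times> {0..1::real})" by (intro compact_Times compact_Icc)
  then obtain B where B: "\<And>p. p \<in> {-R..R} \<times> {0..1} \<Longrightarrow> cmod (g p) \<le> B"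
    using continuous_on_compact_bounded[OF _ continuous_on_subset[OF g subset_UNIV]] by meson
  have ms: "{-R..R} \<times> {0..<1} \<in> sets cyl"
    unfolding cyl_eq using sets.top[of circ] by auto
  have "emeasure cyl ({-R..R} \<times> {0..<1}) = emeasure lborel {-R..R} * emeasure circ {0..<1}"
    unfolding cyl_eq by (intro circ.emeasure_pair_measure_Times) (use sets.top[of circ] in auto)
  then have fin: "emeasure cyl ({-R..R} \<times> {0..<1}) < \<infinity>"
    by (simp add: emeasure_circ_space emeasure_lborel_Icc_eq)
  show ?thesis
  proof (rule sqint_bound)
    show "g \<in> borel_measurable cyl"
      by (intro measurable_cylI borel_measurable_continuous_onI g)
    show "integrable cyl (\<lambda>p. indicator ({-R..R} \<times> {0..<1}) p * B\<^sup>2)"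
      by (intro integrable_mult_left integrable_real_indicator ms fin)
    show "AE p in cyl. (cmod (g p))\<^sup>2 \<le> indicator ({-R..R} \<times> {0..<1}) p * B\<^sup>2"
    proof (rule AE_I2)
      fix p assume "p \<in> space cyl"
      then have p: "snd p \<in> {0..<1}" by (auto simp: space_cyl)
      show "(cmod (g p))\<^sup>2 \<le> indicator ({-R..R} \<times> {0..<1}) p * B\<^sup>2"
      proof (cases "\<bar>fst p\<bar> > R")
        case True
        then show ?thesis using zero by simp
      next
        case False
        then have "fst p \<in> {-R..R}" by (auto simp: abs_le_iff)
        then have "p \<in> {-R..R} \<times> {0..<1}" using p by (simp add: mem_Times_iff)
        moreover from this have "cmod (g p) \<le> B" by (intro B) (auto simp: mem_Times_iff)
        ultimately show ?thesis by (simp add: power_mono)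
      qed
    qed
  qed
qed

text \<open>Fourier convergence holds on almost every slice, and the slice errors are dominated by
  the squared slice norms of \<open>u\<close>, so convergence survives integration over
  \<open>r\<close>.\<close>

lemma fourier_cyl:
  assumes u: "u \<in> L2"
  shows "(\<lambda>N. LINT p|cyl. (cmod (u p - (\<Sum>n\<in>{- int N..int N}. fmode u n (fst p) * fexp n (snd p))))\<^sup>2) \<longlonglongrightarrow> 0"
proof -
  define d where "d N p = u p - (\<Sum>n\<in>{- int N..int N}. fmode u n (fst p) * fexp n (snd p))" for N p
  have d: "sqint cyl (d N)" for N
    unfolding d_def by (intro sqint_diff L2_sqint u sqint_sum sqint_cyl_separated sqint_fmode)
  have d_slice: "d N (r, t) = u (r, t) - fpart (\<lambda>t. u (r, t)) N t" for N r t
    by (simp add: d_def fpart_def fmode_def)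
  have "(\<lambda>N. LINT r|lborel. LINT t|circ. (cmod (d N (r, t)))\<^sup>2) \<longlonglongrightarrow> (LINT r|(lborel::real measure). 0)"
  proof (rule integral_dominated_convergence)
    show "integrable lborel (\<lambda>r. LINT t|circ. (cmod (u (r, t)))\<^sup>2)"
      by (rule integral_cyl_sq(2)[OF L2_sqint[OF u]])
    show "AE r in lborel. (\<lambda>N. LINT t|circ. (cmod (d N (r, t)))\<^sup>2) \<longlonglongrightarrow> 0"
      using sqint_slice[OF u] unfolding d_slice by eventually_elim (rule fpart_error_tendsto)
    show "AE r in lborel. norm (LINT t|circ. (cmod (d N (r, t)))\<^sup>2) \<le> (LINT t|circ. (cmod (u (r, t)))\<^sup>2)" for N
      using sqint_slice[OF u] unfolding d_slice
    proof eventually_elim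
      case (elim r)
      show ?case using fpart_error_le[OF elim, of N] by (simp add: integral_nonneg_AE)
    qed
    show "(\<lambda>r. LINT t|circ. (cmod (d N (r, t)))\<^sup>2) \<in> borel_measurable lborel" for N
      by (rule borel_measurable_integrable[OF integral_cyl_sq(2)[OF d]])
  qed simp
  then show ?thesis unfolding d_def[symmetric] integral_cyl_sq(1)[OF d] by simp
qed

lemma sqint_zero_AE:
  assumes "sqint M g" "(LINT x|M. (cmod (g x))\<^sup>2) = 0" shows "AE x in M. g x = 0"
  using integral_nonneg_eq_0_iff_AE[OF sqint_integrable[OF assms(1)]] assms(2) by auto

text \<open>Once \<open>N\<close> reaches \<open>\<bar>n\<bar>\<close>, every partial Fourier sum
  equals the one remaining term almost everywhere, so an error that is constant in \<open>N\<close>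
  tends to 0. There are only countably many weights, hence one common null set of radii.\<close>

lemma AE_eq_single_mode:
  assumes u: "u \<in> L2" and modes: "\<And>k. k \<noteq> n \<Longrightarrow> AE r in lborel. fmode u k r = 0"
  shows "AE p in cyl. u p = fmode u n (fst p) * fexp n (snd p)"
proof -
  define g where "g p = u p - fmode u n (fst p) * fexp n (snd p)" for p
  have g: "sqint cyl g"
    unfolding g_def by (intro sqint_diff L2_sqint u sqint_cyl_separated sqint_fmode)
  have zero: "AE r in lborel. \<forall>k. k \<noteq> n \<longrightarrow> fmode u k r = 0"
    unfolding AE_all_countable using modes by auto
  have eq: "(LINT p|cyl. (cmod (u p - (\<Sum>k\<in>{- int N..int N}. fmode u k (fst p) * fexp k (snd p))))\<^sup>2)
      = (LINT p|cyl. (cmod (g p))\<^sup>2)" if "N \<ge> nat \<bar>n\<bar>" for N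
  proof (rule integral_cong_AE)
    show "AE p in cyl. (cmod (u p - (\<Sum>k\<in>{- int N..int N}. fmode u k (fst p) * fexp k (snd p))))\<^sup>2 = (cmod (g p))\<^sup>2"
      using AE_cyl_fst[OF zero]
    proof eventually_elim
      case (elim p)
      have "(\<Sum>k\<in>{- int N..int N}. fmode u k (fst p) * fexp k (snd p))
          = (\<Sum>k\<in>{- int N..int N}. if k = n then fmode u n (fst p) * fexp n (snd p) else 0)"
        using elim by (intro sum.cong) auto
      also have "\<dots> = fmode u n (fst p) * fexp n (snd p)" using that by (subst sum.delta) auto
      finally show ?case by (simp add: g_def)
    qed
    have "sqint cyl (\<lambda>p. u p - (\<Sum>k\<in>{- int N..int N}. fmode u k (fst p) * fexp k (snd p)))"
      by (intro sqint_diff L2_sqint u sqint_sum sqint_cyl_separated sqint_fmode)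
    then show "(\<lambda>p. (cmod (u p - (\<Sum>k\<in>{- int N..int N}. fmode u k (fst p) * fexp k (snd p))))\<^sup>2) \<in> borel_measurable cyl"
      by (intro borel_measurable_integrable sqint_integrable)
    show "(\<lambda>p. (cmod (g p))\<^sup>2) \<in> borel_measurable cyl"
      by (intro borel_measurable_integrable sqint_integrable g)
  qed
  have "(\<lambda>N. LINT p|cyl. (cmod (u p - (\<Sum>k\<in>{- int N..int N}. fmode u k (fst p) * fexp k (snd p))))\<^sup>2)
      \<longlonglongrightarrow> (LINT p|cyl. (cmod (g p))\<^sup>2)"
    by (rule tendsto_eventually) (use eq in \<open>auto simp: eventually_sequentially\<close>)
  then have "(LINT p|cyl. (cmod (g p))\<^sup>2) = 0"
    using fourier_cyl[OF u] LIMSEQ_unique by blast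
  then have "AE p in cyl. g p = 0" by (rule sqint_zero_AE[OF g])
  then show ?thesis by eventually_elim (simp add: g_def)
qed

section \<open>The equation on a single mode\<close>

text \<open>
  \<open>\<tau> = 1\<close> is \<open>D\<^sup>+\<close> and \<open>\<tau> = -1\<close> is \<open>D\<^sup>-\<close>, both with \<open>s = 1\<close>, \<open>t = 0\<close> and \<open>q = (1 + f\<^sup>\<epsilon>) \<rho>\<close>; the formal adjoint of
  \<open>\<tau>\<close> is \<open>- \<tau>\<close>, and on weight \<open>n\<close> the solutions are multiples of \<open>exp (2\<pi>\<tau>A)\<close> with \<open>A' = n - q\<close>.
\<close>

definition dirac_sgn ::
  "(real \<Rightarrow> real) \<Rightarrow> real \<Rightarrow> (real \<times> real \<Rightarrow> complex) \<Rightarrow> real \<times> real \<Rightarrow> complex" where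
  "dirac_sgn q \<tau> \<phi> p = complex_of_real \<tau> * (pd_th \<phi> p - 2 * pi * \<i> * q (fst p) * \<phi> p) - \<i> * pd_r \<phi> p"

definition ker_sgn :: "(real \<Rightarrow> real) \<Rightarrow> real \<Rightarrow> (real \<times> real \<Rightarrow> complex) set" where
  "ker_sgn q \<tau> = {u \<in> L2. \<forall>\<phi>. test_sec \<phi> \<longrightarrow> (LINT p|cyl. u p * cnj (dirac_sgn q (- \<tau>) \<phi> p)) = 0}"

text \<open>At \<open>t = 0\<close> the \<open>s\<close>-term has the same form as the connection
  term, and the two merge into one potential; the sign \<open>- 1\<close> inside the proof is that
  of the adjoint used for testing.\<close>

lemma ker_plus_eq: "ker_plus \<rho> f 1 0 \<epsilon>\<^sub>1 \<epsilon>\<^sub>2 = ker_sgn (\<lambda>r. \<rho> r + f r powr \<epsilon>\<^sub>1 * \<rho> r) 1"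
proof -
  have "dirac_minus \<rho> f 1 0 \<epsilon>\<^sub>1 \<epsilon>\<^sub>2 = dirac_sgn (\<lambda>r. \<rho> r + f r powr \<epsilon>\<^sub>1 * \<rho> r) (- 1)"
    by (intro ext) (simp add: dirac_minus_def dirac_sgn_def algebra_simps)
  then show ?thesis by (simp add: ker_plus_def ker_sgn_def)
qed

lemma ker_minus_eq: "ker_minus \<rho> f 1 0 \<epsilon>\<^sub>1 \<epsilon>\<^sub>2 = ker_sgn (\<lambda>r. \<rho> r + f r powr \<epsilon>\<^sub>1 * \<rho> r) (- 1)"
proof -
  have "dirac_plus \<rho> f 1 0 \<epsilon>\<^sub>1 \<epsilon>\<^sub>2 = dirac_sgn (\<lambda>r. \<rho> r + f r powr \<epsilon>\<^sub>1 * \<rho> r) 1"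
    by (intro ext) (simp add: dirac_plus_def dirac_sgn_def algebra_simps)
  then show ?thesis by (simp add: ker_minus_def ker_sgn_def)
qed

lemma ker_sgn_L2: "u \<in> ker_sgn q \<tau> \<Longrightarrow> u \<in> L2"
  by (simp add: ker_sgn_def)

lemma deriv_zero_outside:
  fixes w :: "real \<Rightarrow> 'a :: real_normed_vector"
  assumes "(w has_vector_derivative d) (at x)" "\<And>y. \<bar>y\<bar> > R \<Longrightarrow> w y = 0" "\<bar>x\<bar> > R"
  shows "d = 0"
proof -
  have "open {y::real. R < \<bar>y\<bar>}" by (intro open_Collect_less continuous_intros)
  then have "((\<lambda>_. 0) has_vector_derivative d) (at x)"
    using assms by (intro has_vector_derivative_transform_within_open[OF assms(1)]) auto
  then show ?thesis using vector_derivative_unique_at has_vector_derivative_const by blast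
qed

lemma periodic_mode: "periodic (mode K g n)"
  by (simp add: periodic_def mode_def fexp_shift)

lemma continuous_mode:
  assumes "continuous_on UNIV g" shows "continuous_on UNIV (mode K g n)"
  unfolding mode_def
  by (intro continuous_intros continuous_on_compose2[OF assms] continuous_on_compose2[OF continuous_fexp]) auto

lemma fmode_weak_equation:
  assumes u: "u \<in> ker_sgn q \<tau>"
    and A: "smooth1 A" "\<And>r. (A has_real_derivative of_int n - q r) (at r)"
    and w: "smooth1 w'" "\<And>r. (w has_real_derivative w' r) (at r)" "\<And>r. \<bar>r\<bar> > R \<Longrightarrow> w r = 0"
  shows "(LINT r|lborel. (fmode u n r * complex_of_real (exp (- (2 * pi * \<tau>) * A r))) * complex_of_real (w' r)) = 0"
proof -
  define E where "E r = exp (- (2 * pi * \<tau>) * A r)" for r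
  have E: "smooth1 E" unfolding E_def by (intro smooth1.exp smooth1_cmult A)
  have E': "(E has_real_derivative E r * (- (2 * pi * \<tau>) * (of_int n - q r))) (at r)" for r
    unfolding E_def by (rule DERIV_fun_exp) (intro DERIV_cmult A)
  define g where "g r = w r * E r" for r
  have g: "smooth1 g" unfolding g_def by (intro smooth1.mult E smooth1.primitive[OF w(1,2)])
  have g': "(g has_real_derivative w' r * E r + E r * (- (2 * pi * \<tau>) * (of_int n - q r)) * w r) (at r)" for r
    unfolding g_def by (rule DERIV_mult[OF w(2) E'])
  \<comment> \<open>The factor \<open>E\<close> in the test section cancels the zeroth-order term of the adjoint operator.\<close>
  define \<phi> where "\<phi> = mode 1 g n"
  have "test_sec \<phi>" unfolding test_sec_def
    by (auto simp: \<phi>_def smooth_sec_mode[OF g] periodic_mode mode_def g_def intro!: exI[of _ R] w(3))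
  have D: "dirac_sgn q (- \<tau>) \<phi> p = mode (- \<i>) (\<lambda>r. w' r * E r) n p" for p
    unfolding dirac_sgn_def \<phi>_def pd_r_mode[OF g'] pd_th_mode
    by (simp add: mode_def g_def algebra_simps)
  have w'0: "w' r = 0" if "\<bar>r\<bar> > R" for r
    using deriv_zero_outside[of w "w' r" r R] w(2,3) that
    by (simp add: has_real_derivative_iff_has_vector_derivative)
  \<comment> \<open>Compact support of \<open>w'\<close> makes the pairing with \<open>u\<close>
    integrable, as Fubini requires.\<close>
  have Dsq: "sqint cyl (\<lambda>p. cnj (mode (- \<i>) (\<lambda>r. w' r * E r) n p))"
    by (intro sqint_cnj sqint_cyl_compact[where R = R] continuous_mode smooth1_continuous smooth1.mult w(1) E)
       (simp add: mode_def w'0)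
  have "0 = (LINT p|cyl. u p * cnj (dirac_sgn q (- \<tau>) \<phi> p))"
    using u \<open>test_sec \<phi>\<close> by (simp add: ker_sgn_def)
  also have "\<dots> = (LINT r|lborel. LINT t|circ. u (r, t) * cnj (mode (- \<i>) (\<lambda>r. w' r * E r) n (r, t)))"
    unfolding D
    using cyl.integral_fst'[OF sqint_mult_integrable[OF L2_sqint[OF ker_sgn_L2[OF u]] Dsq, unfolded cyl_eq]]
    by (simp add: cyl_eq)
  also have "\<dots> = (LINT r|lborel. \<i> * (fmode u n r * complex_of_real (E r) * complex_of_real (w' r)))"
  proof (rule Bochner_Integration.integral_cong)
    fix r :: real
    have "(LINT t|circ. u (r, t) * cnj (mode (- \<i>) (\<lambda>r. w' r * E r) n (r, t)))
        = (LINT t|circ. (\<i> * complex_of_real (E r) * complex_of_real (w' r)) * (u (r, t) * cnj (fexp n t)))"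
      by (simp add: mode_def mult_ac)
    also have "\<dots> = (\<i> * complex_of_real (E r) * complex_of_real (w' r)) * fmode u n r"
      by (subst integral_mult_right_zero) (simp add: fmode_def fcoef_def)
    finally show "(LINT t|circ. u (r, t) * cnj (mode (- \<i>) (\<lambda>r. w' r * E r) n (r, t)))
        = \<i> * (fmode u n r * complex_of_real (E r) * complex_of_real (w' r))" by (simp add: mult_ac)
  qed simp
  also have "\<dots> = \<i> * (LINT r|lborel. fmode u n r * complex_of_real (E r) * complex_of_real (w' r))"
    by (rule integral_mult_right_zero)
  finally show ?thesis by (simp add: E_def)
qed

text \<open>Du Bois-Reymond asks for local integrability: the mode is square-integrable, and the
  reciprocal \<open>E\<close> of the formal solution is bounded on compact intervals.\<close>

lemma fmode_solution:
  assumes H: "smooth_step H" and u: "u \<in> ker_sgn q \<tau>"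
    and A: "smooth1 A" "\<And>r. (A has_real_derivative of_int n - q r) (at r)"
  shows "\<exists>c. AE r in lborel. fmode u n r = c * complex_of_real (exp (2 * pi * \<tau> * A r))"
proof -
  define E where "E r = exp (- (2 * pi * \<tau>) * A r)" for r
  have E: "continuous_on S E" for S
    unfolding E_def by (intro smooth1_continuous smooth1.exp smooth1_cmult A)
  have "\<exists>c. AE r in lborel. fmode u n r * complex_of_real (E r) = c"
  proof (rule du_bois_reymond[OF H])
    fix R
    obtain B where B: "\<And>r. r \<in> {-R..R} \<Longrightarrow> \<bar>E r\<bar> \<le> B"
      using continuous_on_compact_bounded[OF compact_Icc E, of "-R" R] unfolding real_norm_def by meson
    have "sqint lborel (\<lambda>r. complex_of_real (indicator {-R..R} r * E r))"
    proof (rule sqint_bound)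
      show "(\<lambda>r. complex_of_real (indicator {-R..R} r * E r)) \<in> borel_measurable lborel"
        using borel_measurable_continuous_onI[OF E] by measurable
      show "integrable lborel (\<lambda>r. indicator {-R..R} r * B\<^sup>2)"
        by (intro integrable_mult_left integrable_real_indicator) (auto simp: emeasure_lborel_Icc_eq)
      show "AE r in lborel. (cmod (complex_of_real (indicator {-R..R} r * E r)))\<^sup>2 \<le> indicator {-R..R} r * B\<^sup>2"
        using B by (intro AE_I2) (auto simp: indicator_def abs_le_square_iff[symmetric] intro: order_trans[OF _ abs_ge_self])
    qed
    from sqint_mult_integrable[OF sqint_fmode[OF ker_sgn_L2[OF u]] this]
    show "set_integrable lborel {-R..R} (\<lambda>r. fmode u n r * complex_of_real (E r))"
      by (simp add: set_integrable_def scaleR_conv_of_real mult_ac)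
  next
    fix w w' R assume "smooth1 w'" "\<And>x. (w has_real_derivative w' x) (at x)" "\<And>x. R < \<bar>x\<bar> \<Longrightarrow> w x = 0"
    then show "(LINT r|lborel. fmode u n r * complex_of_real (E r) * complex_of_real (w' r)) = 0"
      unfolding E_def by (rule fmode_weak_equation[OF u A])
  qed
  then obtain c where "AE r in lborel. fmode u n r * complex_of_real (E r) = c" by blast
  then have "AE r in lborel. fmode u n r = c * complex_of_real (exp (2 * pi * \<tau> * A r))"
  proof eventually_elim
    case (elim r)
    have "E r * exp (2 * pi * \<tau> * A r) = 1" by (simp add: E_def flip: exp_add)
    then have "complex_of_real (E r) * complex_of_real (exp (2 * pi * \<tau> * A r)) = 1"
      by (metis of_real_1 of_real_mult)
    then show ?case using elim by (metis mult.assoc mult.right_neutral)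
  qed
  then show ?thesis by blast
qed

section \<open>Derivatives of test sections, and formal solutions as weak solutions\<close>

lemma smooth_sec_differentiable: "smooth_sec \<phi> \<Longrightarrow> \<phi> differentiable (at p)"
  by (erule smooth_sec.cases) blast

lemma smooth_sec_pd: "smooth_sec \<phi> \<Longrightarrow> smooth_sec (pd_r \<phi>)" "smooth_sec \<phi> \<Longrightarrow> smooth_sec (pd_th \<phi>)"
  by (cases rule: smooth_sec.cases, auto)+

lemma smooth_sec_continuous: "smooth_sec \<phi> \<Longrightarrow> continuous_on UNIV \<phi>"
  by (simp add: continuous_at_imp_continuous_on differentiable_imp_continuous_within smooth_sec_differentiable)

lemma smooth_sec_pd_r:
  assumes "smooth_sec \<phi>" shows "((\<lambda>x. \<phi> (x, t)) has_vector_derivative pd_r \<phi> (r, t)) (at r)"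
proof -
  have "(\<lambda>x. \<phi> (x, t)) differentiable (at r)"
    by (rule differentiable_compose[of \<phi> "\<lambda>x. (x, t)", OF smooth_sec_differentiable[OF assms]])
       (auto intro!: differentiableI has_derivative_Pair has_derivative_ident has_derivative_const)
  then show ?thesis by (simp add: pd_r_def vector_derivative_works)
qed

lemma smooth_sec_pd_th:
  assumes "smooth_sec \<phi>" shows "((\<lambda>y. \<phi> (r, y)) has_vector_derivative pd_th \<phi> (r, t)) (at t)"
proof -
  have "(\<lambda>y. \<phi> (r, y)) differentiable (at t)"
    by (rule differentiable_compose[of \<phi> "\<lambda>y. (r, y)", OF smooth_sec_differentiable[OF assms]])
       (auto intro!: differentiableI has_derivative_Pair has_derivative_ident has_derivative_const)
  then show ?thesis by (simp add: pd_th_def vector_derivative_works)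
qed

lemma pd_zero_outside:
  assumes "smooth_sec \<phi>" "\<And>r t. \<bar>r\<bar> > R \<Longrightarrow> \<phi> (r, t) = 0" "\<bar>r\<bar> > R"
  shows "pd_r \<phi> (r, t) = 0" "pd_th \<phi> (r, t) = 0"
proof -
  show "pd_r \<phi> (r, t) = 0"
    using smooth_sec_pd_r[OF assms(1)] assms(2,3) by (rule deriv_zero_outside)
  have "(\<lambda>y. \<phi> (r, y)) = (\<lambda>y. 0)" using assms by auto
  then have "((\<lambda>y. 0) has_vector_derivative pd_th \<phi> (r, t)) (at t)"
    using smooth_sec_pd_th[OF assms(1), of r t] by simp
  then show "pd_th \<phi> (r, t) = 0"
    using vector_derivative_unique_at has_vector_derivative_const by blast
qed

lemma continuous_on_fst_real:
  assumes "continuous_on UNIV (q :: real \<Rightarrow> real)"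
  shows "continuous_on UNIV (\<lambda>p :: real \<times> real. complex_of_real (q (fst p)))"
  by (intro continuous_on_of_real continuous_on_compose2[OF assms] continuous_on_fst continuous_on_id) auto

lemma sqint_dirac_sgn:
  assumes q: "continuous_on UNIV q" and \<phi>: "test_sec \<phi>"
  shows "sqint cyl (\<lambda>p. cnj (dirac_sgn q \<tau> \<phi> p))"
proof -
  obtain R where s: "smooth_sec \<phi>" and R: "\<And>r t. \<bar>r\<bar> > R \<Longrightarrow> \<phi> (r, t) = 0"
    using \<phi> by (auto simp: test_sec_def)
  show ?thesis
  proof (intro sqint_cnj sqint_cyl_compact[where R = R])
    show "continuous_on UNIV (dirac_sgn q \<tau> \<phi>)"
      unfolding dirac_sgn_def
      by (intro continuous_intros smooth_sec_continuous smooth_sec_pd s continuous_on_fst_real q)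
    show "dirac_sgn q \<tau> \<phi> p = 0" if "\<bar>fst p\<bar> > R" for p
      using that R[of "fst p" "snd p"] pd_zero_outside[where r = "fst p" and t = "snd p", OF s R] by (simp add: dirac_sgn_def)
  qed
qed

text \<open>Integration by parts against a test section: along the circle the boundary terms cancel
  by periodicity, along the line they vanish by compact support.\<close>

lemma mode_solution_in_ker:
  fixes A q :: "real \<Rightarrow> real" and n :: int and \<tau> :: real
  defines "E \<equiv> mode 1 (\<lambda>r. exp (2 * pi * \<tau> * A r)) n"
  assumes A: "\<And>r. (A has_real_derivative of_int n - q r) (at r)"
    and q: "continuous_on UNIV q" and E: "E \<in> L2"
  shows "E \<in> ker_sgn q \<tau>"
proof -
  have "(LINT p|cyl. E p * cnj (dirac_sgn q (- \<tau>) \<phi> p)) = 0" if "test_sec \<phi>" for \<phi>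
  proof -
    obtain R where s: "smooth_sec \<phi>" and per: "periodic \<phi>" and R: "\<And>r t. \<bar>r\<bar> > R \<Longrightarrow> \<phi> (r, t) = 0"
      using \<open>test_sec \<phi>\<close> by (auto simp: test_sec_def)
    define w where "w p = E p * cnj (\<phi> p)" for p
    \<comment> \<open>\<open>\<alpha>\<close> and \<open>\<beta>\<close> are arranged so that
      \<open>E p * \<alpha> p\<close> and \<open>E p * \<beta> p\<close> are the derivatives of
      \<open>w\<close> in the radial and in the angular direction.\<close>
    define \<alpha> where "\<alpha> p = cnj (pd_r \<phi> p) + 2 * pi * \<tau> * (of_int n - complex_of_real (q (fst p))) * cnj (\<phi> p)" for p
    define \<beta> where "\<beta> p = cnj (pd_th \<phi> p) + 2 * pi * \<i> * of_int n * cnj (\<phi> p)" for p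
    have zero: "\<alpha> p = 0" "\<beta> p = 0" "w p = 0" if "\<bar>fst p\<bar> > R" for p
      using that R[of "fst p" "snd p"] pd_zero_outside[where r = "fst p" and t = "snd p", OF s R]
      by (simp_all add: \<alpha>_def \<beta>_def w_def)
    have c\<alpha>: "continuous_on UNIV \<alpha>" and c\<beta>: "continuous_on UNIV \<beta>"
      unfolding \<alpha>_def \<beta>_def
      by (intro continuous_intros continuous_on_cnj smooth_sec_continuous smooth_sec_pd s continuous_on_fst_real q)+
    have "continuous_on UNIV (\<lambda>r. exp (2 * pi * \<tau> * A r))"
      by (intro continuous_intros continuous_at_imp_continuous_on ballI DERIV_isCont[OF A])
    then have cE: "continuous_on UNIV E" unfolding E_def by (rule continuous_mode)
    have i\<alpha>: "integrable cyl (\<lambda>p. E p * \<alpha> p)" and i\<beta>: "integrable cyl (\<lambda>p. E p * \<beta> p)"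
      using zero by (intro sqint_mult_integrable L2_sqint E sqint_cyl_compact[where R = R] c\<alpha> c\<beta>; simp)+
    have dE_r: "((\<lambda>x. E (x, t)) has_vector_derivative 2 * pi * \<tau> * (of_int n - complex_of_real (q r)) * E (r, t)) (at r)" for r t
    proof -
      have "((\<lambda>r. exp (2 * pi * \<tau> * A r)) has_real_derivative exp (2 * pi * \<tau> * A r) * (2 * pi * \<tau> * (of_int n - q r))) (at r)"
        by (rule DERIV_fun_exp) (intro DERIV_cmult A)
      then have "((\<lambda>r. complex_of_real (exp (2 * pi * \<tau> * A r))) has_vector_derivative
          complex_of_real (exp (2 * pi * \<tau> * A r) * (2 * pi * \<tau> * (of_int n - q r)))) (at r)"
        using has_real_derivative_iff_has_vector_derivative has_vector_derivative_of_real by blast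
      then have "((\<lambda>x. E (x, t)) has_vector_derivative
          1 * complex_of_real (exp (2 * pi * \<tau> * A r) * (2 * pi * \<tau> * (of_int n - q r))) * fexp n t) (at r)"
        unfolding E_def mode_def fst_conv snd_conv
        by (intro has_vector_derivative_mult_left has_vector_derivative_mult_right)
      then show ?thesis by (simp add: E_def mode_def mult_ac)
    qed
    have dE_t: "((\<lambda>y. E (r, y)) has_vector_derivative 2 * pi * \<i> * of_int n * E (r, t)) (at t)" for r t
    proof -
      have "((\<lambda>y. E (r, y)) has_vector_derivative
          1 * complex_of_real (exp (2 * pi * \<tau> * A r)) * (2 * pi * \<i> * of_int n * fexp n t)) (at t)"
        unfolding E_def mode_def fst_conv snd_conv
        by (intro has_vector_derivative_mult_right has_vector_derivative_fexp)
      then show ?thesis by (simp add: E_def mode_def mult_ac)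
    qed
    have dw_r: "((\<lambda>x. w (x, t)) has_vector_derivative E (r, t) * \<alpha> (r, t)) (at r)" for r t
    proof -
      have "((\<lambda>x. w (x, t)) has_vector_derivative
          E (r, t) * cnj (pd_r \<phi> (r, t)) + 2 * pi * \<tau> * (of_int n - complex_of_real (q r)) * E (r, t) * cnj (\<phi> (r, t))) (at r)"
        unfolding w_def
        by (intro has_vector_derivative_mult dE_r has_vector_derivative_cnj smooth_sec_pd_r s)
      then show ?thesis by (simp add: \<alpha>_def algebra_simps)
    qed
    have dw_t: "((\<lambda>y. w (r, y)) has_vector_derivative E (r, t) * \<beta> (r, t)) (at t)" for r t
    proof -
      have "((\<lambda>y. w (r, y)) has_vector_derivative
          E (r, t) * cnj (pd_th \<phi> (r, t)) + 2 * pi * \<i> * of_int n * E (r, t) * cnj (\<phi> (r, t))) (at t)"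
        unfolding w_def
        by (intro has_vector_derivative_mult dE_t has_vector_derivative_cnj smooth_sec_pd_th s)
      then show ?thesis by (simp add: \<beta>_def algebra_simps)
    qed
    have "(LINT p|cyl. E p * \<beta> p) = (LINT r|lborel. LINT t|circ. E (r, t) * \<beta> (r, t))"
      using cyl.integral_fst'[OF i\<beta>[unfolded cyl_eq]] by (simp add: cyl_eq)
    also have "\<dots> = (LINT r|(lborel::real measure). 0)"
    proof (rule Bochner_Integration.integral_cong)
      fix r :: real
      have "(LINT t|circ. E (r, t) * \<beta> (r, t)) = w (r, 1) - w (r, 0)"
        by (intro integral_circ_FTC dw_t continuous_intros continuous_on_compose2[OF cE] continuous_on_compose2[OF c\<beta>]) auto
      also have "w (r, 1) = w (r, 0)"
        using per[unfolded periodic_def, rule_format, of r 0] by (simp add: w_def E_def mode_def)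
      finally show "(LINT t|circ. E (r, t) * \<beta> (r, t)) = 0" by simp
    qed simp
    finally have I\<beta>: "(LINT p|cyl. E p * \<beta> p) = 0" by simp
    \<comment> \<open>Opposite order of integration: the exact derivative is now radial, so the
      inner integral runs over \<open>r\<close>.\<close>
    have "(LINT p|cyl. E p * \<alpha> p) = (LINT t|circ. LINT r|lborel. E (r, t) * \<alpha> (r, t))"
      using cyl.integral_snd[of "\<lambda>r t. E (r, t) * \<alpha> (r, t)"] i\<alpha> by (simp add: cyl_eq split_beta')
    also have "\<dots> = (LINT t|circ. 0)"
    proof (rule Bochner_Integration.integral_cong)
      fix t :: real
      \<comment> \<open>The absolute value ensures \<open>- K \<le> K\<close> for negative
        \<open>R\<close> too, and the added 1 puts both endpoints strictly outside the
        support.\<close>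
      define K where "K = \<bar>R\<bar> + 1"
      have "(LINT r|lborel. E (r, t) * \<alpha> (r, t)) = (LINT r|lborel. indicator {-K..K} r *\<^sub>R (E (r, t) * \<alpha> (r, t)))"
        by (intro Bochner_Integration.integral_cong) (auto simp: indicator_def K_def intro: zero)
      also have "\<dots> = w (K, t) - w (- K, t)"
        by (intro integral_FTC_atLeastAtMost has_vector_derivative_at_within[OF dw_r] continuous_intros
            continuous_on_compose2[OF cE] continuous_on_compose2[OF c\<alpha>]) (auto simp: K_def)
      also have "\<dots> = 0" using zero(3)[of "(K, t)"] zero(3)[of "(- K, t)"] by (simp add: K_def)
      finally show "(LINT r|lborel. E (r, t) * \<alpha> (r, t)) = 0" .
    qed simp
    finally have I\<alpha>: "(LINT p|cyl. E p * \<alpha> p) = 0" by simp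
    \<comment> \<open>The integrand is \<open>- \<tau> \<partial>\<^sub>\<theta> w + \<i> \<partial>\<^sub>r w\<close>.\<close>
    have "E p * cnj (dirac_sgn q (- \<tau>) \<phi> p) = (- complex_of_real \<tau>) * (E p * \<beta> p) + \<i> * (E p * \<alpha> p)" for p
      by (simp add: dirac_sgn_def \<alpha>_def \<beta>_def algebra_simps)
    then have "(LINT p|cyl. E p * cnj (dirac_sgn q (- \<tau>) \<phi> p))
        = (- complex_of_real \<tau>) * (LINT p|cyl. E p * \<beta> p) + \<i> * (LINT p|cyl. E p * \<alpha> p)"
      using i\<alpha> i\<beta> by simp
    then show ?thesis by (simp add: I\<alpha> I\<beta>)
  qed
  then show ?thesis using E by (simp add: ker_sgn_def)
qed

section \<open>Kernels as closed linear subspaces\<close>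

lemma L2_sum:
  assumes "\<And>i. i \<in> I \<Longrightarrow> f i \<in> L2" shows "(\<lambda>p. \<Sum>i\<in>I. c i * f i p) \<in> L2"
proof (rule L2I)
  show "(\<lambda>p. \<Sum>i\<in>I. c i * f i p) \<in> borel_measurable borel"
    by (rule borel_measurable_sum, rule borel_measurable_times, simp, rule L2_measurable, rule assms)
  show "periodic (\<lambda>p. \<Sum>i\<in>I. c i * f i p)"
    using assms by (auto simp: periodic_def L2_def)
  show "sqint cyl (\<lambda>p. \<Sum>i\<in>I. c i * f i p)"
    by (intro sqint_sum sqint_cmult L2_sqint assms)
qed

lemma cspan_subset_ker_sgn:
  assumes q: "continuous_on UNIV q" and S: "S \<subseteq> ker_sgn q \<tau>"
  shows "cspan S \<subseteq> ker_sgn q \<tau>"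
proof
  fix u assume "u \<in> cspan S"
  then obtain F c where F: "finite F" "F \<subseteq> S" and u: "u = (\<lambda>p. \<Sum>v\<in>F. c v * v p)"
    by (auto simp: cspan_def)
  have K: "v \<in> ker_sgn q \<tau>" if "v \<in> F" for v using that F S by blast
  have "(LINT p|cyl. u p * cnj (dirac_sgn q (- \<tau>) \<phi> p)) = 0" if \<phi>: "test_sec \<phi>" for \<phi>
  proof -
    have "(LINT p|cyl. u p * cnj (dirac_sgn q (- \<tau>) \<phi> p))
        = (LINT p|cyl. (\<Sum>v\<in>F. c v * (v p * cnj (dirac_sgn q (- \<tau>) \<phi> p))))"
      by (simp only: u sum_distrib_right mult.assoc)
    also have "\<dots> = (\<Sum>v\<in>F. LINT p|cyl. c v * (v p * cnj (dirac_sgn q (- \<tau>) \<phi> p)))"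
      by (intro Bochner_Integration.integral_sum integrable_mult_right
          sqint_mult_integrable[OF L2_sqint[OF ker_sgn_L2[OF K]] sqint_dirac_sgn[OF q \<phi>]])
    also have "\<dots> = (\<Sum>v\<in>F. c v * (LINT p|cyl. v p * cnj (dirac_sgn q (- \<tau>) \<phi> p)))"
      by simp
    also have "\<dots> = 0" using K \<phi> by (intro sum.neutral) (auto simp: ker_sgn_def)
    finally show ?thesis .
  qed
  moreover have "u \<in> L2" unfolding u by (rule L2_sum[OF ker_sgn_L2[OF K]])
  ultimately show "u \<in> ker_sgn q \<tau>" by (simp add: ker_sgn_def)
qed

text \<open>Pairing with a fixed test section is continuous in L2. The weighted inequality
  \<open>x * y \<le> x\<^sup>2 / e + e * y\<^sup>2\<close> takes the place of
  Cauchy-Schwarz.\<close>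

lemma L2_closure_subset_ker_sgn:
  assumes q: "continuous_on UNIV q" and S: "S \<subseteq> ker_sgn q \<tau>"
  shows "L2_closure S \<subseteq> ker_sgn q \<tau>"
proof
  fix u assume "u \<in> L2_closure S"
  then have u: "u \<in> L2" and app: "\<And>e. e > 0 \<Longrightarrow> \<exists>v\<in>S \<inter> L2. (LINT p|cyl. (cmod (u p - v p))\<^sup>2) < e"
    by (auto simp: L2_closure_def)
  have "(LINT p|cyl. u p * cnj (dirac_sgn q (- \<tau>) \<phi> p)) = 0" if \<phi>: "test_sec \<phi>" for \<phi>
  proof -
    define D where "D p = cnj (dirac_sgn q (- \<tau>) \<phi> p)" for p
    have D: "sqint cyl D" unfolding D_def by (rule sqint_dirac_sgn[OF q \<phi>])
    define X where "X = (LINT p|cyl. (cmod (D p))\<^sup>2)"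
    have X: "X \<ge> 0" unfolding X_def by (intro integral_nonneg_AE) auto
    have bound: "cmod (LINT p|cyl. u p * D p) \<le> e * (1 + X)" if e: "e > 0" for e
    proof -
      \<comment> \<open>Accuracy \<open>e\<^sup>2\<close> leaves \<open>e\<close> after the division
        by \<open>e\<close> in the weighted inequality.\<close>
      obtain v where v: "v \<in> S" "v \<in> L2" and le: "(LINT p|cyl. (cmod (u p - v p))\<^sup>2) < e\<^sup>2"
        using app[of "e\<^sup>2"] e by auto
      have d: "sqint cyl (\<lambda>p. u p - v p)" by (intro sqint_diff L2_sqint u v)
      have "(LINT p|cyl. v p * D p) = 0"
        using v S \<phi> unfolding D_def by (auto simp: ker_sgn_def)
      then have "(LINT p|cyl. u p * D p) = (LINT p|cyl. (u p - v p) * D p)"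
        using sqint_mult_integrable[OF L2_sqint[OF u] D] sqint_mult_integrable[OF L2_sqint[OF v(2)] D]
        by (simp add: left_diff_distrib)
      also have "cmod \<dots> \<le> (LINT p|cyl. cmod ((u p - v p) * D p))"
        by (rule integral_norm_bound)
      also have "\<dots> \<le> (LINT p|cyl. (cmod (u p - v p))\<^sup>2 / e + e * (cmod (D p))\<^sup>2)"
      proof (rule integral_mono)
        show "integrable cyl (\<lambda>p. cmod ((u p - v p) * D p))"
          by (intro integrable_norm sqint_mult_integrable d D)
        show "integrable cyl (\<lambda>p. (cmod (u p - v p))\<^sup>2 / e + e * (cmod (D p))\<^sup>2)"
          using sqint_integrable[OF d] sqint_integrable[OF D] by simp
        have ineq: "x * y \<le> x\<^sup>2 / e + e * y\<^sup>2" if "x \<ge> 0" "y \<ge> 0" for x y :: real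
        proof (cases "x \<le> e * y")
          case True
          then have "x * y \<le> e * y * y" using that by (intro mult_right_mono)
          then show ?thesis using e by (simp add: power2_eq_square add_increasing)
        next
          case False
          then have "y \<le> x / e" using e by (simp add: field_simps)
          then have "x * y \<le> x * (x / e)" using that by (intro mult_left_mono)
          then show ?thesis using e by (simp add: power2_eq_square add_increasing2)
        qed
        show "cmod ((u p - v p) * D p) \<le> (cmod (u p - v p))\<^sup>2 / e + e * (cmod (D p))\<^sup>2" for p
          unfolding norm_mult by (rule ineq) auto
      qed
      also have "\<dots> = (LINT p|cyl. (cmod (u p - v p))\<^sup>2) / e + e * X"
        using sqint_integrable[OF d] sqint_integrable[OF D] by (simp add: X_def)
      also have "\<dots> \<le> e + e * X"
        using le e by (simp add: divide_le_eq power2_eq_square)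
      finally show ?thesis by (simp add: algebra_simps)
    qed
    have "cmod (LINT p|cyl. u p * D p) \<le> 0"
    proof (rule field_le_epsilon)
      fix e :: real assume "e > 0"
      then show "cmod (LINT p|cyl. u p * D p) \<le> 0 + e"
        using bound[of "e / (1 + X)"] X by simp
    qed
    then show ?thesis by (simp add: D_def)
  qed
  then show "u \<in> ker_sgn q \<tau>" using u by (simp add: ker_sgn_def)
qed

lemma L2_null_subset_ker_sgn: "L2_null \<subseteq> ker_sgn q \<tau>"
proof
  fix u assume "u \<in> L2_null"
  then have u: "u \<in> L2" and null: "AE p in cyl. u p = 0" by (auto simp: L2_null_def)
  have "(LINT p|cyl. u p * cnj (dirac_sgn q (- \<tau>) \<phi> p)) = 0" for \<phi>
    by (rule integral_eq_zero_AE) (use null in eventually_elim, simp)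
  then show "u \<in> ker_sgn q \<tau>" using u by (simp add: ker_sgn_def)
qed

text \<open>A lower bound for \<open>\<tau> * A\<close> on intervals of every length, wherever they
  lie, forces infinite norm unless \<open>c = 0\<close>: an interval of length \<open>K\<close>
  contributes at least \<open>K * k\<close>.\<close>

lemma coefficient_zero:
  assumes v: "sqint lborel v" and eq: "AE r in lborel. v r = c * complex_of_real (exp (2 * pi * \<tau> * A r))"
    and large: "\<And>K. \<exists>a. \<forall>r\<in>{a..a + real K}. L \<le> \<tau> * A r"
  shows "c = 0"
proof (rule ccontr)
  assume "c \<noteq> 0"
  define k where "k = (cmod c * exp (2 * pi * L))\<^sup>2"
  have k: "k > 0" using \<open>c \<noteq> 0\<close> by (simp add: k_def)
  have "real K * k \<le> (LINT r|lborel. (cmod (v r))\<^sup>2)" for K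
  proof -
    obtain a where a: "\<And>r. r \<in> {a..a + real K} \<Longrightarrow> L \<le> \<tau> * A r" using large by blast
    have i: "integrable lborel (\<lambda>r. indicator {a..a + real K} r * k)"
      by (intro integrable_mult_left integrable_real_indicator) (auto simp: emeasure_lborel_Icc_eq)
    have "(LINT r|lborel. indicator {a..a + real K} r * k) \<le> (LINT r|lborel. (cmod (v r))\<^sup>2)"
    proof (rule integral_mono_AE[OF i sqint_integrable[OF v]])
      show "AE r in lborel. indicator {a..a + real K} r * k \<le> (cmod (v r))\<^sup>2"
        using eq
      proof eventually_elim
        case (elim r)
        show ?case
        proof (cases "r \<in> {a..a + real K}")
          case True
          have "exp (2 * pi * L) \<le> exp (2 * pi * \<tau> * A r)" using a[OF True] by (simp add: mult.assoc)
          then have "cmod c * exp (2 * pi * L) \<le> cmod (v r)"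
            by (simp add: elim norm_mult mult_left_mono)
          then have "k \<le> (cmod (v r))\<^sup>2" unfolding k_def by (intro power_mono) auto
          then show ?thesis using True by simp
        qed simp
      qed
    qed
    then show ?thesis by simp
  qed
  moreover obtain K :: nat where "real K * k > (LINT r|lborel. (cmod (v r))\<^sup>2)"
    using reals_Archimedean3[OF k] by blast
  ultimately show False using not_less by blast
qed

text \<open>The bound \<open>L\<close> may depend on the weight but not on \<open>K\<close>. Once
  all modes vanish, completeness leaves only null functions.\<close>

lemma ker_sgn_eq_L2_null:
  assumes H: "smooth_step H"
    and A: "\<And>n. smooth1 (A n)" "\<And>n r. (A n has_real_derivative of_int n - q r) (at r)"
    and large: "\<And>n. \<exists>L. \<forall>K. \<exists>a. \<forall>r\<in>{a..a + real K}. L \<le> \<tau> * A n r"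
  shows "ker_sgn q \<tau> = L2_null"
proof (intro equalityI L2_null_subset_ker_sgn subsetI)
  fix u assume u: "u \<in> ker_sgn q \<tau>"
  have zero: "AE r in lborel. fmode u n r = 0" for n
  proof -
    obtain c where c: "AE r in lborel. fmode u n r = c * complex_of_real (exp (2 * pi * \<tau> * A n r))"
      using fmode_solution[OF H u A] by blast
    obtain L where L: "\<And>K. \<exists>a. \<forall>r\<in>{a..a + real K}. L \<le> \<tau> * A n r" using large[of n] by blast
    have "c = 0" by (rule coefficient_zero[OF sqint_fmode[OF ker_sgn_L2[OF u]] c L])
    then show ?thesis using c by simp
  qed
  have "AE p in cyl. u p = 0"
    \<comment> \<open>The weight 0 is an arbitrary choice, as its own mode vanishes like the
      others.\<close>
    using AE_eq_single_mode[where n = 0, OF ker_sgn_L2[OF u] zero] AE_cyl_fst[OF zero[of 0]]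
    by eventually_elim simp
  then show "u \<in> L2_null" using ker_sgn_L2[OF u] by (simp add: L2_null_def)
qed

section \<open>Weight spaces\<close>

text \<open>The translated domain \<open>{\<alpha>..<1 + \<alpha>}\<close> is cut at 1, and the
  overhanging piece is moved back by one period.\<close>

lemma integral_circ_shift:
  fixes F :: "real \<Rightarrow> complex"
  assumes F: "integrable circ F" and per: "\<And>t. F (t + 1) = F t" and \<alpha>: "0 < \<alpha>" "\<alpha> < 1"
  shows "(LINT t|circ. F (t + \<alpha>)) = (LINT t|circ. F t)"
proof -
  have circ_set: "(LINT t|circ. G t) = (LINT t:{0..<1}|lborel. G t)" for G :: "real \<Rightarrow> complex"
    by (simp add: circ_def integral_restrict_space set_lebesgue_integral_def)
  have i: "set_integrable lborel {0..<1} F"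
    using F by (simp add: circ_def integrable_restrict_space set_integrable_def)
  have i1: "set_integrable lborel {0..<\<alpha>} F" and i2: "set_integrable lborel {\<alpha>..<1} F"
    by (rule set_integrable_subset[OF i]; use \<alpha> in auto)+
  \<comment> \<open>\<open>1 + 1 * t\<close> is the literal shape of the affine substitution with
    shift 1 and slope 1.\<close>
  have shift: "indicator {1..<1 + \<alpha>} (1 + 1 * t) *\<^sub>R F (1 + 1 * t) = indicator {0..<\<alpha>} t *\<^sub>R F t" for t
    using per[of t] by (simp add: indicator_def add.commute)
  have i3: "set_integrable lborel {1..<1 + \<alpha>} F"
    using lborel_integrable_real_affine_iff[of 1 "\<lambda>t. indicator {1..<1 + \<alpha>} t *\<^sub>R F t" 1] i1
    unfolding set_integrable_def shift by simp
  have e3: "(LINT t:{1..<1 + \<alpha>}|lborel. F t) = (LINT t:{0..<\<alpha>}|lborel. F t)"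
    unfolding set_lebesgue_integral_def
    by (subst lborel_integral_real_affine[of 1 _ 1]) (simp_all only: shift, simp_all)
  have "(LINT t|circ. F (t + \<alpha>)) = (LINT t:{0..<1}|lborel. F (t + \<alpha>))" by (rule circ_set)
  also have "\<dots> = (LINT t:{\<alpha>..<1 + \<alpha>}|lborel. F t)"
    unfolding set_lebesgue_integral_def
    by (subst lborel_integral_real_affine[of 1 _ \<alpha>])
       (auto intro!: Bochner_Integration.integral_cong simp: indicator_def add.commute)
  also have "{\<alpha>..<1 + \<alpha>} = {\<alpha>..<1} \<union> {1..<1 + \<alpha>}" using \<alpha> by auto
  also have "(LINT t:\<dots>|lborel. F t) = (LINT t:{\<alpha>..<1}|lborel. F t) + (LINT t:{1..<1 + \<alpha>}|lborel. F t)"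
    by (intro set_integral_Un i2 i3) auto
  also have "\<dots> = (LINT t:{0..<\<alpha>}|lborel. F t) + (LINT t:{\<alpha>..<1}|lborel. F t)" by (simp add: e3)
  also have "\<dots> = (LINT t:{0..<\<alpha>} \<union> {\<alpha>..<1}|lborel. F t)"
    by (intro set_integral_Un[symmetric] i1 i2) auto
  also have "{0..<\<alpha>} \<union> {\<alpha>..<1} = {0..<1}" using \<alpha> by auto
  finally show ?thesis by (simp add: circ_set)
qed

text \<open>The \<open>k\<close>-th coefficient of a rotated slice is computed twice, by rotation
  invariance of the integral and by the weight condition; the results differ by the factor
  \<open>- 1\<close>. One angle suffices, so only one exceptional null set arises.\<close>

lemma fmode_weight:
  assumes u: "u \<in> L2" and weight: "\<And>\<alpha>. AE p in cyl. u (fst p, snd p + \<alpha>) = cis (2 * pi * of_int n * \<alpha>) * u p"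
    and k: "k \<noteq> n"
  shows "AE r in lborel. fmode u k r = 0"
proof -
  \<comment> \<open>Rotating by this angle multiplies the weight \<open>n - k\<close> by \<open>-1\<close>.\<close>
  define \<alpha> where "\<alpha> = 1 / (2 * real_of_int \<bar>n - k\<bar>)"
  have "real_of_int \<bar>n - k\<bar> \<ge> 1" using k by linarith
  then have \<alpha>: "0 < \<alpha>" "\<alpha> < 1" by (auto simp: \<alpha>_def field_simps)
  have anti: "fexp n \<alpha> = - fexp k \<alpha>"
  proof -
    have "2 * pi * of_int (n - k) * \<alpha> = pi \<or> 2 * pi * of_int (n - k) * \<alpha> = - pi"
      using k by (auto simp: \<alpha>_def field_simps abs_if)
    then have "fexp (n - k) \<alpha> = cis pi \<or> fexp (n - k) \<alpha> = cis (- pi)" unfolding fexp_def by metis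
    then have "fexp (n - k) \<alpha> = - 1" by (auto simp: complex_eq_iff)
    then show ?thesis using fexp_add[of "n - k" k \<alpha>] by simp
  qed
  have "AE r in lborel. AE t in circ. u (r, t + \<alpha>) = fexp n \<alpha> * u (r, t)"
    using cyl.AE_pair[OF weight[of \<alpha>, unfolded cyl_eq]] by (simp add: fexp_def)
  then show ?thesis using sqint_slice[OF u]
  proof eventually_elim
    case (elim r)
    define F where "F = (\<lambda>t. u (r, t) * cnj (fexp k t))"
    have m: "(\<lambda>t. u (r, t)) \<in> borel_measurable borel" by (rule measurable_slice[OF L2_measurable[OF u]])
    have mF: "F \<in> borel_measurable borel"
      unfolding F_def cnj_fexp using m fexp_measurable by measurable
    have F: "integrable circ F"
      unfolding F_def by (intro sqint_mult_integrable elim sqint_cnj sqint_fexp)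
    have per: "F (t + 1) = F t" for t
      using u by (simp add: F_def L2_def periodic_def fexp_shift)
    have "fmode u k r = (LINT t|circ. F (t + \<alpha>))"
      unfolding integral_circ_shift[OF F per \<alpha>] by (simp add: F_def fmode_def fcoef_def)
    also have "\<dots> = (LINT t|circ. fexp n \<alpha> * cnj (fexp k \<alpha>) * F t)"
    proof (rule integral_cong_AE)
      show "(\<lambda>t. F (t + \<alpha>)) \<in> borel_measurable circ"
        by (intro measurable_circI measurable_compose[OF _ mF]) simp
      show "(\<lambda>t. fexp n \<alpha> * cnj (fexp k \<alpha>) * F t) \<in> borel_measurable circ"
        by (intro measurable_circI borel_measurable_times borel_measurable_const mF)
      show "AE t in circ. F (t + \<alpha>) = fexp n \<alpha> * cnj (fexp k \<alpha>) * F t"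
        using elim(1) by eventually_elim (simp add: F_def fexp_shift mult_ac)
    qed
    also have "\<dots> = fexp n \<alpha> * cnj (fexp k \<alpha>) * fmode u k r"
      by (subst integral_mult_right_zero) (simp add: F_def fmode_def fcoef_def)
    also have "fexp n \<alpha> * cnj (fexp k \<alpha>) = - 1"
      unfolding anti by (simp add: fexp_def cis_cnj cis_mult)
    finally show ?case by simp
  qed
qed

text \<open>An equivalence in \<open>d\<close>, because \<open>weight_mult\<close> is a definite
  description and needs uniqueness along with existence. A null vector in a basis would violate
  independence.\<close>

lemma has_L2_dim_null:
  assumes "\<And>u. u \<in> V \<Longrightarrow> AE p in cyl. u p = 0" shows "has_L2_dim V d \<longleftrightarrow> d = 0"
proof
  assume "has_L2_dim V d"
  then obtain B where B: "finite B" "card B = d" "B \<subseteq> V"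
    and ind: "\<And>c. (AE p in cyl. (\<Sum>b\<in>B. c b * b p) = 0) \<Longrightarrow> (\<forall>b\<in>B. c b = 0)"
    unfolding has_L2_dim_def by blast
  have "AE p in cyl. \<forall>b\<in>B. b p = 0" using B assms by (intro AE_finite_allI) auto
  then have "AE p in cyl. (\<Sum>b\<in>B. 1 * b p) = 0"
    by eventually_elim (simp add: sum.neutral)
  then have "B = {}" using ind[of "\<lambda>_. 1"] by auto
  then show "d = 0" using B by simp
next
  assume "d = 0"
  then show "has_L2_dim V d" unfolding has_L2_dim_def using assms by (intro exI[of _ "{}"]) auto
qed

text \<open>Two distinct basis vectors would both be multiples of \<open>b\<close> up to null
  functions, hence dependent.\<close>

lemma has_L2_dim_line:
  assumes b: "b \<in> V" "\<not> (AE p in cyl. b p = 0)"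
    and V: "\<And>u. u \<in> V \<Longrightarrow> \<exists>c. AE p in cyl. u p = c * b p"
  shows "has_L2_dim V d \<longleftrightarrow> d = 1"
proof
  assume "has_L2_dim V d"
  then obtain B where B: "finite B" "card B = d" "B \<subseteq> V"
    and ind: "\<And>c x. (AE p in cyl. (\<Sum>b\<in>B. c b * b p) = 0) \<Longrightarrow> x \<in> B \<Longrightarrow> c x = 0"
    and sp: "\<And>u. u \<in> V \<Longrightarrow> \<exists>c. AE p in cyl. u p = (\<Sum>b\<in>B. c b * b p)"
    unfolding has_L2_dim_def by blast
  have "B \<noteq> {}" using sp[OF b(1)] b(2) by auto
  moreover have "x = y" if xy: "x \<in> B" "y \<in> B" for x y
  proof (rule ccontr)
    assume "x \<noteq> y"
    obtain cx where cx: "AE p in cyl. x p = cx * b p" using V xy(1) B(3) by blast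
    obtain cy where cy: "AE p in cyl. y p = cy * b p" using V xy(2) B(3) by blast
    \<comment> \<open>The coefficients of the relation \<open>cy * x p - cx * y p = 0\<close>,
      written as a sum of two conditionals so that the finite sum splits.\<close>
    define c where "c z = (if z = x then cy else 0) + (if z = y then - cx else 0)" for z
    have sum_c: "(\<Sum>z\<in>B. c z * z p) = cy * x p - cx * y p" for p
    proof -
      have "(\<Sum>z\<in>B. c z * z p) = (\<Sum>z\<in>B. (if z = x then cy * x p else 0) + (if z = y then - cx * y p else 0))"
        by (intro sum.cong) (auto simp: c_def algebra_simps)
      then show ?thesis using B(1) xy by (simp add: sum.distrib)
    qed
    have "AE p in cyl. (\<Sum>z\<in>B. c z * z p) = 0"
      using cx cy by eventually_elim (simp add: sum_c)
    then have "c y = 0" using ind xy(2) by blast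
    then have "cx = 0" using \<open>x \<noteq> y\<close> by (simp add: c_def)
    then have "AE p in cyl. x p = 0" using cx by simp
    then have "AE p in cyl. (\<Sum>z\<in>B. (if z = x then 1 else 0) * z p) = 0"
    proof eventually_elim
      case (elim p)
      then show ?case by (intro sum.neutral) auto
    qed
    from ind[OF this xy(1)] show False by simp
  qed
  ultimately obtain x where "B = {x}" by blast
  then show "d = 1" using B by simp
next
  assume "d = 1"
  have "c b = 0" if "AE p in cyl. (\<Sum>b\<in>{b}. c b * b p) = 0" for c
  proof (rule ccontr)
    assume "c b \<noteq> 0"
    have "AE p in cyl. b p = 0" using that by eventually_elim (use \<open>c b \<noteq> 0\<close> in simp)
    then show False using b by blast
  qed
  moreover have "\<exists>c. AE p in cyl. u p = (\<Sum>b\<in>{b}. c b * b p)" if "u \<in> V" for u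
  proof -
    obtain c where "AE p in cyl. u p = c * b p" using V[OF \<open>u \<in> V\<close>] by blast
    then show ?thesis by (intro exI[of _ "\<lambda>_. c"]) simp
  qed
  ultimately show "has_L2_dim V d" unfolding has_L2_dim_def using b \<open>d = 1\<close> by (intro exI[of _ "{b}"]) auto
qed

lemma weight_mult_eqI:
  assumes "\<And>d. has_L2_dim (weight_space K n) d \<longleftrightarrow> d = k"
  shows "finite_mult K n" "weight_mult K n = k"
  using assms by (auto simp: finite_mult_def weight_mult_def)

text \<open>The cylinder is not a null set, so a nowhere vanishing section is not a null
  function.\<close>

lemma not_AE_cyl_False: "\<not> (AE p in cyl. False)"
proof
  assume "AE p in cyl. False"
  then have "AE r in (lborel :: real measure). AE t in circ. False"
    unfolding cyl_eq by (rule cyl.AE_pair)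
  then show False by (simp add: eventually_False ae_filter_eq_bot_iff emeasure_circ_space)
qed

section \<open>Growth of the radial solutions\<close>

lemma powr_eventually_large:
  fixes e X :: real
  assumes "e > 0" shows "\<exists>T. \<forall>r\<ge>T. X \<le> r powr e"
proof (intro exI allI impI)
  fix r :: real assume r: "r \<ge> max X 1 powr (1 / e)"
  have "X \<le> (max X 1 powr (1 / e)) powr e" using assms by (simp add: powr_powr)
  also have "\<dots> \<le> r powr e" using r assms by (intro powr_mono2) auto
  finally show "X \<le> r powr e" .
qed

text \<open>The threshold makes \<open>(1 + Y) / 2\<close> exceed \<open>\<bar>n\<bar> + 1\<close>,
  and \<open>1/2\<close> is the smallest modulus a half-integer plateau can have.\<close>

lemma drift_bound:
  fixes Y h n :: real
  assumes "Y \<ge> 2 * \<bar>n\<bar> + 2"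
  shows "h \<ge> 1/2 \<Longrightarrow> n - (h + Y * h) \<le> - 1" "h \<le> - 1/2 \<Longrightarrow> n - (h + Y * h) \<ge> 1"
proof -
  assume "h \<ge> 1/2"
  then have "(1 + Y) * (1/2) \<le> (1 + Y) * h" using assms by (intro mult_left_mono) auto
  then show "n - (h + Y * h) \<le> - 1" using assms by (simp add: algebra_simps abs_if split: if_splits)
next
  assume "h \<le> - 1/2"
  then have "(1 + Y) * (1 + 2 * h) \<le> 0" using assms by (intro mult_nonneg_nonpos) auto
  then have "1 + Y \<le> - 2 * (h + Y * h)" by (simp add: algebra_simps)
  moreover have "- n \<le> \<bar>n\<bar>" by (rule abs_ge_minus_self)
  moreover define z where "z = h + Y * h"
  ultimately show "n - (h + Y * h) \<ge> 1" using assms unfolding z_def[symmetric] by linarith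
qed

text \<open>At the right end the plateau is \<open>m + 1/2\<close>, so \<open>m = 0\<close> falls on
  the positive side of the case split.\<close>

lemma drift_right:
  assumes "\<And>r. r > real_of_int m + 1/2 \<Longrightarrow> \<rho> r = real_of_int m + 1/2"
    and "\<And>r. \<bar>r\<bar> \<ge> R \<Longrightarrow> f r = \<bar>r\<bar>" and "e > 0"
  shows "\<exists>T. \<forall>r\<ge>T. (m \<ge> 0 \<longrightarrow> real_of_int n - (\<rho> r + f r powr e * \<rho> r) \<le> - 1)
    \<and> (m < 0 \<longrightarrow> real_of_int n - (\<rho> r + f r powr e * \<rho> r) \<ge> 1)"
proof -
  obtain T where T: "\<And>r. r \<ge> T \<Longrightarrow> 2 * \<bar>real_of_int n\<bar> + 2 \<le> r powr e"
    using powr_eventually_large[OF assms(3)] by blast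
  show ?thesis
  proof (intro exI allI impI)
    fix r assume r: "r \<ge> max (max T \<bar>R\<bar>) (real_of_int m + 1)"
    then have "f r = r" "\<rho> r = real_of_int m + 1/2" using assms(1,2)[of r] by auto
    moreover have "2 * \<bar>real_of_int n\<bar> + 2 \<le> r powr e" using r by (intro T) auto
    moreover have "m < 0 \<Longrightarrow> real_of_int m + 1/2 \<le> - 1/2" by linarith
    ultimately show "(m \<ge> 0 \<longrightarrow> real_of_int n - (\<rho> r + f r powr e * \<rho> r) \<le> - 1)
        \<and> (m < 0 \<longrightarrow> real_of_int n - (\<rho> r + f r powr e * \<rho> r) \<ge> 1)"
      using drift_bound[of "real_of_int n" "r powr e" "real_of_int m + 1/2"] by simp
  qed
qed

text \<open>At the left end the plateau is \<open>m - 1/2\<close>, so \<open>m = 0\<close> falls on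
  the negative side; this difference from the right end singles out \<open>m = 0\<close>.\<close>

lemma drift_left:
  assumes "\<And>r. r < real_of_int m - 1/2 \<Longrightarrow> \<rho> r = real_of_int m - 1/2"
    and "\<And>r. \<bar>r\<bar> \<ge> R \<Longrightarrow> f r = \<bar>r\<bar>" and "e > 0"
  shows "\<exists>T. \<forall>r\<le>T. (m > 0 \<longrightarrow> real_of_int n - (\<rho> r + f r powr e * \<rho> r) \<le> - 1)
    \<and> (m \<le> 0 \<longrightarrow> real_of_int n - (\<rho> r + f r powr e * \<rho> r) \<ge> 1)"
proof -
  obtain T where T: "\<And>r. r \<ge> T \<Longrightarrow> 2 * \<bar>real_of_int n\<bar> + 2 \<le> r powr e"
    using powr_eventually_large[OF assms(3)] by blast
  show ?thesis
  proof (intro exI allI impI)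
    fix r assume r: "r \<le> min (min (- T) (- \<bar>R\<bar>)) (real_of_int m - 1)"
    then have "f r = - r" "\<rho> r = real_of_int m - 1/2" using assms(1,2)[of r] by auto
    moreover have "2 * \<bar>real_of_int n\<bar> + 2 \<le> (- r) powr e" using r by (intro T) auto
    moreover have "m > 0 \<Longrightarrow> real_of_int m - 1/2 \<ge> 1/2" by linarith
    ultimately show "(m > 0 \<longrightarrow> real_of_int n - (\<rho> r + f r powr e * \<rho> r) \<le> - 1)
        \<and> (m \<le> 0 \<longrightarrow> real_of_int n - (\<rho> r + f r powr e * \<rho> r) \<ge> 1)"
      using drift_bound[of "real_of_int n" "(- r) powr e" "real_of_int m - 1/2"] by simp
  qed
qed

text \<open>Supplies the long intervals for \<open>coefficient_zero\<close>: the half-line beyond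
  \<open>T\<close> contains one of every length.\<close>

lemma bounded_below_right:
  fixes B :: "real \<Rightarrow> real"
  assumes "\<And>r. (B has_real_derivative B' r) (at r)" "\<And>r. r \<ge> T \<Longrightarrow> 0 \<le> B' r"
  shows "\<exists>L. \<forall>K. \<exists>a. \<forall>r\<in>{a..a + real K}. L \<le> B r"
proof (intro exI allI ballI)
  fix K r assume r: "r \<in> {T..T + real K}"
  show "B T \<le> B r"
  proof (rule DERIV_nonneg_imp_nondecreasing[of T r B])
    show "\<exists>y. (B has_real_derivative y) (at x) \<and> 0 \<le> y" if "T \<le> x" for x
      using assms(1)[of x] assms(2)[OF that] by blast
  qed (use r in simp)
qed

lemma bounded_below_left:
  fixes B :: "real \<Rightarrow> real"
  assumes "\<And>r. (B has_real_derivative B' r) (at r)" "\<And>r. r \<le> T \<Longrightarrow> B' r \<le> 0"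
  shows "\<exists>L. \<forall>K. \<exists>a. \<forall>r\<in>{a..a + real K}. L \<le> B r"
proof (intro exI allI ballI)
  \<comment> \<open>Towards the left, the interval of length \<open>K\<close> has to end at
    \<open>T\<close>.\<close>
  fix K r assume r: "r \<in> {T - real K..T - real K + real K}"
  show "B T \<le> B r"
  proof (rule DERIV_nonpos_imp_nonincreasing[of r T B])
    show "\<exists>y. (B has_real_derivative y) (at x) \<and> y \<le> 0" if "x \<le> T" for x
      using assms(1)[of x] assms(2)[OF that] by blast
  qed (use r in simp)
qed

text \<open>The one-sided exponential plus its reflection is a majorant, with equality except at
  0.\<close>

lemma integrable_exp_abs: "integrable lborel (\<lambda>x::real. exp (- \<bar>x\<bar>))"
proof -
  define g :: "real \<Rightarrow> real" where "g x = exp (- x) * indicator {0..} x" for x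
  have lim: "((\<lambda>x::real. - exp (- x)) \<longlongrightarrow> 0) at_top"
    using tendsto_minus[OF filterlim_compose[OF exp_at_bot filterlim_uminus_at_bot_at_top]] by simp
  have "(\<integral>\<^sup>+x. ennreal (exp (- x)) * indicator {0..} x \<partial>lborel) = 0 - (- exp (- 0::real))"
    by (rule nn_integral_FTC_atLeast[OF _ _ _ lim]) (auto intro!: derivative_eq_intros)
  moreover have "ennreal (exp (- x)) * indicator {0..} x = ennreal (g x)" for x :: real
    by (simp add: g_def indicator_def)
  ultimately have g: "integrable lborel g"
    by (intro integrableI_nonneg) (auto simp: g_def[abs_def])
  have "integrable lborel (\<lambda>x. g (0 + (- 1) * x))"
    using g by (subst lborel_integrable_real_affine_iff) auto
  then have "integrable lborel (\<lambda>x. g x + g (- x))" using g by simp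
  then show ?thesis
    by (rule Bochner_Integration.integrable_bound) (auto simp: g_def indicator_def)
qed

text \<open>The slope bounds make \<open>A r + \<bar>r\<bar>\<close> nonincreasing to the right of
  \<open>T\<close> and nondecreasing up to \<open>- T\<close>, so a bound on \<open>{-T..T}\<close>
  is a global upper bound.\<close>

lemma sqint_exp_decaying:
  assumes A: "\<And>r. (A has_real_derivative A' r) (at r)"
    and right: "\<And>r. r \<ge> T1 \<Longrightarrow> A' r \<le> - 1" and left: "\<And>r. r \<le> T2 \<Longrightarrow> A' r \<ge> 1"
  shows "sqint lborel (\<lambda>r. complex_of_real (exp (2 * pi * A r)))"
proof -
  define T where "T = max \<bar>T1\<bar> \<bar>T2\<bar>"
  have c: "continuous_on S A" for S using A DERIV_isCont continuous_at_imp_continuous_on by blast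
  have "continuous_on {-T..T} (\<lambda>r. A r + \<bar>r\<bar>)" by (intro continuous_intros c)
  then obtain B where B: "\<And>r. r \<in> {-T..T} \<Longrightarrow> norm (A r + \<bar>r\<bar>) \<le> B"
    using continuous_on_compact_bounded[OF compact_Icc] by meson
  have T: "T \<ge> 0" "T1 \<le> T" "- T \<le> T2" by (auto simp: T_def)
  have le: "A r + \<bar>r\<bar> \<le> B" for r
  proof -
    consider "r \<in> {-T..T}" | "r > T" | "r < - T" by fastforce
    then show ?thesis
    proof cases
      case 1 then show ?thesis using B by fastforce
    next
      case 2
      have "A r + r \<le> A T + T"
      proof (rule DERIV_nonpos_imp_nonincreasing[of T r "\<lambda>x. A x + x"])
        fix x assume "T \<le> x"
        then have "((\<lambda>x. A x + x) has_real_derivative A' x + 1) (at x)" "A' x + 1 \<le> 0"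
          using right[of x] T by (auto intro!: derivative_intros A)
        then show "\<exists>y. ((\<lambda>x. A x + x) has_real_derivative y) (at x) \<and> y \<le> 0" by blast
      qed (use 2 in simp)
      moreover have "A T + T \<le> B" using B[of T] T by simp
      ultimately show ?thesis using 2 T by simp
    next
      case 3
      have "A r - r \<le> A (- T) - (- T)"
      proof (rule DERIV_nonneg_imp_nondecreasing[of r "- T" "\<lambda>x. A x - x"])
        fix x assume "x \<le> - T"
        then have "((\<lambda>x. A x - x) has_real_derivative A' x - 1) (at x)" "A' x - 1 \<ge> 0"
          using left[of x] T by (auto intro!: derivative_intros A)
        then show "\<exists>y. ((\<lambda>x. A x - x) has_real_derivative y) (at x) \<and> 0 \<le> y" by blast
      qed (use 3 in simp)
      moreover have "A (- T) + T \<le> B" using B[of "- T"] T by simp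
      ultimately show ?thesis using 3 T by simp
    qed
  qed
  show ?thesis
  proof (rule sqint_bound)
    show "(\<lambda>r. complex_of_real (exp (2 * pi * A r))) \<in> borel_measurable lborel"
      using borel_measurable_continuous_onI[OF c] by measurable
    show "integrable lborel (\<lambda>r. exp (4 * pi * B) * exp (- \<bar>r\<bar>))"
      by (intro integrable_mult_right integrable_exp_abs)
    show "AE r in lborel. (cmod (complex_of_real (exp (2 * pi * A r))))\<^sup>2 \<le> exp (4 * pi * B) * exp (- \<bar>r\<bar>)"
    proof (rule AE_I2)
      fix r
      have "4 * pi * (A r + \<bar>r\<bar>) \<le> 4 * pi * B" using le[of r] by simp
      \<comment> \<open>The surplus factor \<open>4 * pi\<close> is given away to reach the majorant
        \<open>exp (- \<bar>r\<bar>)\<close>.\<close>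
      moreover have "1 * \<bar>r\<bar> \<le> 4 * pi * \<bar>r\<bar>" using pi_gt3 by (intro mult_right_mono) auto
      ultimately have "4 * pi * A r \<le> 4 * pi * B - \<bar>r\<bar>" by (simp add: algebra_simps)
      moreover have "(exp (2 * pi * A r))\<^sup>2 = exp (4 * pi * A r)"
        by (simp add: power2_eq_square flip: exp_add)
      ultimately show "(cmod (complex_of_real (exp (2 * pi * A r))))\<^sup>2 \<le> exp (4 * pi * B) * exp (- \<bar>r\<bar>)"
        by (simp flip: exp_add)
    qed
  qed
qed

text \<open>The case of vanishing Kronecker delta: the span contains only the zero function, but its
  closure contains every representative of zero.\<close>

lemma L2_closure_zero: "L2_closure (cspan (range (\<lambda>n::int. \<lambda>p. 0))) = L2_null"
proof (intro equalityI subsetI)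
  fix u assume u: "u \<in> L2_closure (cspan (range (\<lambda>n::int. \<lambda>p. 0)))"
  then have L: "u \<in> L2" by (simp add: L2_closure_def)
  have "(LINT p|cyl. (cmod (u p))\<^sup>2) \<le> 0"
  proof (rule field_le_epsilon)
    fix e :: real assume "e > 0"
    then obtain v where v: "v \<in> cspan (range (\<lambda>n::int. \<lambda>p. 0))" "(LINT p|cyl. (cmod (u p - v p))\<^sup>2) < e"
      using u by (auto simp: L2_closure_def)
    obtain F c where "F \<subseteq> range (\<lambda>n::int. \<lambda>p. 0)" "v = (\<lambda>p. \<Sum>w\<in>F. c w * w p)"
      using v(1) by (auto simp: cspan_def)
    then have "v p = 0" for p by (auto intro!: sum.neutral)
    then show "(LINT p|cyl. (cmod (u p))\<^sup>2) \<le> 0 + e" using v(2) by simp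
  qed
  moreover have "(LINT p|cyl. (cmod (u p))\<^sup>2) \<ge> 0" by (intro integral_nonneg_AE) auto
  ultimately have "AE p in cyl. u p = 0" by (intro sqint_zero_AE L2_sqint L) simp
  then show "u \<in> L2_null" using L by (simp add: L2_null_def)
next
  fix u assume "u \<in> L2_null"
  then have L: "u \<in> L2" and null: "AE p in cyl. u p = 0" by (auto simp: L2_null_def)
  have "(\<lambda>p. 0) \<in> cspan (range (\<lambda>n::int. \<lambda>p. 0))"
    unfolding cspan_def by (intro CollectI exI[of _ "{}"]) simp
  moreover have "(\<lambda>p. 0) \<in> L2" by (simp add: L2_def periodic_def)
  moreover have "(LINT p|cyl. (cmod (u p - 0))\<^sup>2) = 0"
    by (rule integral_eq_zero_AE) (use null in eventually_elim, simp)
  ultimately have "\<exists>v\<in>cspan (range (\<lambda>n::int. \<lambda>p. 0)) \<inter> L2. (LINT p|cyl. (cmod (u p - v p))\<^sup>2) < e"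
    if "e > 0" for e
    using that by (intro bexI[of _ "\<lambda>p. 0"]) simp_all
  then show "u \<in> L2_closure (cspan (range (\<lambda>n::int. \<lambda>p. 0)))"
    unfolding L2_closure_def using L by blast
qed

text \<open>\<open>cspan\<close> sums over a set of functions, so the coefficients of indices
  sharing the same \<open>e n\<close> are collected in \<open>d\<close>.\<close>

lemma cspan_sum:
  assumes "finite I" shows "(\<lambda>p. \<Sum>n\<in>I. c n * e n p) \<in> cspan (range e)"
proof -
  define d where "d v = (\<Sum>n\<in>{n \<in> I. e n = v}. c n)" for v
  have "(\<Sum>n\<in>I. c n * e n p) = (\<Sum>v\<in>e ` I. d v * v p)" for p
  proof -
    have "(\<Sum>n\<in>I. c n * e n p) = (\<Sum>v\<in>e ` I. \<Sum>n\<in>{n \<in> I. e n = v}. c n * e n p)"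
      by (rule sum.image_gen[OF assms])
    also have "\<dots> = (\<Sum>v\<in>e ` I. d v * v p)"
      unfolding d_def sum_distrib_right by (intro sum.cong) auto
    finally show ?thesis .
  qed
  then show ?thesis
    unfolding cspan_def using assms by (intro CollectI exI[of _ "e ` I"] exI[of _ d]) auto
qed

text \<open>Partial Fourier sums of a solution agree almost everywhere with finite combinations of
  the \<open>E n\<close>; the other inclusion is closedness of the kernel.\<close>

lemma ker_sgn_eq_closure:
  fixes E :: "int \<Rightarrow> real \<times> real \<Rightarrow> complex"
  assumes H: "smooth_step H" and q: "continuous_on UNIV q"
    and A: "\<And>n. smooth1 (A n)" "\<And>n r. (A n has_real_derivative of_int n - q r) (at r)"
    and E_def: "\<And>n. E n = mode 1 (\<lambda>r. exp (2 * pi * \<tau> * A n r)) n"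
    and E: "\<And>n. E n \<in> L2"
  shows "ker_sgn q \<tau> = L2_closure (cspan (range E))"
proof
  have "range E \<subseteq> ker_sgn q \<tau>"
    using mode_solution_in_ker[OF A(2) q] E unfolding E_def by blast
  then show "L2_closure (cspan (range E)) \<subseteq> ker_sgn q \<tau>"
    by (intro L2_closure_subset_ker_sgn cspan_subset_ker_sgn q)
next
  show "ker_sgn q \<tau> \<subseteq> L2_closure (cspan (range E))"
  proof
    fix u assume u: "u \<in> ker_sgn q \<tau>"
    have L: "u \<in> L2" by (rule ker_sgn_L2[OF u])
    have "\<exists>c. AE r in lborel. fmode u n r = c * complex_of_real (exp (2 * pi * \<tau> * A n r))" for n
      by (rule fmode_solution[OF H u A])
    then obtain c where c: "\<And>n. AE r in lborel. fmode u n r = c n * complex_of_real (exp (2 * pi * \<tau> * A n r))"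
      by metis
    have "\<exists>v\<in>cspan (range E) \<inter> L2. (LINT p|cyl. (cmod (u p - v p))\<^sup>2) < e" if e: "e > 0" for e
    proof -
      have "\<forall>\<^sub>F N in sequentially. (LINT p|cyl. (cmod (u p - (\<Sum>n\<in>{- int N..int N}. fmode u n (fst p) * fexp n (snd p))))\<^sup>2) < e"
        using order_tendstoD(2)[OF fourier_cyl[OF L] e] .
      then obtain N where N: "(LINT p|cyl. (cmod (u p - (\<Sum>n\<in>{- int N..int N}. fmode u n (fst p) * fexp n (snd p))))\<^sup>2) < e"
        by (meson eventually_sequentially order_refl)
      define v where "v p = (\<Sum>n\<in>{- int N..int N}. c n * E n p)" for p
      have v: "v \<in> cspan (range E)" "v \<in> L2"
        unfolding v_def by (intro cspan_sum finite_atLeastAtMost_int) (intro L2_sum E)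
      have "(LINT p|cyl. (cmod (u p - v p))\<^sup>2)
          = (LINT p|cyl. (cmod (u p - (\<Sum>n\<in>{- int N..int N}. fmode u n (fst p) * fexp n (snd p))))\<^sup>2)"
      proof (rule integral_cong_AE)
        show "(\<lambda>p. (cmod (u p - v p))\<^sup>2) \<in> borel_measurable cyl"
          by (intro borel_measurable_integrable sqint_integrable sqint_diff L2_sqint L v)
        show "(\<lambda>p. (cmod (u p - (\<Sum>n\<in>{- int N..int N}. fmode u n (fst p) * fexp n (snd p))))\<^sup>2) \<in> borel_measurable cyl"
          by (intro borel_measurable_integrable sqint_integrable sqint_diff L2_sqint L sqint_sum
              sqint_cyl_separated sqint_fmode)
        have "AE r in lborel. \<forall>n. fmode u n r = c n * complex_of_real (exp (2 * pi * \<tau> * A n r))"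
          unfolding AE_all_countable using c by blast
        from AE_cyl_fst[OF this]
        show "AE p in cyl. (cmod (u p - v p))\<^sup>2
            = (cmod (u p - (\<Sum>n\<in>{- int N..int N}. fmode u n (fst p) * fexp n (snd p))))\<^sup>2"
        proof eventually_elim
          case (elim p)
          then show ?case by (simp add: v_def E_def mode_def mult.assoc)
        qed
      qed
      then show ?thesis using v N by (intro bexI[of _ v]) simp_all
    qed
    then show "u \<in> L2_closure (cspan (range E))" using L by (simp add: L2_closure_def)
  qed
qed

text \<open>The weight condition leaves only the \<open>n\<close>-th mode, a multiple of
  \<open>E\<close>, and \<open>E\<close> vanishes nowhere.\<close>

lemma has_L2_dim_weight_space:
  fixes E :: "real \<times> real \<Rightarrow> complex"
  assumes H: "smooth_step H" and q: "continuous_on UNIV q"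
    and A: "smooth1 A" "\<And>r. (A has_real_derivative of_int n - q r) (at r)"
    and E_def: "E = mode 1 (\<lambda>r. exp (2 * pi * \<tau> * A r)) n"
    and E: "E \<in> L2"
  shows "has_L2_dim (weight_space (ker_sgn q \<tau>) n) d \<longleftrightarrow> d = 1"
proof (rule has_L2_dim_line[where b = E])
  have "E \<in> ker_sgn q \<tau>" using mode_solution_in_ker[OF A(2) q] E unfolding E_def by blast
  then show "E \<in> weight_space (ker_sgn q \<tau>) n"
    by (auto simp: weight_space_def E_def mode_def fexp_shift) (simp add: fexp_def)
  have ne: "E p \<noteq> 0" for p by (simp add: E_def mode_def fexp_def)
  show "\<not> (AE p in cyl. E p = 0)" using ne not_AE_cyl_False by simp
next
  fix u assume "u \<in> weight_space (ker_sgn q \<tau>) n"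
  then have u: "u \<in> ker_sgn q \<tau>"
    and w: "\<And>\<alpha>. AE p in cyl. u (fst p, snd p + \<alpha>) = cis (2 * pi * of_int n * \<alpha>) * u p"
    by (auto simp: weight_space_def)
  have L: "u \<in> L2" by (rule ker_sgn_L2[OF u])
  obtain c where c: "AE r in lborel. fmode u n r = c * complex_of_real (exp (2 * pi * \<tau> * A r))"
    using fmode_solution[OF H u A] by blast
  have "AE p in cyl. u p = fmode u n (fst p) * fexp n (snd p)"
    by (rule AE_eq_single_mode[OF L fmode_weight[OF L w]])
  then have "AE p in cyl. u p = c * E p"
    using AE_cyl_fst[OF c]
    by eventually_elim (simp add: E_def mode_def)
  then show "\<exists>c. AE p in cyl. u p = c * E p" by blast
qed

section \<open>Kernels and multiplicities for both values of the Kronecker delta\<close>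

theorem propositionA2:
  fixes m :: int and \<rho> f :: "real \<Rightarrow> real" and \<epsilon>\<^sub>1 \<epsilon>\<^sub>2 :: real
    and A :: "int \<Rightarrow> real \<Rightarrow> real" and a :: "int \<Rightarrow> real \<Rightarrow> real"
    and e :: "int \<Rightarrow> real \<times> real \<Rightarrow> complex"
  assumes "smooth_fun \<rho>" and "mono \<rho>"
    and "\<And>r. real_of_int m - 1/4 < r \<Longrightarrow> r < real_of_int m + 1/4 \<Longrightarrow> \<rho> r = r"
    and "\<And>r. r < real_of_int m - 1/2 \<Longrightarrow> \<rho> r = real_of_int m - 1/2"
    and "\<And>r. r > real_of_int m + 1/2 \<Longrightarrow> \<rho> r = real_of_int m + 1/2"
    and "smooth_fun f" and "\<And>r. f r > 0" and "\<exists>R. \<forall>r. \<bar>r\<bar> \<ge> R \<longrightarrow> f r = \<bar>r\<bar>"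
    and "\<epsilon>\<^sub>1 > \<epsilon>\<^sub>2" and "\<epsilon>\<^sub>2 \<ge> 0"
    and "\<And>n r. (A n has_real_derivative ((real_of_int n - \<rho> r) - f r powr \<epsilon>\<^sub>1 * \<rho> r)) (at r)"
    and "\<And>n r. a n r = exp (2 * pi * A n r)"
    and "\<And>n r \<theta>. e n (r, \<theta>) =
           (if m = 0 then 1 else 0) * complex_of_real (a n r) * exp (2 * pi * \<i> * of_int n * \<theta>)"
  shows "range e \<subseteq> L2
    \<and> ker_plus \<rho> f 1 0 \<epsilon>\<^sub>1 \<epsilon>\<^sub>2 = L2_closure (cspan (range e))
    \<and> ker_minus \<rho> f 1 0 \<epsilon>\<^sub>1 \<epsilon>\<^sub>2 = L2_null
    \<and> (\<forall>n. finite_mult (ker_plus \<rho> f 1 0 \<epsilon>\<^sub>1 \<epsilon>\<^sub>2) n \<and> finite_mult (ker_minus \<rho> f 1 0 \<epsilon>\<^sub>1 \<epsilon>\<^sub>2) n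
         \<and> transverse_index \<rho> f \<epsilon>\<^sub>1 \<epsilon>\<^sub>2 n = (if m = 0 then 1 else 0))"
proof -
  define q where "q r = \<rho> r + f r powr \<epsilon>\<^sub>1 * \<rho> r" for r
  have kp: "ker_plus \<rho> f 1 0 \<epsilon>\<^sub>1 \<epsilon>\<^sub>2 = ker_sgn q 1" and km: "ker_minus \<rho> f 1 0 \<epsilon>\<^sub>1 \<epsilon>\<^sub>2 = ker_sgn q (- 1)"
    unfolding q_def by (rule ker_plus_eq, rule ker_minus_eq)
  obtain H where H: "smooth_step H" using smooth_stepI[OF assms(1,2,4,5)] by blast
  have sq: "smooth1 q" unfolding q_def
    by (intro smooth1.add smooth1.mult smooth1_powr smooth1.base assms(1,6,7))
  have q: "continuous_on UNIV q" by (rule smooth1_continuous[OF sq])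
  have A': "(A n has_real_derivative of_int n - q r) (at r)" for n r
    using assms(11)[of n r] by (simp add: q_def algebra_simps)
  have A: "smooth1 (A n)" for n
    by (rule smooth1.primitive[OF smooth1_diff[OF smooth1.const sq] A'])
  obtain R where R: "\<And>r. \<bar>r\<bar> \<ge> R \<Longrightarrow> f r = \<bar>r\<bar>" using assms(8) by blast
  have "\<epsilon>\<^sub>1 > 0" using assms(9,10) by simp
  have right: "\<exists>T. \<forall>r\<ge>T. (m \<ge> 0 \<longrightarrow> of_int n - q r \<le> - 1) \<and> (m < 0 \<longrightarrow> of_int n - q r \<ge> 1)" for n
    unfolding q_def by (rule drift_right[where f = f, OF assms(5) R \<open>\<epsilon>\<^sub>1 > 0\<close>])
  have left: "\<exists>T. \<forall>r\<le>T. (m > 0 \<longrightarrow> of_int n - q r \<le> - 1) \<and> (m \<le> 0 \<longrightarrow> of_int n - q r \<ge> 1)" for n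
    unfolding q_def by (rule drift_left[where f = f, OF assms(4) R \<open>\<epsilon>\<^sub>1 > 0\<close>])
  have dA: "((\<lambda>r. \<tau> * A n r) has_real_derivative \<tau> * (of_int n - q r)) (at r)" for \<tau> n r
    by (rule DERIV_cmult[OF A'])
  have minus: "ker_sgn q (- 1) = L2_null"
  proof (rule ker_sgn_eq_L2_null[OF H A A'])
    fix n
    show "\<exists>L. \<forall>K. \<exists>a. \<forall>r\<in>{a..a + real K}. L \<le> - 1 * A n r"
    \<comment> \<open>The reciprocal solution grows at the right end for \<open>m \<ge> 0\<close>
      and at the left end for \<open>m < 0\<close>.\<close>
    proof (cases "m \<ge> 0")
      case True
      obtain T where "\<And>r. r \<ge> T \<Longrightarrow> of_int n - q r \<le> - 1" using right[of n] True by blast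
      then show ?thesis by (intro bounded_below_right[OF dA, of T]) force
    next
      case False
      obtain T where "\<And>r. r \<le> T \<Longrightarrow> of_int n - q r \<ge> 1" using left[of n] False by force
      then show ?thesis by (intro bounded_below_left[OF dA, of T]) force
    qed
  qed
  have null: "has_L2_dim (weight_space L2_null n) d \<longleftrightarrow> d = 0" for n d
    by (rule has_L2_dim_null) (auto simp: weight_space_def L2_null_def)
  have mult_minus: "finite_mult (ker_sgn q (- 1)) n" "weight_mult (ker_sgn q (- 1)) n = 0" for n
    unfolding minus by (rule weight_mult_eqI[OF null])+
  show ?thesis
  proof (cases "m = 0")
    case True
    \<comment> \<open>The factor \<open>1\<close> keeps the exponent in the shape
      \<open>2 * pi * \<tau> * A n r\<close> with \<open>\<tau> = 1\<close>.\<close>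
    have e: "e n = mode 1 (\<lambda>r. exp (2 * pi * 1 * A n r)) n" for n
    proof
      fix p :: "real \<times> real"
      show "e n p = mode 1 (\<lambda>r. exp (2 * pi * 1 * A n r)) n p"
        using assms(13)[of n "fst p" "snd p"] True
        by (simp add: assms(12) mode_def fexp_def cis_conv_exp mult_ac)
    qed
    have eL2: "e n \<in> L2" for n
    proof (rule L2I)
      \<comment> \<open>Decay at the right end comes from \<open>m \<ge> 0\<close> and decay at the
        left end from \<open>m \<le> 0\<close>; only \<open>m = 0\<close> meets both.\<close>
      obtain T1 where T1: "\<And>r. r \<ge> T1 \<Longrightarrow> of_int n - q r \<le> - 1" using right[of n] True by auto
      obtain T2 where T2: "\<And>r. r \<le> T2 \<Longrightarrow> of_int n - q r \<ge> 1" using left[of n] True by auto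
      have "sqint lborel (\<lambda>r. complex_of_real (exp (2 * pi * A n r)))"
        by (rule sqint_exp_decaying[OF A' T1 T2])
      from sqint_cyl_separated[OF this, of n]
      show "sqint cyl (e n)" unfolding e mode_def by simp
      show "e n \<in> borel_measurable borel"
        unfolding e by (intro borel_measurable_continuous_onI continuous_mode smooth1_continuous smooth1.exp smooth1_cmult A)
      show "periodic (e n)" unfolding e by (rule periodic_mode)
    qed
    have plus: "ker_sgn q 1 = L2_closure (cspan (range e))"
      by (rule ker_sgn_eq_closure[OF H q A A' e eL2])
    have "finite_mult (ker_sgn q 1) n" "weight_mult (ker_sgn q 1) n = 1" for n
      by (rule weight_mult_eqI[OF has_L2_dim_weight_space[OF H q A A' e eL2]])+
    then show ?thesis
      using True eL2 minus mult_minus plus by (auto simp: transverse_index_def kp km)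
  next
    case False
    have plus: "ker_sgn q 1 = L2_null"
    proof (rule ker_sgn_eq_L2_null[OF H A A'])
      fix n
      show "\<exists>L. \<forall>K. \<exists>a. \<forall>r\<in>{a..a + real K}. L \<le> 1 * A n r"
      \<comment> \<open>The formal solution grows at the left end for \<open>m > 0\<close> and at
        the right end for \<open>m < 0\<close>.\<close>
      proof (cases "m > 0")
        case True
        obtain T where "\<And>r. r \<le> T \<Longrightarrow> of_int n - q r \<le> - 1" using left[of n] True by blast
        then show ?thesis by (intro bounded_below_left[OF dA, of T]) force
      next
        case m: False
        obtain T where "\<And>r. r \<ge> T \<Longrightarrow> of_int n - q r \<ge> 1" using right[of n] False m by force
        then show ?thesis by (intro bounded_below_right[OF dA, of T]) force
      qed
    qed
    have "e n p = 0" for n p using assms(13)[of n "fst p" "snd p"] False by simp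
    then have e: "e = (\<lambda>n p. 0)" by (intro ext)
    have "L2_closure (cspan (range e)) = L2_null" unfolding e by (rule L2_closure_zero)
    moreover have "range e \<subseteq> L2" unfolding e by (auto simp: L2_def periodic_def)
    moreover have "finite_mult (ker_sgn q 1) n" "weight_mult (ker_sgn q 1) n = 0" for n
      unfolding plus by (rule weight_mult_eqI[OF null])+
    ultimately show ?thesis
      using False minus mult_minus plus by (auto simp: transverse_index_def kp km)
  qed
qed

end
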